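(* Consider the setting and assumptions (A1)–(A3) described in the context, along a sequence $n\to\infty$ with $d=d_n\to\infty$. Suppose (A1), (A2), (A3) hold and $s=o\big(\sqrt n/(\sqrt{\log n}\,\log d)\big)$. If the regularization parameter is $\lambda_n=C\sqrt{\log d/n}$ for some (suitable) constant $C>0$ not depending on $n$, then $$\|\tilde{\boldsymbol\theta}-\boldsymbol\theta\|_2=O\!\left(\sqrt{\frac{s\log d}{n}}\right)\quad\text{and}\quad\|\tilde{\boldsymbol\theta}-\boldsymbol\theta\|_1=O\!\left(s\sqrt{\frac{\log d}{n}}\right)$$ with probability $1-o(1)$, as $n\to\infty$ and $d\to\infty$ such that $s\sqrt{\log d/n}=o(1)$. (That is, there is a constant $K'$ not depending on $n$ such that, with probability tending to $1$, the two norms are at most $K'\sqrt{s\log d/n}$ and $K's\sqrt{\log d/n}$ respectively.)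
   Context: **Model.** For each $n$, $\mathbf G_n=([n],E)$ is a hypergraph (hyperedges are subsets of $[n]$) with weights $g_{\mathbf e}\ge 0$, $\mathbf e\in E$. The covariates $\mathbf X_1,\dots,\mathbf X_n\in\mathbb R^d$ are i.i.d.; $\mathbf X$ is the $n\times d$ matrix with rows $\mathbf X_i^\top$. Given $\mathbf X$, the response $\mathbf y\in\{\pm1\}^n$ has conditional p.m.f. $$\mathbb P_{\boldsymbol\theta}(\mathbf y\mid\mathbf X)=\frac1{Z(\boldsymbol\theta)}\exp\Big(\sum_{\mathbf e\in E}g_{\mathbf e}\,\mathbf y_{\mathbf e}+\sum_{i=1}^n y_i\mathbf X_i^\top\boldsymbol\theta\Big),\qquad \mathbf y_{\mathbf e}=\prod_{i\in\mathbf e}y_i,$$ where $Z(\boldsymbol\theta)$ is the normalizing constant and $\boldsymbol\theta\in\mathbb R^d$ is the unknown parameter. A single realization $(\mathbf y,\mathbf X)$ is observed. For $i\in[n]$ put $m_i(\mathbf y)=\sum_{\mathbf e\in E:\,i\in\mathbf e}g_{\mathbf e}\prod_{j\in\mathbf e\setminus\{i\}}y_j$. **Assumptions.** (A1) $\sup_n\max_{i\in[n]}\sum_{\mathbf e:\,i\in\mathbf e}g_{\mathbf e}\le 1$ and $\sup_n\max_{i\in[n]}|\mathcal N_i|=\Delta<\infty$, where $\mathcal N_i=\{j\in[n]:\exists\,\mathbf e\in E,\ i,j\in\mathbf e\}$. (A2) $\|\boldsymbol\theta\|_0=s$ and $\|\boldsymbol\theta\|_2\le K$ for some constant $K>0$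 independent of $n$. (A3) The $\mathbf X_i$ are i.i.d. sub-Gaussian vectors with sub-Gaussian norm bounded by a constant independent of $n$, and $\boldsymbol\Sigma=\mathbb E(\mathbf X_1\mathbf X_1^\top)$ satisfies $1/\kappa\le\lambda_{\min}(\boldsymbol\Sigma)\le\lambda_{\max}(\boldsymbol\Sigma)\le\kappa$ for some $\kappa>0$ independent of $n,d$. **Sample splitting.** A set $I\subseteq[n]$ is a strong independent set if $|I\cap\mathbf e|\le1$ for every $\mathbf e\in E$. $S=S(\mathbf G_n)$ is a strong independent set, chosen from $\mathbf G_n$ only, of even size with $|S|=\Omega(n)$ (i.e. $|S|\ge c_0n$ for some fixed $c_0>0$ and all large $n$), and $S=S_1\cup S_2$ is a split into two disjoint parts of equal size. **Estimator.** With $$L_{S_1}(\mathbf b)=-\frac1{|S_1|}\sum_{i\in S_1}\Big\{y_i\big(m_i(\mathbf y)+\mathbf X_i^\top\mathbf b\big)-\log\cosh\big(m_i(\mathbf y)+\mathbf X_i^\top\mathbf b\big)\Big\},$$ let $\tilde{\boldsymbol\theta}\in\operatorname{argmin}_{\mathbf b\in\mathbb R^d}\{L_{S_1}(\mathbf b)+\lambda_n\|\mathbf b\|_1\}$. *)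

theory Defs
  imports
    "HOL-Probability.Probability"
    "HOL-Library.Landau_Symbols"
    "Jordan_Normal_Form.Spectral_Radius"
begin

text \<open>
  The vertex set \<open>[n]\<close> is \<open>{..<n}\<close> and the coordinates of \<open>\<real>\<^sup>d\<close> are indexed by \<open>{..<d}\<close>.
  A vector of \<open>\<real>\<^sup>d\<close> is a function on \<open>{..<d}\<close>, extended by \<open>undefined\<close>; its
  Euclidean norm is \<open>L2_set v {..<d}\<close>.
\<close>

definition Rd :: "nat \<Rightarrow> (nat \<Rightarrow> real) set" where
  "Rd d = {..<d} \<rightarrow>\<^sub>E UNIV"

definition borel_Rd :: "nat \<Rightarrow> (nat \<Rightarrow> real) measure" where
  "borel_Rd d = PiM {..<d} (\<lambda>_. borel)"

definition dotp :: "nat \<Rightarrow> (nat \<Rightarrow> real) \<Rightarrow> (nat \<Rightarrow> real) \<Rightarrow> real" where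
  "dotp d v w = (\<Sum>k<d. v k * w k)"

definition l1_norm :: "nat \<Rightarrow> (nat \<Rightarrow> real) \<Rightarrow> real" where
  "l1_norm d v = (\<Sum>k<d. \<bar>v k\<bar>)"

definition l0_norm :: "nat \<Rightarrow> (nat \<Rightarrow> real) \<Rightarrow> nat" where
  "l0_norm d v = card {k\<in>{..<d}. v k \<noteq> 0}"


subsection \<open>Weighted hypergraphs\<close>

definition weighted_hypergraph :: "nat \<Rightarrow> nat set set \<Rightarrow> (nat set \<Rightarrow> real) \<Rightarrow> bool" where
  "weighted_hypergraph n E g \<longleftrightarrow> E \<subseteq> Pow {..<n} \<and> (\<forall>e\<in>E. 0 \<le> g e)"

definition neighbours :: "nat \<Rightarrow> nat set set \<Rightarrow> nat \<Rightarrow> nat set" where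
  "neighbours n E i = {j\<in>{..<n}. \<exists>e\<in>E. i \<in> e \<and> j \<in> e}"

definition strong_independent :: "nat \<Rightarrow> nat set set \<Rightarrow> nat set \<Rightarrow> bool" where
  "strong_independent n E I \<longleftrightarrow> I \<subseteq> {..<n} \<and> (\<forall>e\<in>E. card (I \<inter> e) \<le> 1)"

definition local_field :: "nat set set \<Rightarrow> (nat set \<Rightarrow> real) \<Rightarrow> (nat \<Rightarrow> real) \<Rightarrow> nat \<Rightarrow> real" where
  "local_field E g y i = (\<Sum>e | e \<in> E \<and> i \<in> e. g e * (\<Prod>j\<in>e - {i}. y j))"


subsection \<open>The conditional law of the responses\<close>

definition spins :: "nat \<Rightarrow> (nat \<Rightarrow> real) set" where
  "spins n = {..<n} \<rightarrow>\<^sub>E {-1, 1}"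

definition log_weight ::
  "nat \<Rightarrow> nat \<Rightarrow> nat set set \<Rightarrow> (nat set \<Rightarrow> real) \<Rightarrow> (nat \<Rightarrow> real) \<Rightarrow> (nat \<Rightarrow> nat \<Rightarrow> real)
    \<Rightarrow> (nat \<Rightarrow> real) \<Rightarrow> real" where
  "log_weight n d E g \<theta> x y =
     (\<Sum>e\<in>E. g e * (\<Prod>i\<in>e. y i)) + (\<Sum>i<n. y i * dotp d (x i) \<theta>)"

definition cond_pmf ::
  "nat \<Rightarrow> nat \<Rightarrow> nat set set \<Rightarrow> (nat set \<Rightarrow> real) \<Rightarrow> (nat \<Rightarrow> real) \<Rightarrow> (nat \<Rightarrow> nat \<Rightarrow> real)
    \<Rightarrow> (nat \<Rightarrow> real) \<Rightarrow> real" where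
  "cond_pmf n d E g \<theta> x y =
     exp (log_weight n d E g \<theta> x y) / (\<Sum>z\<in>spins n. exp (log_weight n d E g \<theta> x z))"

definition design :: "nat \<Rightarrow> (nat \<Rightarrow> 'a \<Rightarrow> nat \<Rightarrow> real) \<Rightarrow> 'a \<Rightarrow> nat \<Rightarrow> nat \<Rightarrow> real" where
  "design n X \<omega> = (\<lambda>i\<in>{..<n}. X i \<omega>)"

definition iid_covariates ::
  "'a measure \<Rightarrow> nat \<Rightarrow> nat \<Rightarrow> (nat \<Rightarrow> 'a \<Rightarrow> nat \<Rightarrow> real) \<Rightarrow> bool" where
  "iid_covariates M n d X \<longleftrightarrow>
     prob_space.indep_vars M (\<lambda>_. borel_Rd d) X {..<n} \<and>
     (\<forall>i<n. \<forall>j<n. distr M (borel_Rd d) (X i) = distr M (borel_Rd d) (X j))"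

text \<open>
  The conditional law is expressed by the conditional probabilities of the events
  \<open>y = \<sigma>\<close> given the \<open>\<sigma>\<close>-algebra generated by the design matrix.
\<close>

definition ising_response ::
  "'a measure \<Rightarrow> nat \<Rightarrow> nat \<Rightarrow> nat set set \<Rightarrow> (nat set \<Rightarrow> real) \<Rightarrow> (nat \<Rightarrow> real)
    \<Rightarrow> (nat \<Rightarrow> 'a \<Rightarrow> nat \<Rightarrow> real) \<Rightarrow> ('a \<Rightarrow> nat \<Rightarrow> real) \<Rightarrow> bool" where
  "ising_response M n d E g \<theta> X y \<longleftrightarrow>
     y \<in> measurable M (count_space (spins n)) \<and>
     (\<forall>\<sigma>\<in>spins n. AE \<omega> in M.
        real_cond_exp M
          (vimage_algebra (space M) (design n X) (PiM {..<n} (\<lambda>_. borel_Rd d)))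
          (indicator {\<omega>\<in>space M. y \<omega> = \<sigma>}) \<omega>
        = cond_pmf n d E g \<theta> (design n X \<omega>) \<sigma>)"


subsection \<open>Sub-Gaussian norms and the second-moment matrix\<close>

definition subgauss_norm :: "'a measure \<Rightarrow> ('a \<Rightarrow> real) \<Rightarrow> ennreal" where
  "subgauss_norm M Z =
     Inf {ennreal t | t. 0 < t \<and> (\<integral>\<^sup>+\<omega>. ennreal (exp ((Z \<omega>)\<^sup>2 / t\<^sup>2)) \<partial>M) \<le> 2}"

definition subgauss_vec_norm :: "'a measure \<Rightarrow> nat \<Rightarrow> ('a \<Rightarrow> nat \<Rightarrow> real) \<Rightarrow> ennreal" where
  "subgauss_vec_norm M d V =
     (SUP u\<in>{u\<in>Rd d. L2_set u {..<d} = 1}. subgauss_norm M (\<lambda>\<omega>. dotp d (V \<omega>) u))"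

definition second_moment :: "'a measure \<Rightarrow> nat \<Rightarrow> ('a \<Rightarrow> nat \<Rightarrow> real) \<Rightarrow> real mat" where
  "second_moment M d V = mat d d (\<lambda>(k, l). integral\<^sup>L M (\<lambda>\<omega>. V \<omega> k * V \<omega> l))"

definition lambda_min :: "real mat \<Rightarrow> real" where
  "lambda_min A = Min (spectrum A)"

definition lambda_max :: "real mat \<Rightarrow> real" where
  "lambda_max A = Max (spectrum A)"


subsection \<open>The estimator\<close>

definition pseudo_loss ::
  "nat \<Rightarrow> nat set set \<Rightarrow> (nat set \<Rightarrow> real) \<Rightarrow> (nat \<Rightarrow> nat \<Rightarrow> real) \<Rightarrow> (nat \<Rightarrow> real)
    \<Rightarrow> nat set \<Rightarrow> (nat \<Rightarrow> real) \<Rightarrow> real" where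
  "pseudo_loss d E g x y S b =
     - (1 / real (card S)) *
       (\<Sum>i\<in>S. y i * (local_field E g y i + dotp d (x i) b)
             - ln (cosh (local_field E g y i + dotp d (x i) b)))"

definition is_lasso_estimate ::
  "nat \<Rightarrow> nat set set \<Rightarrow> (nat set \<Rightarrow> real) \<Rightarrow> (nat \<Rightarrow> nat \<Rightarrow> real) \<Rightarrow> (nat \<Rightarrow> real)
    \<Rightarrow> nat set \<Rightarrow> real \<Rightarrow> (nat \<Rightarrow> real) \<Rightarrow> bool" where
  "is_lasso_estimate d E g x y S lam b \<longleftrightarrow>
     is_arg_min (\<lambda>b. pseudo_loss d E g x y S b + lam * l1_norm d b) (\<lambda>b. b \<in> Rd d) b"


subsection \<open>Events of probability \<open>1 - o(1)\<close>\<close>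

text \<open>
  Minimizers need not be unique and a selection of them need not be measurable, so
  ``with probability \<open>1 - o(1)\<close>'' is stated through measurable events implying the property.
  If the sets \<open>{\<omega> \<in> space (M n). P n \<omega>}\<close> are measurable this amounts to their
  probabilities tending to \<open>1\<close>.
\<close>

definition with_high_prob :: "(nat \<Rightarrow> 'a measure) \<Rightarrow> (nat \<Rightarrow> 'a \<Rightarrow> bool) \<Rightarrow> bool" where
  "with_high_prob M P \<longleftrightarrow>
     (\<exists>A. (\<forall>n. A n \<in> sets (M n)) \<and> (\<forall>n. \<forall>\<omega>\<in>A n. P n \<omega>) \<and>
          (\<lambda>n. measure (M n) (A n)) \<longlonglongrightarrow> 1)"

end

theory Submission
  imports Defs
begin

text \<open>
  Why the theorem holds. The responses at a strong independent set are, given the covariates and all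
  other responses, independent signs with means \<open>tanh (m\<^sub>i + X\<^sub>i \<bullet> \<theta>)\<close>, and the local fields
  \<open>m\<^sub>i\<close> depend on those other responses only. The pseudo-likelihood on the sample is thus the
  likelihood of a logistic regression with random offsets in \<open>[-1, 1]\<close>, and the usual Lasso argument
  applies: a bound on the gradient at the truth in the maximum norm confines the error to a cone on
  which the \<open>\<ell>\<^sub>1\<close> norm is at most \<open>4 sqrt s\<close> times the Euclidean norm
  (\<open>l1_penalty_cone\<close>), and curvature of the loss on that cone turns the optimality inequality into the
  two error bounds (\<open>l1_penalized_error_bound\<close>).

  Gradient. Flipping one spin at a time shows that every coordinate of the score, given the
  covariates, has a Gaussian moment generating function with variance proxy \<open>\<Sum> X\<^sub>i\<^sub>k\<^sup>2\<close>
  (\<open>cond_pmf_mgf\<close>). Integrating over the independent sub-Gaussian covariates gives a Gaussian bound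
  for every real argument of the moment generating function (\<open>score_mgf\<close>). The full range of
  arguments matters when \<open>\<theta> = 0\<close>: then the rate conditions say nothing about \<open>ln d / n\<close>, the penalty can be
  large, and the estimator has to be exactly \<open>0\<close>, which follows from the gradient bound alone.

  Curvature. On a bounded interval \<open>ln cosh\<close> is strongly convex. Restricting to observations whose
  signal \<open>X\<^sub>i \<bullet> \<theta>\<close> is below a constant cutoff leaves a truncated Gram matrix. Its mean still has
  smallest eigenvalue at least \<open>1 / (2 \<kappa>)\<close>, by fourth moments (\<open>truncated_second_moment_lower\<close>), and its
  entries deviate from their means by \<open>O(sqrt (ln d / n))\<close>, by Bernstein's inequality (\<open>gram_tail\<close>). An
  entrywise deviation \<open>\<delta>\<close> costs at most \<open>\<delta>\<close> times the squared \<open>\<ell>\<^sub>1\<close> norm, that is \<open>16 s \<delta>\<close> times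
  the squared Euclidean norm on the cone; this is small because \<open>s sqrt (ln d / n)\<close> tends to \<open>0\<close>. The
  arguments of \<open>ln cosh\<close> stay bounded along the error because all entries of the design are
  \<open>O(sqrt (ln (n d)))\<close> while the \<open>\<ell>\<^sub>1\<close> norm of the error, after shrinking it along the segment to
  the truth, is \<open>O(s sqrt (ln d / n))\<close>; the product vanishes by the sparsity condition.

  For a fixed sample size the event that carries the error bounds has probability at least \<open>1 - 6 / d\<close>
  (\<open>lasso_error_whp\<close>); the rate conditions imply the smallness conditions of that bound for large \<open>n\<close>.
\<close>

section \<open>Convexity of the logarithm of the hyperbolic cosine\<close>

text \<open>
  The second derivative of \<open>ln cosh\<close> is \<open>1 - tanh\<^sup>2\<close>, which lies in \<open>(0, 1]\<close> and decreases away
  from \<open>0\<close>. This Taylor formula is the source of the upper bound (sub-Gaussian spins), of convexity,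
  and of strong convexity on bounded intervals (curvature of the loss).
\<close>

lemma ln_cosh_expansion:
  fixes a h :: real
  shows "\<exists>\<xi>. \<bar>\<xi>\<bar> \<le> \<bar>a\<bar> + \<bar>h\<bar> \<and>
    ln (cosh (a + h)) = ln (cosh a) + tanh a * h + (1 - (tanh \<xi>)\<^sup>2) / 2 * h\<^sup>2"
proof (cases "h = 0")
  case False
  define f where "f x = ln (cosh x)" for x :: real
  define df where "df m = (if m = 0 then f else if m = 1 then tanh else (\<lambda>x::real. 1 - (tanh x)\<^sup>2))" for m :: nat
  have D: "DERIV (df m) t :> df (Suc m) t" if "m < 2" for m t
  proof -
    have "m = 0 \<or> m = 1" using that by auto
    then show ?thesis
    proof
      assume "m = 0"
      have "(f has_real_derivative tanh t) (at t)" unfolding f_def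
        by (auto intro!: derivative_eq_intros simp: tanh_def)
      then show ?thesis using \<open>m = 0\<close> by (simp add: df_def)
    next
      assume "m = 1"
      then show ?thesis by (auto simp: df_def intro!: derivative_eq_intros)
    qed
  qed
  have "\<exists>t. (if a + h < a then a + h < t \<and> t < a else a < t \<and> t < a + h) \<and>
      f (a + h) = (\<Sum>m<2. df m a / fact m * (a + h - a) ^ m) + df 2 t / fact 2 * (a + h - a) ^ 2"
    by (rule Taylor[where a = "min a (a+h)" and b = "max a (a+h)"]) (use False D in \<open>auto simp: df_def\<close>)
  then obtain t where t: "if a + h < a then a + h < t \<and> t < a else a < t \<and> t < a + h"
    and e: "f (a + h) = (\<Sum>m<2. df m a / fact m * h ^ m) + df 2 t / fact 2 * h ^ 2" by auto
  have "\<bar>t\<bar> \<le> \<bar>a\<bar> + \<bar>h\<bar>" using t by (auto split: if_splits)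
  with e show ?thesis
    by (intro exI[of _ t]) (simp add: df_def f_def numeral_2_eq_2)
qed (auto intro: exI[of _ 0])

lemma tanh_square_le_one: "(tanh (x::real))\<^sup>2 \<le> 1"
  using tanh_real_bounds[of x] by (simp add: abs_square_le_1 abs_le_iff)

lemma ln_cosh_upper:
  "ln (cosh (a + h)) \<le> ln (cosh a) + tanh a * h + h\<^sup>2 / 2" for a h :: real
proof -
  obtain \<xi> where e: "ln (cosh (a + h)) = ln (cosh a) + tanh a * h + (1 - (tanh \<xi>)\<^sup>2) / 2 * h\<^sup>2"
    using ln_cosh_expansion[of a h] by auto
  have "(1 - (tanh \<xi>)\<^sup>2) / 2 * h\<^sup>2 \<le> 1 / 2 * h\<^sup>2"
    by (intro mult_right_mono) auto
  with e show ?thesis by simp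
qed

text \<open>
  In probabilistic terms: the centred sign with mean \<open>tanh a\<close> has moment generating function
  \<open>cosh (a + h) / cosh a * exp (- h tanh a)\<close>, which is at most that of a standard Gaussian.
\<close>

lemma cosh_shift_le: "cosh (a + h) * exp (- (tanh a * h)) \<le> cosh a * exp (h\<^sup>2 / 2)" for a h :: real
proof -
  have "cosh (a + h) = exp (ln (cosh (a + h)))" by simp
  also have "\<dots> \<le> exp (ln (cosh a) + tanh a * h + h\<^sup>2 / 2)"
    using ln_cosh_upper[of a h] by (simp only: exp_le_cancel_iff)
  also have "\<dots> = cosh a * exp (tanh a * h) * exp (h\<^sup>2 / 2)"
    by (simp only: exp_add exp_ln[OF cosh_real_pos])
  finally have "cosh (a + h) * exp (- (tanh a * h))
      \<le> cosh a * exp (tanh a * h) * exp (h\<^sup>2 / 2) * exp (- (tanh a * h))"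
    by (intro mult_right_mono) auto
  also have "\<dots> = cosh a * exp (h\<^sup>2 / 2) * exp (tanh a * h + - (tanh a * h))"
    by (simp only: exp_add mult_ac)
  finally show ?thesis by simp
qed

lemma ln_cosh_strong_convexity:
  fixes a h R :: real
  assumes "\<bar>a\<bar> + \<bar>h\<bar> \<le> R"
  shows "ln (cosh a) + tanh a * h + (1 - (tanh R)\<^sup>2) / 2 * h\<^sup>2 \<le> ln (cosh (a + h))"
proof -
  obtain \<xi> where x: "\<bar>\<xi>\<bar> \<le> \<bar>a\<bar> + \<bar>h\<bar>"
    and e: "ln (cosh (a + h)) = ln (cosh a) + tanh a * h + (1 - (tanh \<xi>)\<^sup>2) / 2 * h\<^sup>2"
    using ln_cosh_expansion[of a h] by auto
  have "\<bar>tanh \<xi>\<bar> \<le> \<bar>tanh R\<bar>"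
    unfolding tanh_real_abs[symmetric] using x assms by (simp del: tanh_real_abs)
  then have "(tanh \<xi>)\<^sup>2 \<le> (tanh R)\<^sup>2"
    by (simp add: abs_le_square_iff)
  then have "(1 - (tanh R)\<^sup>2) / 2 * h\<^sup>2 \<le> (1 - (tanh \<xi>)\<^sup>2) / 2 * h\<^sup>2"
    by (intro mult_right_mono) auto
  with e show ?thesis by simp
qed

lemma ln_cosh_above_tangent:
  "ln (cosh a) + tanh a * h \<le> ln (cosh (a + h))" for a h :: real
proof -
  have "0 \<le> (1 - (tanh (\<bar>a\<bar> + \<bar>h\<bar>))\<^sup>2) / 2 * h\<^sup>2"
    using tanh_square_le_one[of "\<bar>a\<bar> + \<bar>h\<bar>"] by simp
  with ln_cosh_strong_convexity[of a h "\<bar>a\<bar> + \<bar>h\<bar>"] show ?thesis by simp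
qed

lemma ln_cosh_segment:
  fixes a h t :: real
  assumes "0 \<le> t" "t \<le> 1"
  shows "ln (cosh (a + t * h)) \<le> (1 - t) * ln (cosh a) + t * ln (cosh (a + h))"
proof -
  let ?z = "a + t * h"
  have "ln (cosh ?z) + tanh ?z * (- (t * h)) \<le> ln (cosh a)"
    using ln_cosh_above_tangent[of ?z "- (t * h)"] by simp
  moreover have "ln (cosh ?z) + tanh ?z * ((1 - t) * h) \<le> ln (cosh (a + h))"
    using ln_cosh_above_tangent[of ?z "(1 - t) * h"] by (simp add: algebra_simps)
  ultimately have "(1 - t) * (ln (cosh ?z) + tanh ?z * (- (t * h)))
      + t * (ln (cosh ?z) + tanh ?z * ((1 - t) * h)) \<le> (1 - t) * ln (cosh a) + t * ln (cosh (a + h))"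
    using assms by (intro add_mono mult_left_mono) auto
  then show ?thesis by (simp add: algebra_simps)
qed

section \<open>The least eigenvalue of a symmetric matrix\<close>

text \<open>
  The variational half of the spectral theorem. The quadratic form attains its minimum over the unit
  sphere by compactness; the minimizer is a critical point of the Rayleigh quotient, hence an
  eigenvector, so the minimum belongs to the spectrum and is at least its least element.
\<close>

lemma quadratic_form_ge_lambda_min:
  fixes a :: "nat \<Rightarrow> nat \<Rightarrow> real" and v :: "nat \<Rightarrow> real"
  assumes sym: "\<And>k l. k < d \<Longrightarrow> l < d \<Longrightarrow> a k l = a l k" and d: "1 \<le> d"
  shows "lambda_min (mat d d (\<lambda>(k, l). a k l)) * (\<Sum>k<d. (v k)\<^sup>2) \<le> (\<Sum>k<d. \<Sum>l<d. a k l * v k * v l)"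
proof -
  define q where "q v = (\<Sum>k<d. \<Sum>l<d. a k l * v k * v l)" for v :: "nat \<Rightarrow> real"
  define nn where "nn v = (\<Sum>k<d. (v k)\<^sup>2)" for v :: "nat \<Rightarrow> real"
  define B where "B = (PiE UNIV (\<lambda>k. if k < d then {-1..1} else {0}) :: (nat \<Rightarrow> real) set)"
  have "compactin (product_topology (\<lambda>_. euclidean) UNIV) B"
    unfolding B_def compactin_PiE by auto
  then have cB: "compact B"
    by (simp add: euclidean_product_topology)
  have cnn: "continuous_on UNIV nn" and cq: "continuous_on UNIV q"
    unfolding nn_def q_def by (intro continuous_intros continuous_on_product_coordinates)+
  have "closed {v. nn v = 1}"
    by (intro closed_Collect_eq cnn continuous_on_const)
  with cB have cS: "compact (B \<inter> {v. nn v = 1})"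
    by (rule compact_Int_closed)
  have "(\<lambda>k. if k = 0 then 1 else 0) \<in> B \<inter> {v. nn v = 1}"
    using d by (auto simp: B_def nn_def if_distrib[where f="\<lambda>x. x\<^sup>2"] sum.delta cong: if_cong)
  then have "B \<inter> {v. nn v = 1} \<noteq> {}" by blast
  then obtain v0 where v0: "v0 \<in> B" "nn v0 = 1"
    and min: "\<And>w. w \<in> B \<Longrightarrow> nn w = 1 \<Longrightarrow> q v0 \<le> q w"
    using continuous_attains_inf[OF cS _ continuous_on_subset[OF cq subset_UNIV]] by auto
  define \<mu> where "\<mu> = q v0"
  have lower: "\<mu> * nn w \<le> q w" for w
  proof (cases "nn w = 0")
    case True
    then have "\<forall>k<d. w k = 0"
      unfolding nn_def by (subst (asm) sum_nonneg_eq_0_iff) auto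
    then have "q w = 0" unfolding q_def by simp
    with True show ?thesis by simp
  next
    case False
    have nn0: "nn w > 0" using False unfolding nn_def
      by (metis sum_nonneg zero_le_power2 order_less_le)
    define r where "r = sqrt (nn w)"
    have r: "r > 0" "r\<^sup>2 = nn w" using nn0 by (auto simp: r_def)
    define u where "u k = (if k < d then w k / r else 0)" for k
    have "nn u = (\<Sum>k<d. (w k)\<^sup>2 / r\<^sup>2)" unfolding nn_def u_def by (simp add: power_divide)
    also have "\<dots> = nn w / r\<^sup>2" by (simp add: nn_def sum_divide_distrib)
    finally have nu: "nn u = 1" using r nn0 by simp
    have "\<bar>u k\<bar> \<le> 1" if "k < d" for k
    proof -
      have "(u k)\<^sup>2 \<le> nn u" unfolding nn_def using that by (intro member_le_sum) auto
      then show ?thesis using nu by (simp add: abs_square_le_1)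
    qed
    then have "- 1 \<le> u k \<and> u k \<le> 1" if "k < d" for k using that by (simp add: abs_le_iff)
    moreover have "u k = 0" if "\<not> k < d" for k using that by (simp add: u_def)
    ultimately have "u \<in> B" unfolding B_def by (simp add: PiE_UNIV_domain)
    then have "\<mu> \<le> q u" using min nu by (simp add: \<mu>_def)
    also have "q u = q w / r\<^sup>2"
      unfolding q_def u_def by (simp add: sum_divide_distrib power2_eq_square)
    finally show ?thesis using r nn0 by (simp add: field_simps)
  qed
  \<comment> \<open>first-order condition: perturb the minimizer along the \<open>k\<close>-th unit vector\<close>
  have stat: "(\<Sum>l<d. a k l * v0 l) = \<mu> * v0 k" if k: "k < d" for k
  proof -
    define \<delta> where "\<delta> = (\<Sum>l<d. a k l * v0 l) - \<mu> * v0 k"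
    define C where "C = a k k - \<mu>"
    have main: "0 \<le> 2 * e * \<delta> + e\<^sup>2 * C" for e
    proof -
      let ?w = "\<lambda>j. v0 j + e * (if j = k then 1 else 0)"
      have "nn ?w = (\<Sum>j<d. (v0 j)\<^sup>2 + (if j = k then 2 * e * v0 j + e\<^sup>2 else 0))"
        unfolding nn_def by (intro sum.cong) (auto simp: power2_eq_square algebra_simps)
      also have "\<dots> = nn v0 + 2 * e * v0 k + e\<^sup>2"
        using k by (simp add: sum.distrib nn_def)
      finally have n1: "nn ?w = 1 + 2 * e * v0 k + e\<^sup>2" using v0 by simp
      have inner: "(\<Sum>l<d. a j l * ?w j * ?w l)
          = (\<Sum>l<d. a j l * v0 j * v0 l) + e * a j k * v0 j
            + (if j = k then e * (\<Sum>l<d. a k l * v0 l) + e\<^sup>2 * a k k else 0)" if "j < d" for j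
      proof -
        have "(\<Sum>l<d. a j l * ?w j * ?w l)
          = (\<Sum>l<d. a j l * v0 j * v0 l + (if l = k then e * a j k * v0 j else 0)
              + (if j = k then e * (a k l * v0 l) else 0)
              + (if l = k then (if j = k then e\<^sup>2 * a k k else 0) else 0))"
          by (intro sum.cong) (auto simp: power2_eq_square algebra_simps)
        also have "\<dots> = (\<Sum>l<d. a j l * v0 j * v0 l) + e * a j k * v0 j
              + (if j = k then e * (\<Sum>l<d. a k l * v0 l) else 0) + (if j = k then e\<^sup>2 * a k k else 0)"
          using k by (simp add: sum.distrib sum_distrib_left)
        finally show ?thesis by simp
      qed
      have "q ?w = (\<Sum>j<d. (\<Sum>l<d. a j l * v0 j * v0 l) + e * a j k * v0 j
            + (if j = k then e * (\<Sum>l<d. a k l * v0 l) + e\<^sup>2 * a k k else 0))"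
        unfolding q_def by (intro sum.cong inner) auto
      also have "\<dots> = q v0 + e * (\<Sum>j<d. a j k * v0 j) + (e * (\<Sum>l<d. a k l * v0 l) + e\<^sup>2 * a k k)"
        using k by (simp add: sum.distrib q_def sum_distrib_left mult.assoc)
      also have "(\<Sum>j<d. a j k * v0 j) = (\<Sum>l<d. a k l * v0 l)"
        using sym k by (intro sum.cong) auto
      finally have "q ?w = \<mu> + 2 * e * (\<Sum>l<d. a k l * v0 l) + e\<^sup>2 * a k k"
        by (simp add: \<mu>_def)
      with lower[of ?w] n1 show ?thesis
        by (simp add: \<delta>_def C_def algebra_simps)
    qed
    have "\<delta> = 0"
    proof (rule ccontr)
      assume "\<delta> \<noteq> 0"
      define K where "K = \<bar>C\<bar> + 1"
      have K: "K > 0" "C \<le> K" by (auto simp: K_def)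
      \<comment> \<open>the step that minimizes the upper bound \<open>2 e \<delta> + e\<^sup>2 K\<close>\<close>
      have "0 \<le> 2 * (- \<delta> / K) * \<delta> + (- \<delta> / K)\<^sup>2 * C" by (rule main)
      also have "\<dots> \<le> 2 * (- \<delta> / K) * \<delta> + (- \<delta> / K)\<^sup>2 * K"
        using K by (intro add_left_mono mult_left_mono) auto
      also have "\<dots> = - (\<delta>\<^sup>2 / K)" using K by (simp add: power2_eq_square field_simps)
      also have "\<dots> < 0" using K \<open>\<delta> \<noteq> 0\<close> by simp
      finally show False by simp
    qed
    then show ?thesis by (simp add: \<delta>_def)
  qed
  let ?A = "mat d d (\<lambda>(k, l). a k l)"
  have "eigenvector ?A (vec d v0) \<mu>"
    unfolding eigenvector_def
  proof (intro conjI)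
    show "vec d v0 \<noteq> 0\<^sub>v (dim_row ?A)"
    proof
      assume "vec d v0 = 0\<^sub>v (dim_row ?A)"
      then have "vec d v0 $ k = 0\<^sub>v d $ k" for k by simp
      then have "v0 k = 0" if "k < d" for k using that by (metis index_vec index_zero_vec(1))
      then have "nn v0 = 0" unfolding nn_def by simp
      then show False using v0 by simp
    qed
    show "?A *\<^sub>v vec d v0 = \<mu> \<cdot>\<^sub>v vec d v0"
      by (rule eq_vecI) (auto simp: scalar_prod_def stat lessThan_atLeast0[symmetric])
  qed simp
  then have "\<mu> \<in> spectrum ?A"
    unfolding spectrum_def eigenvalue_def by auto
  moreover have "finite (spectrum ?A)"
    by (rule card_finite_spectrum(1)[of _ d]) simp
  ultimately have "lambda_min ?A \<le> \<mu>"
    unfolding lambda_min_def by simp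
  then have "lambda_min ?A * nn v \<le> \<mu> * nn v"
    by (intro mult_right_mono) (auto simp: nn_def sum_nonneg)
  also have "\<dots> \<le> q v" by (rule lower)
  finally show ?thesis by (simp add: nn_def q_def)
qed

section \<open>Minimizers of convex functions with an l1 penalty\<close>

lemma l1_norm_nonneg: "0 \<le> l1_norm d v"
  by (simp add: l1_norm_def sum_nonneg)

lemma l1_norm_le_sqrt_card_L2_set:
  fixes v :: "nat \<Rightarrow> real"
  assumes "J \<subseteq> {..<d}"
  shows "(\<Sum>k\<in>J. \<bar>v k\<bar>) \<le> sqrt (real (card J)) * L2_set v {..<d}"
proof -
  have fin: "finite J" using assms finite_subset by blast
  have "(\<Sum>k\<in>J. \<bar>v k\<bar>) = (\<Sum>k\<in>J. \<bar>1\<bar> * \<bar>v k\<bar>)" by simp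
  also have "\<dots> \<le> L2_set (\<lambda>_. 1) J * L2_set v J" by (rule L2_set_mult_ineq)
  also have "L2_set (\<lambda>_. 1::real) J = sqrt (real (card J))" by (simp add: L2_set_def)
  also have "L2_set v J \<le> L2_set v {..<d}"
    unfolding L2_set_def using assms by (intro real_sqrt_le_mono sum_mono2) auto
  finally show ?thesis by (simp add: mult_left_mono)
qed

text \<open>
  Off the support of \<open>\<theta>\<close> the penalty increases by the full \<open>\<ell>\<^sub>1\<close> mass of \<open>v\<close>, on the support it
  decreases by at most that mass, and the linear term can compensate only half of the penalty. Hence
  the mass off the support is at most three times the mass on it.
\<close>

lemma l1_penalty_cone:
  fixes \<theta> v G :: "nat \<Rightarrow> real"
  assumes lam: "0 < lam"
    and G: "\<And>k. k < d \<Longrightarrow> \<bar>G k\<bar> \<le> lam / 2"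
    and opt: "(\<Sum>k<d. G k * v k) + lam * l1_norm d (\<lambda>k. \<theta> k + v k) \<le> lam * l1_norm d \<theta>"
  shows "l1_norm d v \<le> 4 * (\<Sum>k | k \<in> {..<d} \<and> \<theta> k \<noteq> 0. \<bar>v k\<bar>)"
proof -
  define J where "J = {k \<in> {..<d}. \<theta> k \<noteq> 0}"
  have J: "J \<subseteq> {..<d}" by (auto simp: J_def)
  have split: "(\<Sum>k<d. f k) = (\<Sum>k\<in>J. f k) + (\<Sum>k\<in>{..<d} - J. f k)" for f :: "nat \<Rightarrow> real"
    using sum.subset_diff[OF J, of f] by simp
  have "- (lam / 2 * l1_norm d v) = (\<Sum>k<d. - (lam / 2 * \<bar>v k\<bar>))"
    by (simp add: l1_norm_def sum_distrib_left sum_negf)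
  also have "\<dots> \<le> (\<Sum>k<d. G k * v k)"
  proof (intro sum_mono)
    fix k assume k: "k \<in> {..<d}"
    have "\<bar>G k * v k\<bar> \<le> lam / 2 * \<bar>v k\<bar>"
      unfolding abs_mult using G k by (intro mult_right_mono) auto
    then show "- (lam / 2 * \<bar>v k\<bar>) \<le> G k * v k" by linarith
  qed
  finally have 1: "- (lam / 2 * l1_norm d v) \<le> (\<Sum>k<d. G k * v k)" .
  have "(\<Sum>k\<in>{..<d} - J. \<bar>v k\<bar>) - (\<Sum>k\<in>J. \<bar>v k\<bar>)
      \<le> (\<Sum>k\<in>{..<d} - J. \<bar>\<theta> k + v k\<bar> - \<bar>\<theta> k\<bar>) + (\<Sum>k\<in>J. \<bar>\<theta> k + v k\<bar> - \<bar>\<theta> k\<bar>)"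
    unfolding diff_conv_add_uminus[of "sum _ ({..<d} - J)"] sum_negf[symmetric]
    by (intro add_mono sum_mono) (auto simp: J_def)
  also have "\<dots> = l1_norm d (\<lambda>k. \<theta> k + v k) - l1_norm d \<theta>"
    unfolding l1_norm_def split by (simp add: sum_subtractf)
  finally have "lam * ((\<Sum>k\<in>{..<d} - J. \<bar>v k\<bar>) - (\<Sum>k\<in>J. \<bar>v k\<bar>))
      \<le> lam * (l1_norm d (\<lambda>k. \<theta> k + v k) - l1_norm d \<theta>)"
    using lam by (intro mult_left_mono) auto
  also have "\<dots> \<le> lam / 2 * l1_norm d v" using opt 1 by (simp add: algebra_simps)
  finally have "lam * ((\<Sum>k\<in>{..<d} - J. \<bar>v k\<bar>) - (\<Sum>k\<in>J. \<bar>v k\<bar>)) \<le> lam * (l1_norm d v / 2)" by simp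
  then have "(\<Sum>k\<in>{..<d} - J. \<bar>v k\<bar>) - (\<Sum>k\<in>J. \<bar>v k\<bar>) \<le> l1_norm d v / 2"
    using lam by (simp only: mult_le_cancel_left_pos)
  then show ?thesis unfolding l1_norm_def split J_def[symmetric] by simp
qed

text \<open>
  The curvature of the loss is available only for perturbations of \<open>\<ell>\<^sub>1\<close> norm at most \<open>\<rho>\<close>. If the
  error \<open>v\<close> is larger, it is shrunk to norm exactly \<open>\<rho>\<close>; by convexity the shrunken point still does at
  least as well as \<open>\<theta>\<close>, and the resulting error bound is strictly below \<open>\<rho>\<close>, a contradiction.
\<close>

lemma l1_penalized_error_bound:
  fixes L :: "(nat \<Rightarrow> real) \<Rightarrow> real" and \<theta> v G :: "nat \<Rightarrow> real"
  assumes lam: "0 < lam" and \<alpha>: "0 < \<alpha>" and \<beta>: "0 \<le> \<beta>"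
    and G: "\<And>k. k < d \<Longrightarrow> \<bar>G k\<bar> \<le> lam / 2"
    and tangent: "L \<theta> + (\<Sum>k<d. G k * v k) \<le> L (\<lambda>k. \<theta> k + v k)"
    and segment: "\<And>t. 0 \<le> t \<Longrightarrow> t \<le> 1 \<Longrightarrow>
        L (\<lambda>k. \<theta> k + t * v k) \<le> (1 - t) * L \<theta> + t * L (\<lambda>k. \<theta> k + v k)"
    and curvature: "\<And>w. l1_norm d w \<le> \<rho> \<Longrightarrow>
        L \<theta> + (\<Sum>k<d. G k * w k) + \<alpha> * (L2_set w {..<d})\<^sup>2 - \<beta> * (l1_norm d w)\<^sup>2 \<le> L (\<lambda>k. \<theta> k + w k)"
    and small: "32 * real (l0_norm d \<theta>) * \<beta> \<le> \<alpha>"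
    and radius: "48 * lam * real (l0_norm d \<theta>) / \<alpha> < \<rho>"
    and opt: "L (\<lambda>k. \<theta> k + v k) + lam * l1_norm d (\<lambda>k. \<theta> k + v k) \<le> L \<theta> + lam * l1_norm d \<theta>"
  shows "L2_set v {..<d} \<le> 12 * lam * sqrt (real (l0_norm d \<theta>)) / \<alpha>"
    and "l1_norm d v \<le> 48 * lam * real (l0_norm d \<theta>) / \<alpha>"
proof -
  define s where "s = real (l0_norm d \<theta>)"
  have s0: "0 \<le> s" by (simp add: s_def)
  have "l1_norm d v \<le> 4 * (\<Sum>k | k \<in> {..<d} \<and> \<theta> k \<noteq> 0. \<bar>v k\<bar>)"
    using l1_penalty_cone[OF lam G, where v = v and \<theta> = \<theta>] opt tangent by simp
  also have "\<dots> \<le> 4 * (sqrt s * L2_set v {..<d})"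
    using l1_norm_le_sqrt_card_L2_set[OF Collect_restrict[of "{..<d}" "\<lambda>k. \<theta> k \<noteq> 0"], of v]
    by (simp add: s_def l0_norm_def)
  finally have cone: "l1_norm d v \<le> 4 * (sqrt s * L2_set v {..<d})" .
  have \<rho>0: "0 < \<rho>"
    using radius lam \<alpha> s0 unfolding s_def[symmetric]
    by (smt (verit) divide_nonneg_pos mult_nonneg_nonneg)
  define t where "t = (if l1_norm d v \<le> \<rho> then 1 else \<rho> / l1_norm d v)"
  have t: "0 < t" "t \<le> 1" using \<rho>0 by (auto simp: t_def)
  define w where "w k = t * v k" for k
  have l1w: "l1_norm d w = t * l1_norm d v"
    using t by (simp add: w_def l1_norm_def abs_mult sum_distrib_left)
  have l2w: "L2_set w {..<d} = t * L2_set v {..<d}"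
    using t unfolding w_def by (simp add: L2_set_right_distrib)
  define x where "x = L2_set w {..<d}"
  have x0: "0 \<le> x" by (simp add: x_def)
  have l1w_rho: "l1_norm d w \<le> \<rho>"
    using \<rho>0 by (auto simp: l1w t_def)
  have conew: "l1_norm d w \<le> 4 * (sqrt s * x)"
    using mult_left_mono[OF cone, of t] t by (simp add: l1w l2w x_def algebra_simps)
  \<comment> \<open>optimality passes from the minimizer to the scaled point by convexity\<close>
  have "l1_norm d (\<lambda>k. \<theta> k + w k) \<le> (1 - t) * l1_norm d \<theta> + t * l1_norm d (\<lambda>k. \<theta> k + v k)"
    unfolding l1_norm_def sum_distrib_left sum.distrib[symmetric]
  proof (intro sum_mono)
    fix k
    have "\<theta> k + w k = (1 - t) * \<theta> k + t * (\<theta> k + v k)" by (simp add: w_def algebra_simps)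
    also have "\<bar>\<dots>\<bar> \<le> \<bar>(1 - t) * \<theta> k\<bar> + \<bar>t * (\<theta> k + v k)\<bar>" by (rule abs_triangle_ineq)
    also have "\<dots> = (1 - t) * \<bar>\<theta> k\<bar> + t * \<bar>\<theta> k + v k\<bar>" using t by (simp add: abs_mult)
    finally show "\<bar>\<theta> k + w k\<bar> \<le> (1 - t) * \<bar>\<theta> k\<bar> + t * \<bar>\<theta> k + v k\<bar>" .
  qed
  then have "L (\<lambda>k. \<theta> k + w k) + lam * l1_norm d (\<lambda>k. \<theta> k + w k)
      \<le> ((1 - t) * L \<theta> + t * L (\<lambda>k. \<theta> k + v k))
        + lam * ((1 - t) * l1_norm d \<theta> + t * l1_norm d (\<lambda>k. \<theta> k + v k))"
    using segment[of t] t lam by (intro add_mono mult_left_mono) (auto simp: w_def)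
  also have "\<dots> = (1 - t) * (L \<theta> + lam * l1_norm d \<theta>)
        + t * (L (\<lambda>k. \<theta> k + v k) + lam * l1_norm d (\<lambda>k. \<theta> k + v k))"
    by (simp add: algebra_simps)
  also have "\<dots> \<le> (1 - t) * (L \<theta> + lam * l1_norm d \<theta>) + t * (L \<theta> + lam * l1_norm d \<theta>)"
    using opt t by (intro add_left_mono mult_left_mono) auto
  also have "\<dots> = L \<theta> + lam * l1_norm d \<theta>" by (simp add: algebra_simps)
  finally have optw: "L (\<lambda>k. \<theta> k + w k) + lam * l1_norm d (\<lambda>k. \<theta> k + w k) \<le> L \<theta> + lam * l1_norm d \<theta>" .
  have Gw: "- (lam / 2 * l1_norm d w) \<le> (\<Sum>k<d. G k * w k)"
    unfolding l1_norm_def sum_distrib_left sum_negf[symmetric]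
  proof (intro sum_mono)
    fix k assume k: "k \<in> {..<d}"
    have "\<bar>G k * w k\<bar> \<le> lam / 2 * \<bar>w k\<bar>"
      unfolding abs_mult using G k by (intro mult_right_mono) auto
    then show "- (lam / 2 * \<bar>w k\<bar>) \<le> G k * w k" by linarith
  qed
  have "l1_norm d \<theta> - l1_norm d w \<le> l1_norm d (\<lambda>k. \<theta> k + w k)"
    unfolding l1_norm_def sum_subtractf[symmetric] by (intro sum_mono) auto
  then have "lam * (l1_norm d \<theta> - l1_norm d w) \<le> lam * l1_norm d (\<lambda>k. \<theta> k + w k)"
    using lam by (intro mult_left_mono) auto
  then have "\<alpha> * x\<^sup>2 \<le> \<beta> * (l1_norm d w)\<^sup>2 + 3 / 2 * lam * l1_norm d w"
    using optw Gw curvature[OF l1w_rho] by (simp add: x_def algebra_simps)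
  also have "\<dots> \<le> \<beta> * (4 * (sqrt s * x))\<^sup>2 + 3 / 2 * lam * (4 * (sqrt s * x))"
    using conew \<beta> lam l1_norm_nonneg[of d w]
    by (intro add_mono mult_left_mono power_mono) auto
  also have "\<dots> = (16 * s * \<beta>) * x\<^sup>2 + 6 * lam * sqrt s * x"
    using s0 by (simp add: power_mult_distrib)
  also have "\<dots> \<le> \<alpha> / 2 * x\<^sup>2 + 6 * lam * sqrt s * x"
    using small by (intro add_right_mono mult_right_mono) (auto simp: s_def)
  finally have "x * (\<alpha> * x) \<le> x * (12 * lam * sqrt s)"
    by (simp add: power2_eq_square algebra_simps)
  then have "x = 0 \<or> \<alpha> * x \<le> 12 * lam * sqrt s"
    using x0 by (metis mult_le_cancel_left_pos order_le_less)
  then have xb: "x \<le> 12 * lam * sqrt s / \<alpha>"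
    using \<alpha> lam s0 by (auto simp: field_simps)
  have "l1_norm d w \<le> 4 * (sqrt s * (12 * lam * sqrt s / \<alpha>))"
    using conew mult_left_mono[OF xb, of "sqrt s"] s0 by simp
  also have "\<dots> = 48 * lam * s / \<alpha>" using s0 by (simp add: field_simps)
  finally have l1b: "l1_norm d w \<le> 48 * lam * s / \<alpha>" .
  have "t = 1"
  proof (rule ccontr)
    assume "t \<noteq> 1"
    then have "l1_norm d v > \<rho>" "t = \<rho> / l1_norm d v" by (auto simp: t_def split: if_splits)
    then have "l1_norm d w = \<rho>" using \<rho>0 by (simp add: l1w)
    with l1b radius show False by (simp add: s_def)
  qed
  then have "w = v" by (simp add: w_def fun_eq_iff)
  with xb l1b show "L2_set v {..<d} \<le> 12 * lam * sqrt (real (l0_norm d \<theta>)) / \<alpha>"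
    and "l1_norm d v \<le> 48 * lam * real (l0_norm d \<theta>) / \<alpha>"
    by (auto simp: x_def s_def)
qed

section \<open>Spins on a strong independent set\<close>

lemma finite_spins: "finite (spins n)"
  unfolding spins_def by (intro finite_PiE) auto

lemma spins_values: "\<sigma> \<in> spins n \<Longrightarrow> i < n \<Longrightarrow> \<sigma> i = 1 \<or> \<sigma> i = - 1"
  unfolding spins_def by (auto simp: PiE_def Pi_def)

lemma flip_in_spins: "\<sigma> \<in> spins n \<Longrightarrow> i < n \<Longrightarrow> \<sigma>(i := - \<sigma> i) \<in> spins n"
  unfolding spins_def by (auto simp: PiE_def Pi_def extensional_def)

lemma sum_spins_flip:
  fixes f :: "(nat \<Rightarrow> real) \<Rightarrow> real"
  assumes "i < n"
  shows "(\<Sum>\<sigma>\<in>spins n. f (\<sigma>(i := - \<sigma> i))) = (\<Sum>\<sigma>\<in>spins n. f \<sigma>)"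
  by (rule sum.reindex_bij_witness[of _ "\<lambda>\<sigma>. \<sigma>(i := - \<sigma> i)" "\<lambda>\<sigma>. \<sigma>(i := - \<sigma> i)"])
     (simp_all add: assms flip_in_spins)

text \<open>
  Flipping a spin is a bijection of the configurations, so it suffices to compare the contributions of
  each pair of configurations that differ at \<open>i\<close> only.
\<close>

lemma sum_spins_le_by_flip:
  fixes f h :: "(nat \<Rightarrow> real) \<Rightarrow> real"
  assumes i: "i < n"
    and le: "\<And>\<sigma>. \<sigma> \<in> spins n \<Longrightarrow> f \<sigma> + f (\<sigma>(i := - \<sigma> i)) \<le> h \<sigma> + h (\<sigma>(i := - \<sigma> i))"
  shows "(\<Sum>\<sigma>\<in>spins n. f \<sigma>) \<le> (\<Sum>\<sigma>\<in>spins n. h \<sigma>)"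
proof -
  have "(\<Sum>\<sigma>\<in>spins n. f \<sigma> + f (\<sigma>(i := - \<sigma> i))) \<le> (\<Sum>\<sigma>\<in>spins n. h \<sigma> + h (\<sigma>(i := - \<sigma> i)))"
    by (rule sum_mono) (rule le)
  then show ?thesis
    by (simp add: sum.distrib sum_spins_flip[OF i, of f] sum_spins_flip[OF i, of h])
qed

lemma local_field_flip:
  assumes "\<And>e. e \<in> E \<Longrightarrow> j \<in> e \<Longrightarrow> i \<in> e \<Longrightarrow> i = j"
  shows "local_field E g (\<sigma>(i := b)) j = local_field E g \<sigma> j"
  unfolding local_field_def
proof (intro sum.cong refl)
  fix e assume e: "e \<in> {e \<in> E. j \<in> e}"
  have "(\<Prod>l\<in>e - {j}. (\<sigma>(i := b)) l) = (\<Prod>l\<in>e - {j}. \<sigma> l)"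
    using assms e by (intro prod.cong) auto
  then show "g e * (\<Prod>l\<in>e - {j}. (\<sigma>(i := b)) l) = g e * (\<Prod>l\<in>e - {j}. \<sigma> l)" by simp
qed

lemma abs_local_field_le_one:
  assumes wh: "weighted_hypergraph n E g" and i: "i < n"
    and w: "(\<Sum>e | e \<in> E \<and> i \<in> e. g e) \<le> 1" and \<sigma>: "\<sigma> \<in> spins n"
  shows "\<bar>local_field E g \<sigma> i\<bar> \<le> 1"
proof -
  have "\<bar>local_field E g \<sigma> i\<bar> \<le> (\<Sum>e | e \<in> E \<and> i \<in> e. \<bar>g e * (\<Prod>j\<in>e - {i}. \<sigma> j)\<bar>)"
    unfolding local_field_def by (rule sum_abs)
  also have "\<dots> = (\<Sum>e | e \<in> E \<and> i \<in> e. g e)"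
  proof (intro sum.cong refl)
    fix e assume e: "e \<in> {e \<in> E. i \<in> e}"
    have "(\<Prod>j\<in>e - {i}. \<bar>\<sigma> j\<bar>) = (\<Prod>j\<in>e - {i}. 1)"
    proof (rule prod.cong[OF refl])
      fix j assume "j \<in> e - {i}"
      then have "j < n" using wh e by (auto simp: weighted_hypergraph_def)
      then show "\<bar>\<sigma> j\<bar> = 1" using spins_values[OF \<sigma>, of j] by auto
    qed
    then show "\<bar>g e * (\<Prod>j\<in>e - {i}. \<sigma> j)\<bar> = g e"
      using wh e by (simp add: abs_mult abs_prod weighted_hypergraph_def)
  qed
  also note w
  finally show ?thesis .
qed

lemma log_weight_single_site:
  assumes wh: "weighted_hypergraph n E g" and i: "i < n"
  shows "log_weight n d E g \<theta> x \<sigma> = \<sigma> i * (local_field E g \<sigma> i + dotp d (x i) \<theta>)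
    + ((\<Sum>e | e \<in> E \<and> i \<notin> e. g e * (\<Prod>j\<in>e. \<sigma> j)) + (\<Sum>j\<in>{..<n} - {i}. \<sigma> j * dotp d (x j) \<theta>))"
proof -
  have finE: "finite E"
    using wh unfolding weighted_hypergraph_def by (meson finite_Pow_iff finite_lessThan finite_subset)
  have "(\<Sum>e\<in>E. g e * (\<Prod>j\<in>e. \<sigma> j))
      = (\<Sum>e | e \<in> E \<and> i \<in> e. g e * (\<Prod>j\<in>e. \<sigma> j)) + (\<Sum>e | e \<in> E \<and> i \<notin> e. g e * (\<Prod>j\<in>e. \<sigma> j))"
    using finE by (subst sum.union_disjoint[symmetric]) (auto intro!: sum.cong)
  moreover have "(\<Sum>e | e \<in> E \<and> i \<in> e. g e * (\<Prod>j\<in>e. \<sigma> j)) = \<sigma> i * local_field E g \<sigma> i"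
    unfolding local_field_def sum_distrib_left
  proof (intro sum.cong refl)
    fix e assume e: "e \<in> {e \<in> E. i \<in> e}"
    then have "e \<subseteq> {..<n}" using wh by (auto simp: weighted_hypergraph_def)
    then have "finite e" by (rule finite_subset) simp
    then have "(\<Prod>j\<in>e. \<sigma> j) = \<sigma> i * (\<Prod>j\<in>e - {i}. \<sigma> j)"
      using e by (intro prod.remove) auto
    then show "g e * (\<Prod>j\<in>e. \<sigma> j) = \<sigma> i * (g e * (\<Prod>j\<in>e - {i}. \<sigma> j))" by simp
  qed
  moreover have "(\<Sum>j<n. \<sigma> j * dotp d (x j) \<theta>)
      = \<sigma> i * dotp d (x i) \<theta> + (\<Sum>j\<in>{..<n} - {i}. \<sigma> j * dotp d (x j) \<theta>)"
    using i by (intro sum.remove) auto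
  ultimately show ?thesis
    unfolding log_weight_def by (simp add: algebra_simps)
qed

text \<open>
  The two configurations that differ at one site, after the factors common to both are removed: \<open>r\<close> is
  the spin, \<open>a\<close> its field, \<open>c\<close> the weight of its centred value in the exponent.
\<close>

lemma spin_flip_exp_le:
  fixes a c :: real
  assumes "r = 1 \<or> r = - 1"
  shows "exp (r * a) * exp (c * (r - tanh a)) + exp (- r * a) * exp (c * (- r - tanh a))
    \<le> exp (c\<^sup>2 / 2) * (exp (r * a) + exp (- r * a))"
proof -
  have "exp (r * a) * exp (c * (r - tanh a)) + exp (- r * a) * exp (c * (- r - tanh a))
      = (exp (a + c) + exp (- (a + c))) * exp (- (tanh a * c))"
    using assms by (auto simp: exp_add exp_diff exp_minus field_simps)
  also have "\<dots> = 2 * (cosh (a + c) * exp (- (tanh a * c)))"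
    by (simp add: cosh_def)
  also have "\<dots> \<le> 2 * (cosh a * exp (c\<^sup>2 / 2))"
    using cosh_shift_le[of a c] by simp
  also have "\<dots> = exp (c\<^sup>2 / 2) * (exp (r * a) + exp (- r * a))"
    using assms by (auto simp: cosh_def)
  finally show ?thesis .
qed

text \<open>
  Induction over the sites of \<open>J\<close>: no edge contains two sites of a strong independent set, so a flip
  at one site changes neither the fields nor the centred values at the others, and each flip contributes
  one Gaussian factor.
\<close>

lemma gibbs_weight_mgf:
  fixes c :: "nat \<Rightarrow> real"
  assumes wh: "weighted_hypergraph n E g" and I: "strong_independent n E I"
    and JI: "J \<subseteq> I"
  shows "(\<Sum>\<sigma>\<in>spins n. exp (log_weight n d E g \<theta> x \<sigma>)
      * exp (\<Sum>i\<in>J. c i * (\<sigma> i - tanh (local_field E g \<sigma> i + dotp d (x i) \<theta>))))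
    \<le> exp (\<Sum>i\<in>J. (c i)\<^sup>2 / 2) * (\<Sum>\<sigma>\<in>spins n. exp (log_weight n d E g \<theta> x \<sigma>))"
proof -
  define a where "a \<sigma> i = local_field E g \<sigma> i + dotp d (x i) \<theta>" for \<sigma> i
  have In: "I \<subseteq> {..<n}" and Ie: "\<And>e. e \<in> E \<Longrightarrow> card (I \<inter> e) \<le> 1"
    using I unfolding strong_independent_def by auto
  have finI: "finite I" using In finite_subset by blast
  have sep: "i = j" if "e \<in> E" "i \<in> e" "j \<in> e" "i \<in> I" "j \<in> I" for e i j
  proof -
    have "{i, j} \<subseteq> I \<inter> e" using that by auto
    then have "card {i, j} \<le> 1"
      using Ie[OF that(1)] finI by (meson card_mono finite_Int le_trans)
    then show ?thesis by (cases "i = j") auto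
  qed
  have "finite J" using JI finI finite_subset by blast
  then show ?thesis using JI unfolding a_def[symmetric]
  proof (induction J)
    case empty
    then show ?case by simp
  next
    case (insert i J)
    then have iI: "i \<in> I" and JI: "J \<subseteq> I" and iJ: "i \<notin> J" by auto
    have i: "i < n" using iI In by auto
    define W where "W \<sigma> = exp (log_weight n d E g \<theta> x \<sigma>)" for \<sigma>
    define \<Phi> where "\<Phi> \<sigma> = exp (\<Sum>j\<in>J. c j * (\<sigma> j - tanh (a \<sigma> j)))" for \<sigma>
    define R where "R \<sigma> = exp ((\<Sum>e | e \<in> E \<and> i \<notin> e. g e * (\<Prod>j\<in>e. \<sigma> j))
        + (\<Sum>j\<in>{..<n} - {i}. \<sigma> j * dotp d (x j) \<theta>))" for \<sigma> :: "nat \<Rightarrow> real"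
    have W: "W \<sigma> = exp (\<sigma> i * a \<sigma> i) * R \<sigma>" for \<sigma>
      unfolding W_def R_def a_def log_weight_single_site[OF wh i, of d \<theta> x \<sigma>] by (simp add: exp_add)
    have a_flip: "a (\<sigma>(i := b)) j = a \<sigma> j" if "j \<in> I" for \<sigma> b j
      unfolding a_def by (subst local_field_flip) (use sep iI that in auto)
    have R_flip: "R (\<sigma>(i := b)) = R \<sigma>" for \<sigma> b
      unfolding R_def by (intro arg_cong[where f = exp] arg_cong2[where f = "(+)"] sum.cong
        arg_cong2[where f = "(*)"] prod.cong refl) auto
    have \<Phi>_flip: "\<Phi> (\<sigma>(i := b)) = \<Phi> \<sigma>" for \<sigma> b
    proof -
      have "(\<Sum>j\<in>J. c j * ((\<sigma>(i := b)) j - tanh (a (\<sigma>(i := b)) j))) = (\<Sum>j\<in>J. c j * (\<sigma> j - tanh (a \<sigma> j)))"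
      proof (rule sum.cong[OF refl])
        fix j assume "j \<in> J"
        then have "j \<in> I" "j \<noteq> i" using JI iJ by auto
        then show "c j * ((\<sigma>(i := b)) j - tanh (a (\<sigma>(i := b)) j)) = c j * (\<sigma> j - tanh (a \<sigma> j))"
          by (simp add: a_flip)
      qed
      then show ?thesis by (simp add: \<Phi>_def)
    qed
    have "(\<Sum>\<sigma>\<in>spins n. W \<sigma> * (exp (c i * (\<sigma> i - tanh (a \<sigma> i))) * \<Phi> \<sigma>))
        \<le> (\<Sum>\<sigma>\<in>spins n. exp ((c i)\<^sup>2 / 2) * (W \<sigma> * \<Phi> \<sigma>))"
    proof (rule sum_spins_le_by_flip[OF i])
      fix \<sigma> assume \<sigma>: "\<sigma> \<in> spins n"
      let ?f = "\<sigma>(i := - \<sigma> i)"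
      have "W \<sigma> * (exp (c i * (\<sigma> i - tanh (a \<sigma> i))) * \<Phi> \<sigma>) + W ?f * (exp (c i * (?f i - tanh (a ?f i))) * \<Phi> ?f)
          = (R \<sigma> * \<Phi> \<sigma>) * (exp (\<sigma> i * a \<sigma> i) * exp (c i * (\<sigma> i - tanh (a \<sigma> i)))
             + exp (- \<sigma> i * a \<sigma> i) * exp (c i * (- \<sigma> i - tanh (a \<sigma> i))))"
        unfolding W R_flip \<Phi>_flip a_flip[OF iI] fun_upd_same by (simp only: distrib_left mult_ac)
      also have "\<dots> \<le> (R \<sigma> * \<Phi> \<sigma>) * (exp ((c i)\<^sup>2 / 2) * (exp (\<sigma> i * a \<sigma> i) + exp (- \<sigma> i * a \<sigma> i)))"
        by (intro mult_left_mono spin_flip_exp_le spins_values[OF \<sigma> i]) (simp add: R_def \<Phi>_def)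
      also have "\<dots> = exp ((c i)\<^sup>2 / 2) * (W \<sigma> * \<Phi> \<sigma>) + exp ((c i)\<^sup>2 / 2) * (W ?f * \<Phi> ?f)"
        unfolding W R_flip \<Phi>_flip a_flip[OF iI] fun_upd_same by (simp only: distrib_left mult_ac)
      finally show "W \<sigma> * (exp (c i * (\<sigma> i - tanh (a \<sigma> i))) * \<Phi> \<sigma>) + W ?f * (exp (c i * (?f i - tanh (a ?f i))) * \<Phi> ?f)
          \<le> exp ((c i)\<^sup>2 / 2) * (W \<sigma> * \<Phi> \<sigma>) + exp ((c i)\<^sup>2 / 2) * (W ?f * \<Phi> ?f)" .
    qed
    also have "\<dots> = exp ((c i)\<^sup>2 / 2) * (\<Sum>\<sigma>\<in>spins n. W \<sigma> * \<Phi> \<sigma>)"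
      by (simp add: sum_distrib_left)
    also have "\<dots> \<le> exp ((c i)\<^sup>2 / 2) * (exp (\<Sum>j\<in>J. (c j)\<^sup>2 / 2) * (\<Sum>\<sigma>\<in>spins n. W \<sigma>))"
      using insert.IH[OF JI] unfolding W_def \<Phi>_def by (intro mult_left_mono) auto
    finally show ?case
      using insert.hyps by (simp add: W_def \<Phi>_def exp_add mult.assoc)
  qed
qed

lemma spins_nonempty: "spins n \<noteq> {}"
  unfolding spins_def by (simp add: PiE_eq_empty_iff)

lemma cond_pmf_mgf:
  fixes c :: "nat \<Rightarrow> real"
  assumes wh: "weighted_hypergraph n E g" and I: "strong_independent n E I"
  shows "(\<Sum>\<sigma>\<in>spins n. cond_pmf n d E g \<theta> x \<sigma>
      * exp (\<Sum>i\<in>I. c i * (\<sigma> i - tanh (local_field E g \<sigma> i + dotp d (x i) \<theta>))))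
    \<le> exp (\<Sum>i\<in>I. (c i)\<^sup>2 / 2)"
proof -
  let ?Z = "\<Sum>\<sigma>\<in>spins n. exp (log_weight n d E g \<theta> x \<sigma>)"
  have Z: "?Z > 0" by (intro sum_pos finite_spins spins_nonempty) auto
  show ?thesis
    using gibbs_weight_mgf[OF wh I order_refl, of d \<theta> x c] Z
    unfolding cond_pmf_def
    by (simp add: sum_divide_distrib[symmetric] divide_le_eq)
qed

lemma cond_pmf_nonneg: "0 \<le> cond_pmf n d E g \<theta> x \<sigma>"
  unfolding cond_pmf_def by (intro divide_nonneg_nonneg sum_nonneg) auto

section \<open>Exponential moment inequalities\<close>

text \<open>
  The infimum defining the norm may be \<open>0\<close> or fail to be attained, but the integral decreases in the
  scale, so a positive scale strictly above the norm is admissible.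
\<close>

lemma subgauss_normD:
  assumes "subgauss_norm M Z \<le> ennreal B" and Z: "Z \<in> borel_measurable M"
  shows "(\<integral>\<^sup>+\<omega>. ennreal (exp ((Z \<omega>)\<^sup>2 / (\<bar>B\<bar> + 1)\<^sup>2)) \<partial>M) \<le> 2"
proof -
  have "subgauss_norm M Z < ennreal (\<bar>B\<bar> + 1)"
  proof -
    have "ennreal B < ennreal (\<bar>B\<bar> + 1)" by (intro ennreal_lessI) auto
    with assms(1) show ?thesis by (rule le_less_trans)
  qed
  then obtain t where t: "0 < t" "ennreal t < ennreal (\<bar>B\<bar> + 1)"
    and i: "(\<integral>\<^sup>+\<omega>. ennreal (exp ((Z \<omega>)\<^sup>2 / t\<^sup>2)) \<partial>M) \<le> 2"
    unfolding subgauss_norm_def Inf_less_iff by auto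
  have tB: "t \<le> \<bar>B\<bar> + 1" using t ennreal_less_iff[of t "\<bar>B\<bar> + 1"] by simp
  have "(\<integral>\<^sup>+\<omega>. ennreal (exp ((Z \<omega>)\<^sup>2 / (\<bar>B\<bar> + 1)\<^sup>2)) \<partial>M) \<le> (\<integral>\<^sup>+\<omega>. ennreal (exp ((Z \<omega>)\<^sup>2 / t\<^sup>2)) \<partial>M)"
    using t tB by (intro nn_integral_mono ennreal_leI iffD2[OF exp_le_cancel_iff] divide_left_mono power_mono) auto
  with i show ?thesis by (rule order_trans[rotated])
qed

lemma subgauss_vec_normD:
  assumes le: "subgauss_vec_norm M d V \<le> ennreal B" and V: "V \<in> measurable M (borel_Rd d)"
    and u: "L2_set u {..<d} = 1"
  shows "(\<integral>\<^sup>+\<omega>. ennreal (exp ((dotp d (V \<omega>) u)\<^sup>2 / (\<bar>B\<bar> + 1)\<^sup>2)) \<partial>M) \<le> 2"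
proof -
  let ?u = "restrict u {..<d}"
  have eq: "dotp d w ?u = dotp d w u" for w unfolding dotp_def by (intro sum.cong) auto
  have "?u \<in> Rd d" by (simp add: Rd_def)
  moreover have "L2_set ?u {..<d} = 1" unfolding u[symmetric] by (intro L2_set_cong) auto
  ultimately have "?u \<in> {u \<in> Rd d. L2_set u {..<d} = 1}" by blast
  then have "subgauss_norm M (\<lambda>\<omega>. dotp d (V \<omega>) ?u) \<le> subgauss_vec_norm M d V"
    unfolding subgauss_vec_norm_def by (rule SUP_upper)
  also note le
  finally have 1: "subgauss_norm M (\<lambda>\<omega>. dotp d (V \<omega>) u) \<le> ennreal B" by (simp add: eq)
  have "(\<lambda>\<omega>. V \<omega> k) \<in> borel_measurable M" if "k < d" for k
    using measurable_compose[OF V[unfolded borel_Rd_def] measurable_component_singleton] that by simp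
  then have "(\<lambda>\<omega>. dotp d (V \<omega>) u) \<in> borel_measurable M" unfolding dotp_def by measurable
  from subgauss_normD[OF 1 this] show ?thesis .
qed

context prob_space
begin

text \<open>
  By convexity \<open>exp (a Z) \<le> (1 - a) + a exp Z\<close>, and the mean of the right-hand side is at most \<open>1 + a\<close>.
  The bound tends to \<open>1\<close> with \<open>a\<close>, as products over many observations require.
\<close>

lemma nn_integral_exp_mult_le:
  assumes Z: "Z \<in> borel_measurable M" and a: "0 \<le> a" "a \<le> 1"
    and e: "(\<integral>\<^sup>+\<omega>. ennreal (exp (Z \<omega>)) \<partial>M) \<le> 2"
  shows "(\<integral>\<^sup>+\<omega>. ennreal (exp (a * Z \<omega>)) \<partial>M) \<le> ennreal (exp a)"
proof -
  have conv: "exp (a * z) \<le> (1 - a) + a * exp z" for z :: real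
    using convex_onD[OF exp_convex, of a 0 z] a by simp
  have "(\<integral>\<^sup>+\<omega>. ennreal (exp (a * Z \<omega>)) \<partial>M) \<le> (\<integral>\<^sup>+\<omega>. ennreal (1 - a) + ennreal a * ennreal (exp (Z \<omega>)) \<partial>M)"
    using a conv by (intro nn_integral_mono) (simp add: ennreal_plus[symmetric] ennreal_mult[symmetric] del: ennreal_plus)
  also have "\<dots> = ennreal (1 - a) + ennreal a * (\<integral>\<^sup>+\<omega>. ennreal (exp (Z \<omega>)) \<partial>M)"
    using Z by (simp add: nn_integral_add nn_integral_cmult emeasure_space_1)
  also have "\<dots> \<le> ennreal (1 - a) + ennreal a * 2"
    using e by (intro add_left_mono mult_left_mono) auto
  also have "\<dots> = ennreal (1 + a)"
    using a by (simp add: ennreal_mult[of a 2, simplified, symmetric] ennreal_plus[symmetric] mult.commute del: ennreal_plus)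
  also have "\<dots> \<le> ennreal (exp a)" by (intro ennreal_leI exp_ge_add_one_self)
  finally show ?thesis .
qed

lemma prob_le_exp_Markov:
  assumes Z: "Z \<in> borel_measurable M"
    and b: "(\<integral>\<^sup>+\<omega>. ennreal (exp (Z \<omega>)) \<partial>M) \<le> ennreal b" "0 \<le> b"
  shows "prob {\<omega>\<in>space M. c < Z \<omega>} \<le> b * exp (- c)"
proof -
  have "emeasure M {\<omega>\<in>space M. c < Z \<omega>} \<le> emeasure M {\<omega>\<in>space M. 1 \<le> ennreal (exp (- c)) * ennreal (exp (Z \<omega>))}"
  proof (intro emeasure_mono subsetI)
    fix \<omega> assume w: "\<omega> \<in> {\<omega>\<in>space M. c < Z \<omega>}"
    then have "1 \<le> exp (- c + Z \<omega>)" by simp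
    then have "1 \<le> exp (- c) * exp (Z \<omega>)" by (simp only: exp_add)
    then have "ennreal 1 \<le> ennreal (exp (- c) * exp (Z \<omega>))" by (rule ennreal_leI)
    with w show "\<omega> \<in> {\<omega>\<in>space M. 1 \<le> ennreal (exp (- c)) * ennreal (exp (Z \<omega>))}"
      by (simp add: ennreal_mult)
  qed (use Z in measurable)
  also have "\<dots> \<le> ennreal (exp (- c)) * (\<integral>\<^sup>+\<omega>. ennreal (exp (Z \<omega>)) * indicator (space M) \<omega> \<partial>M)"
    using Z by (intro order_trans[OF _ nn_integral_Markov_inequality]) (auto intro!: emeasure_mono)
  also have "(\<integral>\<^sup>+\<omega>. ennreal (exp (Z \<omega>)) * indicator (space M) \<omega> \<partial>M) = (\<integral>\<^sup>+\<omega>. ennreal (exp (Z \<omega>)) \<partial>M)"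
    by (intro nn_integral_cong) auto
  also have "ennreal (exp (- c)) * (\<integral>\<^sup>+\<omega>. ennreal (exp (Z \<omega>)) \<partial>M) \<le> ennreal (exp (- c)) * ennreal b"
    using b by (intro mult_left_mono) auto
  also have "\<dots> = ennreal (b * exp (- c))" using b by (simp add: ennreal_mult mult.commute)
  finally show ?thesis using b by (simp add: emeasure_eq_measure)
qed

lemma prob_abs_le_Chernoff:
  assumes Z: "Z \<in> borel_measurable M"
    and b: "(\<integral>\<^sup>+\<omega>. ennreal (exp (t * Z \<omega>)) \<partial>M) \<le> ennreal b"
      "(\<integral>\<^sup>+\<omega>. ennreal (exp (- t * Z \<omega>)) \<partial>M) \<le> ennreal b" "0 \<le> b" and t: "0 < t"
  shows "prob {\<omega>\<in>space M. r < \<bar>Z \<omega>\<bar>} \<le> 2 * b * exp (- (t * r))"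
proof -
  note Z[measurable]
  have "prob {\<omega>\<in>space M. r < \<bar>Z \<omega>\<bar>} \<le> prob ({\<omega>\<in>space M. t * r < t * Z \<omega>} \<union> {\<omega>\<in>space M. t * r < - t * Z \<omega>})"
  proof (intro finite_measure_mono subsetI)
    fix \<omega> assume w: "\<omega> \<in> {\<omega>\<in>space M. r < \<bar>Z \<omega>\<bar>}"
    then have "r < Z \<omega> \<or> r < - Z \<omega>" by auto
    then have "t * r < t * Z \<omega> \<or> t * r < t * - Z \<omega>"
      using t by (metis mult_less_cancel_left_pos)
    with w show "\<omega> \<in> {\<omega>\<in>space M. t * r < t * Z \<omega>} \<union> {\<omega>\<in>space M. t * r < - t * Z \<omega>}" by auto
  qed (use Z in measurable)
  also have "\<dots> \<le> prob {\<omega>\<in>space M. t * r < t * Z \<omega>} + prob {\<omega>\<in>space M. t * r < - t * Z \<omega>}"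
    by (intro measure_Un_le) measurable
  also have "\<dots> \<le> b * exp (- (t * r)) + b * exp (- (t * r))"
    using Z b by (intro add_mono prob_le_exp_Markov) auto
  finally show ?thesis by simp
qed

lemma prob_finite_union_le:
  assumes "finite I" and "\<And>i. i \<in> I \<Longrightarrow> {\<omega>\<in>space M. P i \<omega>} \<in> events"
    and "\<And>i. i \<in> I \<Longrightarrow> prob {\<omega>\<in>space M. P i \<omega>} \<le> p"
  shows "prob {\<omega>\<in>space M. \<exists>i\<in>I. P i \<omega>} \<le> real (card I) * p"
proof -
  have "{\<omega>\<in>space M. \<exists>i\<in>I. P i \<omega>} = (\<Union>i\<in>I. {\<omega>\<in>space M. P i \<omega>})" by auto
  then have "prob {\<omega>\<in>space M. \<exists>i\<in>I. P i \<omega>} \<le> (\<Sum>i\<in>I. prob {\<omega>\<in>space M. P i \<omega>})"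
    using assms by (auto intro!: measure_UNION_le)
  also have "\<dots> \<le> (\<Sum>i\<in>I. p)" by (intro sum_mono assms)
  finally show ?thesis by simp
qed

lemma integral_le_of_exp_bound:
  assumes f: "f \<in> borel_measurable M" "\<And>\<omega>. 0 \<le> f \<omega>" and Z: "Z \<in> borel_measurable M"
    and le: "\<And>\<omega>. f \<omega> \<le> c * exp (Z \<omega>)" and c: "0 \<le> c"
    and e: "(\<integral>\<^sup>+\<omega>. ennreal (exp (Z \<omega>)) \<partial>M) \<le> 2"
  shows "integrable M f" and "expectation f \<le> 2 * c"
proof -
  have "(\<integral>\<^sup>+\<omega>. ennreal (f \<omega>) \<partial>M) \<le> (\<integral>\<^sup>+\<omega>. ennreal c * ennreal (exp (Z \<omega>)) \<partial>M)"
    using le c by (intro nn_integral_mono) (simp add: ennreal_mult[symmetric])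
  also have "\<dots> = ennreal c * (\<integral>\<^sup>+\<omega>. ennreal (exp (Z \<omega>)) \<partial>M)"
    using Z by (simp add: nn_integral_cmult)
  also have "\<dots> \<le> ennreal c * 2" using e by (intro mult_left_mono) auto
  also have "\<dots> = ennreal (2 * c)" using c by (simp add: ennreal_mult' mult.commute)
  finally have n: "(\<integral>\<^sup>+\<omega>. ennreal (f \<omega>) \<partial>M) \<le> ennreal (2 * c)" .
  show int: "integrable M f"
    using f n by (intro integrableI_nonneg) (auto intro: le_less_trans)
  show "expectation f \<le> 2 * c"
    using n c f(2) by (simp add: nn_integral_eq_integral[OF int])
qed

text \<open>
  Second-order expansion: \<open>exp x \<le> 1 + x + x\<^sup>2 / 2 * exp \<bar>x\<bar>\<close>, and for \<open>\<bar>\<eta>\<bar> \<le> 1/2\<close> the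
  remainder is dominated by \<open>4 \<eta>\<^sup>2 exp \<bar>U\<bar>\<close>, whose mean is at most \<open>8 \<eta>\<^sup>2\<close>.
\<close>

lemma subexponential_centered_mgf:
  assumes U: "U \<in> borel_measurable M"
    and e: "(\<integral>\<^sup>+\<omega>. ennreal (exp \<bar>U \<omega>\<bar>) \<partial>M) \<le> 2"
    and \<eta>: "\<bar>\<eta>\<bar> \<le> 1 / 2"
  shows "(\<integral>\<^sup>+\<omega>. ennreal (exp (\<eta> * (U \<omega> - expectation U))) \<partial>M) \<le> ennreal (exp (8 * \<eta>\<^sup>2))"
proof -
  have e1: "x \<le> exp x" for x :: real using exp_ge_add_one_self[of x] by linarith
  have intE: "integrable M (\<lambda>\<omega>. exp \<bar>U \<omega>\<bar>)" and EE: "expectation (\<lambda>\<omega>. exp \<bar>U \<omega>\<bar>) \<le> 2"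
    using integral_le_of_exp_bound[of "\<lambda>\<omega>. exp \<bar>U \<omega>\<bar>" "\<lambda>\<omega>. \<bar>U \<omega>\<bar>" 1] U e by auto
  have intU: "integrable M U"
    using U e1 by (intro Bochner_Integration.integrable_bound[OF intE]) auto
  have taylor: "exp x \<le> 1 + x + x\<^sup>2 / 2 * exp \<bar>x\<bar>" for x :: real
  proof -
    obtain t where t: "\<bar>t\<bar> \<le> \<bar>x\<bar>" and "exp x = (\<Sum>m<2. x ^ m / fact m) + exp t / fact 2 * x ^ 2"
      using Maclaurin_exp_le[of x 2] by auto
    then have "exp x = 1 + x + exp t / 2 * x\<^sup>2" by (simp add: numeral_2_eq_2)
    moreover have "exp t / 2 * x\<^sup>2 \<le> exp \<bar>x\<bar> / 2 * x\<^sup>2"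
      using t by (intro mult_right_mono) auto
    ultimately show ?thesis by (simp add: mult.commute)
  qed
  have sq: "z\<^sup>2 \<le> 2 * exp z" if "0 \<le> z" for z :: real
    using exp_lower_Taylor_quadratic[OF that] that by (simp add: field_simps)
  have pw: "exp (\<eta> * u) \<le> 1 + \<eta> * u + 4 * \<eta>\<^sup>2 * exp \<bar>u\<bar>" for u :: real
  proof -
    have "(\<bar>u\<bar> / 2)\<^sup>2 \<le> 2 * exp (\<bar>u\<bar> / 2)" by (rule sq) simp
    then have u2: "u\<^sup>2 \<le> 8 * exp (\<bar>u\<bar> / 2)" by (simp add: power_divide)
    have "\<bar>\<eta> * u\<bar> \<le> \<bar>u\<bar> / 2" using mult_right_mono[OF \<eta>, of "\<bar>u\<bar>"] by (simp add: abs_mult)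
    then have "(\<eta> * u)\<^sup>2 / 2 * exp \<bar>\<eta> * u\<bar> \<le> (\<eta> * u)\<^sup>2 / 2 * exp (\<bar>u\<bar> / 2)"
      by (intro mult_left_mono) auto
    also have "\<dots> = \<eta>\<^sup>2 / 2 * (u\<^sup>2 * exp (\<bar>u\<bar> / 2))" by (simp add: power_mult_distrib)
    also have "\<dots> \<le> \<eta>\<^sup>2 / 2 * (8 * exp (\<bar>u\<bar> / 2) * exp (\<bar>u\<bar> / 2))"
      using u2 by (intro mult_left_mono mult_right_mono) auto
    also have "\<dots> = 4 * \<eta>\<^sup>2 * exp \<bar>u\<bar>" by (simp add: exp_add[symmetric])
    finally show ?thesis using taylor[of "\<eta> * u"] by simp
  qed
  have int2: "integrable M (\<lambda>\<omega>. 1 + \<eta> * U \<omega> + 4 * \<eta>\<^sup>2 * exp \<bar>U \<omega>\<bar>)"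
    using intU intE by simp
  have int1: "integrable M (\<lambda>\<omega>. exp (\<eta> * U \<omega>))"
    using U pw by (intro Bochner_Integration.integrable_bound[OF int2])
      (auto intro!: AE_I2 order_trans[OF pw abs_ge_self])
  have "expectation (\<lambda>\<omega>. exp (\<eta> * U \<omega>)) \<le> expectation (\<lambda>\<omega>. 1 + \<eta> * U \<omega> + 4 * \<eta>\<^sup>2 * exp \<bar>U \<omega>\<bar>)"
    by (intro integral_mono int1 int2 pw)
  also have "\<dots> = 1 + \<eta> * expectation U + 4 * \<eta>\<^sup>2 * expectation (\<lambda>\<omega>. exp \<bar>U \<omega>\<bar>)"
    using intU intE by (simp add: prob_space)
  also have "\<dots> \<le> 1 + \<eta> * expectation U + 4 * \<eta>\<^sup>2 * 2"
    using EE by (intro add_left_mono mult_left_mono) auto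
  also have "\<dots> \<le> exp (\<eta> * expectation U + 8 * \<eta>\<^sup>2)"
    using exp_ge_add_one_self[of "\<eta> * expectation U + 8 * \<eta>\<^sup>2"] by linarith
  finally have *: "expectation (\<lambda>\<omega>. exp (\<eta> * U \<omega>)) \<le> exp (\<eta> * expectation U + 8 * \<eta>\<^sup>2)" .
  have "(\<integral>\<^sup>+\<omega>. ennreal (exp (\<eta> * (U \<omega> - expectation U))) \<partial>M)
      = (\<integral>\<^sup>+\<omega>. ennreal (exp (\<eta> * U \<omega>) * exp (- (\<eta> * expectation U))) \<partial>M)"
    by (simp add: exp_add[symmetric] algebra_simps)
  also have "\<dots> = ennreal (expectation (\<lambda>\<omega>. exp (\<eta> * U \<omega>) * exp (- (\<eta> * expectation U))))"
    using int1 by (intro nn_integral_eq_integral) auto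
  also have "\<dots> = ennreal (expectation (\<lambda>\<omega>. exp (\<eta> * U \<omega>)) * exp (- (\<eta> * expectation U)))" by simp
  also have "\<dots> \<le> ennreal (exp (\<eta> * expectation U + 8 * \<eta>\<^sup>2) * exp (- (\<eta> * expectation U)))"
    using * by (intro ennreal_leI mult_right_mono) auto
  also have "\<dots> = ennreal (exp (8 * \<eta>\<^sup>2))" by (simp add: exp_add[symmetric])
  finally show ?thesis .
qed

lemma nn_integral_exp_sum_le:
  fixes Z :: "'i \<Rightarrow> 'a \<Rightarrow> real"
  assumes I: "finite I" and ind: "indep_vars (\<lambda>_. borel) Z I"
    and b: "\<And>i. i \<in> I \<Longrightarrow> (\<integral>\<^sup>+\<omega>. ennreal (exp (Z i \<omega>)) \<partial>M) \<le> ennreal (exp c)"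
  shows "(\<integral>\<^sup>+\<omega>. ennreal (exp (\<Sum>i\<in>I. Z i \<omega>)) \<partial>M) \<le> ennreal (exp (real (card I) * c))"
proof -
  have "(\<integral>\<^sup>+\<omega>. ennreal (exp (\<Sum>i\<in>I. Z i \<omega>)) \<partial>M) = (\<integral>\<^sup>+\<omega>. (\<Prod>i\<in>I. ennreal (exp (Z i \<omega>))) \<partial>M)"
    using I by (simp add: exp_sum prod_ennreal)
  also have "\<dots> = (\<Prod>i\<in>I. \<integral>\<^sup>+\<omega>. ennreal (exp (Z i \<omega>)) \<partial>M)"
    by (intro indep_vars_nn_integral I indep_vars_compose2[OF ind]) auto
  also have "\<dots> \<le> (\<Prod>i\<in>I. ennreal (exp c))"
    using b by (intro prod_mono_ennreal) auto
  also have "\<dots> = ennreal (exp (real (card I) * c))"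
    by (simp add: ennreal_power exp_of_nat_mult)
  finally show ?thesis .
qed

text \<open>
  The exponent \<open>8 \<eta>\<^sup>2 - \<eta> u\<close> per observation is minimal at \<open>\<eta> = u / 16\<close>; the condition \<open>u \<le> 8\<close>
  keeps this within the range where the moment generating function is controlled.
\<close>

lemma Bernstein_subexponential:
  fixes U :: "'i \<Rightarrow> 'a \<Rightarrow> real"
  assumes I: "finite I" and ind: "indep_vars (\<lambda>_. borel) U I"
    and e: "\<And>i. i \<in> I \<Longrightarrow> (\<integral>\<^sup>+\<omega>. ennreal (exp \<bar>U i \<omega>\<bar>) \<partial>M) \<le> 2"
    and m: "\<And>i. i \<in> I \<Longrightarrow> expectation (U i) = m"
    and u: "0 < u" "u \<le> 8"
  shows "prob {\<omega>\<in>space M. real (card I) * u < \<bar>(\<Sum>i\<in>I. U i \<omega>) - real (card I) * m\<bar>}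
    \<le> 2 * exp (- (real (card I) * u\<^sup>2 / 32))"
proof -
  let ?N = "real (card I)"
  define \<eta> where "\<eta> = u / 16"
  have rv: "U i \<in> borel_measurable M" if "i \<in> I" for i using ind that by (simp add: indep_vars_def)
  have sum_eq: "(\<Sum>i\<in>I. U i \<omega>) - ?N * m = (\<Sum>i\<in>I. U i \<omega> - m)" for \<omega>
    by (simp add: sum_subtractf)
  have mgf: "(\<integral>\<^sup>+\<omega>. ennreal (exp (\<tau> * ((\<Sum>i\<in>I. U i \<omega>) - ?N * m))) \<partial>M) \<le> ennreal (exp (?N * (8 * \<eta>\<^sup>2)))"
    if \<tau>: "\<bar>\<tau>\<bar> = \<eta>" for \<tau>
  proof -
    have "indep_vars (\<lambda>_. borel) (\<lambda>i \<omega>. \<tau> * (U i \<omega> - m)) I"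
      by (rule indep_vars_compose2[OF ind]) auto
    moreover have "(\<integral>\<^sup>+\<omega>. ennreal (exp (\<tau> * (U i \<omega> - m))) \<partial>M) \<le> ennreal (exp (8 * \<eta>\<^sup>2))" if "i \<in> I" for i
    proof -
      have "\<tau>\<^sup>2 = \<eta>\<^sup>2" using \<tau> by (metis power2_abs)
      then show ?thesis
      using subexponential_centered_mgf[OF rv[OF that] e[OF that], of \<tau>] m[OF that] \<tau> u
      by (simp add: \<eta>_def)
    qed
    ultimately show ?thesis
      unfolding sum_eq sum_distrib_left using I by (intro nn_integral_exp_sum_le) auto
  qed
  have "prob {\<omega>\<in>space M. ?N * u < \<bar>(\<Sum>i\<in>I. U i \<omega>) - ?N * m\<bar>}
      \<le> 2 * exp (?N * (8 * \<eta>\<^sup>2)) * exp (- (\<eta> * (?N * u)))"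
    using rv u by (intro prob_abs_le_Chernoff mgf) (auto simp: \<eta>_def intro!: borel_measurable_diff borel_measurable_sum)
  also have "\<dots> = 2 * exp (- (?N * u\<^sup>2 / 32))"
    by (simp add: \<eta>_def exp_add[symmetric] power2_eq_square)
  finally show ?thesis .
qed

end

section \<open>Integration against the conditional law of the responses\<close>

text \<open>
  The hypothesis on the response speaks about conditional probabilities of single configurations. Since
  there are finitely many of them, it determines the joint law of response and design: split the
  integrand over the value of the response and use the defining property of conditional expectation on
  each part.
\<close>

lemma (in prob_space) nn_integral_ising_response:
  fixes h :: "(nat \<Rightarrow> real) \<Rightarrow> (nat \<Rightarrow> nat \<Rightarrow> real) \<Rightarrow> ennreal"
  assumes resp: "ising_response M n d E g \<theta> X y"
    and X: "\<And>i. i < n \<Longrightarrow> X i \<in> measurable M (borel_Rd d)"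
    and h: "\<And>\<sigma>. \<sigma> \<in> spins n \<Longrightarrow> h \<sigma> \<in> borel_measurable (PiM {..<n} (\<lambda>_. borel_Rd d))"
  shows "(\<integral>\<^sup>+\<omega>. h (y \<omega>) (design n X \<omega>) \<partial>M)
    = (\<integral>\<^sup>+\<omega>. (\<Sum>\<sigma>\<in>spins n. ennreal (cond_pmf n d E g \<theta> (design n X \<omega>) \<sigma>) * h \<sigma> (design n X \<omega>)) \<partial>M)"
proof -
  let ?P = "PiM {..<n} (\<lambda>_. borel_Rd d)"
  let ?F = "vimage_algebra (space M) (design n X) ?P"
  let ?A = "\<lambda>\<sigma>. {\<omega>\<in>space M. y \<omega> = \<sigma>}"
  let ?c = "\<lambda>\<sigma> \<omega>. nn_cond_exp M ?F (\<lambda>\<omega>. ennreal (indicator (?A \<sigma>) \<omega>)) \<omega>"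
  have D: "design n X \<in> measurable M ?P"
    unfolding design_def by (intro measurable_restrict) (use X in auto)
  have Dsp: "design n X \<in> space M \<rightarrow> space ?P" using measurable_space[OF D] by auto
  have DF: "design n X \<in> measurable ?F ?P" by (rule measurable_vimage_algebra1[OF Dsp])
  have sub: "subalgebra M ?F"
    unfolding subalgebra_def sets_vimage_algebra2[OF Dsp] using measurable_sets[OF D] by auto
  interpret F: finite_measure_subalgebra M ?F by unfold_locales (rule sub)
  have y: "y \<in> measurable M (count_space (spins n))"
    and pmf: "\<And>\<sigma>. \<sigma> \<in> spins n \<Longrightarrow> AE \<omega> in M. real_cond_exp M ?F (indicator (?A \<sigma>)) \<omega>
        = cond_pmf n d E g \<theta> (design n X \<omega>) \<sigma>"
    using resp unfolding ising_response_def by auto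
  have A: "?A \<sigma> \<in> sets M" if "\<sigma> \<in> spins n" for \<sigma>
  proof -
    have "?A \<sigma> = y -` {\<sigma>} \<inter> space M" by auto
    then show ?thesis using measurable_sets[OF y, of "{\<sigma>}"] that by simp
  qed
  have hF: "(\<lambda>\<omega>. h \<sigma> (design n X \<omega>)) \<in> borel_measurable ?F" if "\<sigma> \<in> spins n" for \<sigma>
    by (rule measurable_compose[OF DF h[OF that]])
  have hM: "(\<lambda>\<omega>. h \<sigma> (design n X \<omega>)) \<in> borel_measurable M" if "\<sigma> \<in> spins n" for \<sigma>
    by (rule measurable_compose[OF D h[OF that]])
  have c_eq: "AE \<omega> in M. ?c \<sigma> \<omega> = ennreal (cond_pmf n d E g \<theta> (design n X \<omega>) \<sigma>)" if s: "\<sigma> \<in> spins n" for \<sigma>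
  proof -
    have [measurable]: "?A \<sigma> \<in> sets M" by (rule A[OF s])
    have ind: "(\<lambda>\<omega>. ennreal (indicator (?A \<sigma>) \<omega>)) \<in> borel_measurable M" by measurable
    have neg: "(\<lambda>\<omega>. ennreal (- indicator (?A \<sigma>) \<omega>)) = (\<lambda>_. 0)"
      by (auto simp: fun_eq_iff indicator_def ennreal_neg)
    have "AE \<omega> in M. 1 = nn_cond_exp M ?F (\<lambda>_. 1) \<omega>" by (rule F.nn_cond_exp_F_meas) simp
    moreover have "AE \<omega> in M. ?c \<sigma> \<omega> \<le> nn_cond_exp M ?F (\<lambda>_. 1) \<omega>"
      using ind by (intro F.nn_cond_exp_mono) (auto simp: indicator_def)
    moreover have "AE \<omega> in M. 0 = nn_cond_exp M ?F (\<lambda>_. 0) \<omega>" by (rule F.nn_cond_exp_F_meas) simp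
    moreover note pmf[OF s]
    ultimately show ?thesis
    proof (eventually_elim)
      case (elim \<omega>)
      have "?c \<sigma> \<omega> \<noteq> \<top>" using elim(1,2) by (auto simp: top_unique)
      moreover have "enn2real (?c \<sigma> \<omega>) = cond_pmf n d E g \<theta> (design n X \<omega>) \<sigma>"
        using elim(3,4) unfolding real_cond_exp_def neg by simp
      ultimately show ?case using ennreal_enn2real[of "?c \<sigma> \<omega>"] by (simp add: less_top)
    qed
  qed
  have "(\<integral>\<^sup>+\<omega>. h (y \<omega>) (design n X \<omega>) \<partial>M)
      = (\<integral>\<^sup>+\<omega>. (\<Sum>\<sigma>\<in>spins n. h \<sigma> (design n X \<omega>) * ennreal (indicator (?A \<sigma>) \<omega>)) \<partial>M)"
  proof (intro nn_integral_cong)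
    fix \<omega> assume w: "\<omega> \<in> space M"
    then have "y \<omega> \<in> spins n" using measurable_space[OF y] by simp
    have "(\<Sum>\<sigma>\<in>spins n. h \<sigma> (design n X \<omega>) * ennreal (indicator (?A \<sigma>) \<omega>))
        = (\<Sum>\<sigma>\<in>spins n. if \<sigma> = y \<omega> then h \<sigma> (design n X \<omega>) else 0)"
      using w by (intro sum.cong) (auto simp: indicator_def)
    also have "\<dots> = h (y \<omega>) (design n X \<omega>)"
      using \<open>y \<omega> \<in> spins n\<close> finite_spins by simp
    finally show "h (y \<omega>) (design n X \<omega>) = (\<Sum>\<sigma>\<in>spins n. h \<sigma> (design n X \<omega>) * ennreal (indicator (?A \<sigma>) \<omega>))"
      by simp
  qed
  also have "\<dots> = (\<Sum>\<sigma>\<in>spins n. \<integral>\<^sup>+\<omega>. h \<sigma> (design n X \<omega>) * ennreal (indicator (?A \<sigma>) \<omega>) \<partial>M)"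
    using hM A by (intro nn_integral_sum borel_measurable_times_ennreal measurable_compose[OF _ measurable_ennreal] borel_measurable_indicator) auto
  also have "\<dots> = (\<Sum>\<sigma>\<in>spins n. \<integral>\<^sup>+\<omega>. h \<sigma> (design n X \<omega>) * ?c \<sigma> \<omega> \<partial>M)"
  proof (intro sum.cong refl)
    fix \<sigma> assume s: "\<sigma> \<in> spins n"
    show "(\<integral>\<^sup>+\<omega>. h \<sigma> (design n X \<omega>) * ennreal (indicator (?A \<sigma>) \<omega>) \<partial>M) = (\<integral>\<^sup>+\<omega>. h \<sigma> (design n X \<omega>) * ?c \<sigma> \<omega> \<partial>M)"
      using hF[OF s] A[OF s] by (intro F.nn_cond_exp_intg[symmetric]) auto
  qed
  also have "\<dots> = (\<integral>\<^sup>+\<omega>. (\<Sum>\<sigma>\<in>spins n. h \<sigma> (design n X \<omega>) * ?c \<sigma> \<omega>) \<partial>M)"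
    using hM by (intro nn_integral_sum[symmetric]) auto
  also have "\<dots> = (\<integral>\<^sup>+\<omega>. (\<Sum>\<sigma>\<in>spins n. ennreal (cond_pmf n d E g \<theta> (design n X \<omega>) \<sigma>) * h \<sigma> (design n X \<omega>)) \<partial>M)"
  proof (rule nn_integral_cong_AE)
    have "AE \<omega> in M. \<forall>\<sigma>\<in>spins n. ?c \<sigma> \<omega> = ennreal (cond_pmf n d E g \<theta> (design n X \<omega>) \<sigma>)"
      using c_eq finite_spins by (intro AE_finite_allI) auto
    then show "AE \<omega> in M. (\<Sum>\<sigma>\<in>spins n. h \<sigma> (design n X \<omega>) * ?c \<sigma> \<omega>)
        = (\<Sum>\<sigma>\<in>spins n. ennreal (cond_pmf n d E g \<theta> (design n X \<omega>) \<sigma>) * h \<sigma> (design n X \<omega>))"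
      by eventually_elim (auto intro!: sum.cong simp: mult.commute)
  qed
  finally show ?thesis .
qed

section \<open>The score at the true parameter\<close>

lemma borel_measurable_tanh [measurable]: "(tanh :: real \<Rightarrow> real) \<in> borel_measurable borel"
  by (intro borel_measurable_continuous_onI continuous_intros) auto

text \<open>
  The model at a single sample size, with the loss evaluated on the strong independent set \<open>I\<close>. The
  constants defined below depend on \<open>K\<close>, \<open>B\<close> and \<open>\<kappa>\<close> only, so the bounds are uniform over a sequence of such
  models.
\<close>

locale ising_regression = prob_space M for M :: "'a measure" +
  fixes n d :: nat and E :: "nat set set" and g :: "nat set \<Rightarrow> real" and \<theta> :: "nat \<Rightarrow> real"
    and X :: "nat \<Rightarrow> 'a \<Rightarrow> nat \<Rightarrow> real" and y :: "'a \<Rightarrow> nat \<Rightarrow> real"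
    and I :: "nat set" and K B \<kappa> :: real
  assumes n_pos: "1 \<le> n" and d_pos: "1 \<le> d"
    and hypergraph: "weighted_hypergraph n E g"
    and weights: "\<And>i. i < n \<Longrightarrow> (\<Sum>e | e \<in> E \<and> i \<in> e. g e) \<le> 1"
    and param_Rd: "\<theta> \<in> Rd d"
    and param_norm: "L2_set \<theta> {..<d} \<le> K"
    and covariates: "iid_covariates M n d X"
    and response: "ising_response M n d E g \<theta> X y"
    and subgauss: "\<And>i. i < n \<Longrightarrow> subgauss_vec_norm M d (X i) \<le> ennreal B"
    and kappa_pos: "0 < \<kappa>"
    and moment_min: "1 / \<kappa> \<le> lambda_min (second_moment M d (X 0))"
    and independent_set: "strong_independent n E I"
    and sample_nonempty: "I \<noteq> {}"
begin

text \<open>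
  A scale at which the exponential square integral of every unit projection of a covariate is at most
  \<open>2\<close>.
\<close>

definition T :: real where "T = \<bar>B\<bar> + 1"

definition residual :: "nat \<Rightarrow> 'a \<Rightarrow> real" where
  "residual i \<omega> = y \<omega> i - tanh (local_field E g (y \<omega>) i + dotp d (X i \<omega>) \<theta>)"

definition score :: "nat \<Rightarrow> 'a \<Rightarrow> real" where
  "score k \<omega> = (\<Sum>i\<in>I. residual i \<omega> * X i \<omega> k)"

text \<open>
  Chosen so that the observations with \<open>\<bar>X \<bullet> \<theta>\<bar>\<close> above it carry at most half of the lower bound
  \<open>1 / \<kappa>\<close> on the second moment in any direction.
\<close>

definition cutoff :: real where "cutoff = sqrt (4 * \<kappa> * T ^ 4 * (1 + K ^ 4))"

text \<open>
  The indicator of a signal below the cutoff. For these observations the second derivative of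
  \<open>ln cosh\<close> is bounded below.
\<close>

definition moderate :: "nat \<Rightarrow> 'a \<Rightarrow> real" where
  "moderate i \<omega> = indicator {- cutoff..cutoff} (dotp d (X i \<omega>) \<theta>)"

text \<open>
  The truncated Gram matrix, summed over the sample rather than averaged.
\<close>

definition gram :: "nat \<Rightarrow> nat \<Rightarrow> 'a \<Rightarrow> real" where
  "gram k l \<omega> = (\<Sum>i\<in>I. moderate i \<omega> * X i \<omega> k * X i \<omega> l)"

definition gram_mean :: "nat \<Rightarrow> nat \<Rightarrow> real" where
  "gram_mean k l = expectation (\<lambda>\<omega>. moderate 0 \<omega> * X 0 \<omega> k * X 0 \<omega> l)"

lemma T_pos: "0 < T" "1 \<le> T" by (auto simp: T_def)

lemma I_subset: "I \<subseteq> {..<n}" using independent_set by (simp add: strong_independent_def)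

lemma finite_I: "finite I" using I_subset finite_subset by blast

lemma card_I_pos: "0 < real (card I)" using finite_I sample_nonempty by (simp add: card_gt_0_iff)

lemma I_less: "i \<in> I \<Longrightarrow> i < n" using I_subset by auto

lemma indep_X: "indep_vars (\<lambda>_. borel_Rd d) X {..<n}"
  using covariates by (simp add: iid_covariates_def)

lemma indep_X_I: "indep_vars (\<lambda>_. borel_Rd d) X I"
  by (rule indep_vars_subset[OF indep_X I_subset])

lemma X_measurable: "i < n \<Longrightarrow> X i \<in> measurable M (borel_Rd d)"
  using indep_X by (simp add: indep_vars_def)

lemma coordinate_measurable: "k < d \<Longrightarrow> (\<lambda>v. v k) \<in> borel_measurable (borel_Rd d)"
  unfolding borel_Rd_def by (rule measurable_component_singleton) simp

lemma dotp_measurable: "(\<lambda>v. dotp d v w) \<in> borel_measurable (borel_Rd d)"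
  unfolding dotp_def by (intro borel_measurable_sum borel_measurable_times coordinate_measurable) auto

lemma X_coordinate_measurable: "i < n \<Longrightarrow> k < d \<Longrightarrow> (\<lambda>\<omega>. X i \<omega> k) \<in> borel_measurable M"
  by (rule measurable_compose[OF X_measurable coordinate_measurable])

lemma X_dotp_measurable: "i < n \<Longrightarrow> (\<lambda>\<omega>. dotp d (X i \<omega>) w) \<in> borel_measurable M"
  by (rule measurable_compose[OF X_measurable dotp_measurable])

lemma y_measurable: "y \<in> measurable M (count_space (spins n))"
  using response by (simp add: ising_response_def)

lemma y_spins: "\<omega> \<in> space M \<Longrightarrow> y \<omega> \<in> spins n"
  using measurable_space[OF y_measurable] by simp

lemma of_y_measurable: "(\<lambda>\<omega>. f (y \<omega>)) \<in> borel_measurable M" for f :: "(nat \<Rightarrow> real) \<Rightarrow> real"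
  by (rule measurable_compose[OF y_measurable]) simp

lemma unit_projection_subgauss:
  "i < n \<Longrightarrow> L2_set u {..<d} = 1 \<Longrightarrow> (\<integral>\<^sup>+\<omega>. ennreal (exp ((dotp d (X i \<omega>) u)\<^sup>2 / T\<^sup>2)) \<partial>M) \<le> 2"
  unfolding T_def by (rule subgauss_vec_normD[OF subgauss X_measurable])

lemma dotp_unit: "k < d \<Longrightarrow> dotp d v (\<lambda>j. if j = k then 1 else 0) = v k"
proof -
  assume "k < d"
  have "dotp d v (\<lambda>j. if j = k then 1 else 0) = (\<Sum>j<d. if j = k then v j else 0)"
    unfolding dotp_def by (intro sum.cong) auto
  with \<open>k < d\<close> show ?thesis by simp
qed

lemma L2_set_unit: "k < d \<Longrightarrow> L2_set (\<lambda>j. if j = k then 1 else 0 :: real) {..<d} = 1"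
proof -
  assume "k < d"
  have "(\<Sum>j<d. (if j = k then 1 else 0 :: real)\<^sup>2) = (\<Sum>j<d. if j = k then 1 else 0)"
    by (intro sum.cong) auto
  with \<open>k < d\<close> show ?thesis by (simp add: L2_set_def)
qed

lemma coordinate_subgauss:
  assumes "i < n" "k < d"
  shows "(\<integral>\<^sup>+\<omega>. ennreal (exp ((X i \<omega> k)\<^sup>2 / T\<^sup>2)) \<partial>M) \<le> 2"
  using unit_projection_subgauss[OF assms(1) L2_set_unit[OF assms(2)]] by (simp add: dotp_unit[OF assms(2)])

lemma abs_residual_le: "\<omega> \<in> space M \<Longrightarrow> i < n \<Longrightarrow> \<bar>residual i \<omega>\<bar> \<le> 2"
  using spins_values[OF y_spins, of \<omega> i]
    tanh_real_bounds[of "local_field E g (y \<omega>) i + dotp d (X i \<omega>) \<theta>"]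
  by (auto simp: residual_def abs_le_iff)

lemma score_measurable:
  assumes "k < d" shows "score k \<in> borel_measurable M"
proof -
  have "(\<lambda>\<omega>. residual i \<omega> * X i \<omega> k) \<in> borel_measurable M" if i: "i \<in> I" for i
  proof -
    note of_y_measurable[of "\<lambda>y. local_field E g y i", measurable]
      of_y_measurable[of "\<lambda>y. y i", measurable]
      X_dotp_measurable[OF I_less[OF i], measurable]
      X_coordinate_measurable[OF I_less[OF i] assms, measurable]
    show ?thesis unfolding residual_def by measurable
  qed
  then show ?thesis unfolding score_def by (intro borel_measurable_sum)
qed

text \<open>
  For \<open>t\<^sup>2 T\<^sup>2 \<le> 2\<close> the conditional Gaussian bound leaves \<open>exp (t\<^sup>2 X\<^sub>i\<^sub>k\<^sup>2 / 2)\<close>, which the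
  sub-Gaussian covariates integrate. For larger \<open>t\<close> that integral may diverge, but the residuals are
  bounded by \<open>2\<close> and \<open>2 \<bar>t X\<^sub>i\<^sub>k\<bar> \<le> t\<^sup>2 T\<^sup>2 + X\<^sub>i\<^sub>k\<^sup>2 / T\<^sup>2\<close>, where the first summand
  already has the required size and the second contributes a factor of at most \<open>2\<close>, absorbed because
  \<open>t\<^sup>2 T\<^sup>2 > 2\<close>.
\<close>

lemma score_mgf:
  assumes k: "k < d"
  shows "(\<integral>\<^sup>+\<omega>. ennreal (exp (t * score k \<omega>)) \<partial>M) \<le> ennreal (exp (real (card I) * (2 * t\<^sup>2 * T\<^sup>2)))"
proof (cases "t\<^sup>2 * T\<^sup>2 / 2 \<le> 1")
  case True
  define a where "a = t\<^sup>2 * T\<^sup>2 / 2"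
  have a: "0 \<le> a" "a \<le> 1" using True by (auto simp: a_def)
  define h where "h \<sigma> x = ennreal (exp (\<Sum>i\<in>I. (t * x i k)
      * (\<sigma> i - tanh (local_field E g \<sigma> i + dotp d (x i) \<theta>))))" for \<sigma> :: "nat \<Rightarrow> real" and x :: "nat \<Rightarrow> nat \<Rightarrow> real"
  have dX: "design n X \<omega> i = X i \<omega>" if "i \<in> I" for \<omega> i
    using I_less[OF that] by (simp add: design_def)
  have h_meas: "h \<sigma> \<in> borel_measurable (PiM {..<n} (\<lambda>_. borel_Rd d))" for \<sigma>
  proof -
    have comp: "(\<lambda>x. x i) \<in> measurable (PiM {..<n} (\<lambda>_. borel_Rd d)) (borel_Rd d)" if "i \<in> I" for i
      using I_less[OF that] by (intro measurable_component_singleton) auto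
    have "(\<lambda>x. \<Sum>i\<in>I. (t * x i k) * (\<sigma> i - tanh (local_field E g \<sigma> i + dotp d (x i) \<theta>)))
        \<in> borel_measurable (PiM {..<n} (\<lambda>_. borel_Rd d))"
    proof (intro borel_measurable_sum)
      fix i assume i: "i \<in> I"
      note measurable_compose[OF comp[OF i] coordinate_measurable[OF k], measurable]
      note measurable_compose[OF comp[OF i] dotp_measurable[of \<theta>], measurable]
      show "(\<lambda>x. (t * x i k) * (\<sigma> i - tanh (local_field E g \<sigma> i + dotp d (x i) \<theta>)))
          \<in> borel_measurable (PiM {..<n} (\<lambda>_. borel_Rd d))"
        by measurable
    qed
    then show ?thesis unfolding h_def by measurable
  qed
  have "(\<integral>\<^sup>+\<omega>. ennreal (exp (t * score k \<omega>)) \<partial>M) = (\<integral>\<^sup>+\<omega>. h (y \<omega>) (design n X \<omega>) \<partial>M)"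
    unfolding h_def score_def residual_def sum_distrib_left
    by (intro nn_integral_cong arg_cong[where f = "\<lambda>z. ennreal (exp z)"] sum.cong refl) (simp add: dX mult_ac)
  also have "\<dots> = (\<integral>\<^sup>+\<omega>. (\<Sum>\<sigma>\<in>spins n. ennreal (cond_pmf n d E g \<theta> (design n X \<omega>) \<sigma>) * h \<sigma> (design n X \<omega>)) \<partial>M)"
    by (rule nn_integral_ising_response[OF response X_measurable h_meas])
  also have "\<dots> \<le> (\<integral>\<^sup>+\<omega>. ennreal (exp (\<Sum>i\<in>I. a * ((X i \<omega> k)\<^sup>2 / T\<^sup>2))) \<partial>M)"
  proof (intro nn_integral_mono)
    fix \<omega>
    have "(\<Sum>\<sigma>\<in>spins n. ennreal (cond_pmf n d E g \<theta> (design n X \<omega>) \<sigma>) * h \<sigma> (design n X \<omega>))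
      = ennreal (\<Sum>\<sigma>\<in>spins n. cond_pmf n d E g \<theta> (design n X \<omega>) \<sigma>
          * exp (\<Sum>i\<in>I. (t * design n X \<omega> i k)
            * (\<sigma> i - tanh (local_field E g \<sigma> i + dotp d (design n X \<omega> i) \<theta>))))"
      unfolding h_def
      by (subst sum_ennreal[symmetric])
        (auto intro!: sum.cong mult_nonneg_nonneg cond_pmf_nonneg ennreal_mult[symmetric])
    also have "\<dots> \<le> ennreal (exp (\<Sum>i\<in>I. (t * design n X \<omega> i k)\<^sup>2 / 2))"
      by (intro ennreal_leI cond_pmf_mgf hypergraph independent_set)
    also have "(\<Sum>i\<in>I. (t * design n X \<omega> i k)\<^sup>2 / 2) = (\<Sum>i\<in>I. a * ((X i \<omega> k)\<^sup>2 / T\<^sup>2))"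
      using T_pos by (intro sum.cong refl) (simp add: dX a_def power_mult_distrib)
    finally show "(\<Sum>\<sigma>\<in>spins n. ennreal (cond_pmf n d E g \<theta> (design n X \<omega>) \<sigma>) * h \<sigma> (design n X \<omega>))
      \<le> ennreal (exp (\<Sum>i\<in>I. a * ((X i \<omega> k)\<^sup>2 / T\<^sup>2)))" .
  qed
  also have "\<dots> \<le> ennreal (exp (real (card I) * a))"
  proof (rule nn_integral_exp_sum_le[OF finite_I])
    show "indep_vars (\<lambda>_. borel) (\<lambda>i \<omega>. a * ((X i \<omega> k)\<^sup>2 / T\<^sup>2)) I"
      by (intro indep_vars_compose2[OF indep_X_I] borel_measurable_times borel_measurable_divide
          borel_measurable_add borel_measurable_power borel_measurable_const coordinate_measurable k)
    fix i assume i: "i \<in> I"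
    have [measurable]: "(\<lambda>\<omega>. X i \<omega> k) \<in> borel_measurable M" by (rule X_coordinate_measurable[OF I_less[OF i] k])
    show "(\<integral>\<^sup>+\<omega>. ennreal (exp (a * ((X i \<omega> k)\<^sup>2 / T\<^sup>2))) \<partial>M) \<le> ennreal (exp a)"
      by (intro nn_integral_exp_mult_le a coordinate_subgauss I_less[OF i] k) measurable
  qed
  also have "\<dots> \<le> ennreal (exp (real (card I) * (2 * t\<^sup>2 * T\<^sup>2)))"
    by (intro ennreal_leI iffD2[OF exp_le_cancel_iff] mult_left_mono) (auto simp: a_def)
  finally show ?thesis .
next
  case False
  have "(\<integral>\<^sup>+\<omega>. ennreal (exp (t * score k \<omega>)) \<partial>M) \<le> (\<integral>\<^sup>+\<omega>. ennreal (exp (\<Sum>i\<in>I. t\<^sup>2 * T\<^sup>2 + (X i \<omega> k)\<^sup>2 / T\<^sup>2)) \<partial>M)"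
  proof (intro nn_integral_mono ennreal_leI iffD2[OF exp_le_cancel_iff])
    fix \<omega> assume w: "\<omega> \<in> space M"
    show "t * score k \<omega> \<le> (\<Sum>i\<in>I. t\<^sup>2 * T\<^sup>2 + (X i \<omega> k)\<^sup>2 / T\<^sup>2)"
      unfolding score_def sum_distrib_left
    proof (intro sum_mono)
      fix i assume i: "i \<in> I"
      have "t * (residual i \<omega> * X i \<omega> k) \<le> \<bar>residual i \<omega>\<bar> * (\<bar>t\<bar> * \<bar>X i \<omega> k\<bar>)"
        using abs_ge_self[of "t * (residual i \<omega> * X i \<omega> k)"] by (simp add: abs_mult mult_ac)
      also have "\<dots> \<le> 2 * (\<bar>t\<bar> * \<bar>X i \<omega> k\<bar>)"
        using abs_residual_le[OF w I_less[OF i]] by (intro mult_right_mono) auto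
      also have "\<dots> = 2 * (\<bar>t\<bar> * T) * (\<bar>X i \<omega> k\<bar> / T)" using T_pos by simp
      also have "\<dots> \<le> (\<bar>t\<bar> * T)\<^sup>2 + (\<bar>X i \<omega> k\<bar> / T)\<^sup>2" by (rule sum_squares_bound)
      also have "\<dots> = t\<^sup>2 * T\<^sup>2 + (X i \<omega> k)\<^sup>2 / T\<^sup>2" by (simp add: power_mult_distrib power_divide)
      finally show "t * (residual i \<omega> * X i \<omega> k) \<le> t\<^sup>2 * T\<^sup>2 + (X i \<omega> k)\<^sup>2 / T\<^sup>2" .
    qed
  qed
  also have "\<dots> \<le> ennreal (exp (real (card I) * (t\<^sup>2 * T\<^sup>2 + 1)))"
  proof (rule nn_integral_exp_sum_le[OF finite_I])
    show "indep_vars (\<lambda>_. borel) (\<lambda>i \<omega>. t\<^sup>2 * T\<^sup>2 + (X i \<omega> k)\<^sup>2 / T\<^sup>2) I"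
      by (intro indep_vars_compose2[OF indep_X_I] borel_measurable_times borel_measurable_divide
          borel_measurable_add borel_measurable_power borel_measurable_const coordinate_measurable k)
    fix i assume i: "i \<in> I"
    have [measurable]: "(\<lambda>\<omega>. X i \<omega> k) \<in> borel_measurable M" by (rule X_coordinate_measurable[OF I_less[OF i] k])
    have "(\<integral>\<^sup>+\<omega>. ennreal (exp (t\<^sup>2 * T\<^sup>2 + (X i \<omega> k)\<^sup>2 / T\<^sup>2)) \<partial>M)
        = ennreal (exp (t\<^sup>2 * T\<^sup>2)) * (\<integral>\<^sup>+\<omega>. ennreal (exp ((X i \<omega> k)\<^sup>2 / T\<^sup>2)) \<partial>M)"
      by (subst nn_integral_cmult[symmetric]) (auto simp: exp_add ennreal_mult)
    also have "\<dots> \<le> ennreal (exp (t\<^sup>2 * T\<^sup>2)) * ennreal 2"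
      using coordinate_subgauss[OF I_less[OF i] k] by (intro mult_left_mono) auto
    also have "\<dots> \<le> ennreal (exp (t\<^sup>2 * T\<^sup>2)) * ennreal (exp 1)"
      using exp_ge_add_one_self[of 1] by (intro mult_left_mono ennreal_leI) auto
    also have "\<dots> = ennreal (exp (t\<^sup>2 * T\<^sup>2 + 1))" by (simp add: exp_add ennreal_mult)
    finally show "(\<integral>\<^sup>+\<omega>. ennreal (exp (t\<^sup>2 * T\<^sup>2 + (X i \<omega> k)\<^sup>2 / T\<^sup>2)) \<partial>M) \<le> ennreal (exp (t\<^sup>2 * T\<^sup>2 + 1))" .
  qed
  also have "\<dots> \<le> ennreal (exp (real (card I) * (2 * t\<^sup>2 * T\<^sup>2)))"
    using False by (intro ennreal_leI iffD2[OF exp_le_cancel_iff] mult_left_mono) auto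
  finally show ?thesis .
qed

lemma score_tail:
  assumes k: "k < d" and r: "0 < r"
  shows "prob {\<omega>\<in>space M. real (card I) * r < \<bar>score k \<omega>\<bar>} \<le> 2 * exp (- (real (card I) * r\<^sup>2 / (8 * T\<^sup>2)))"
proof -
  let ?N = "real (card I)"
  \<comment> \<open>minimizes the exponent \<open>2 t\<^sup>2 T\<^sup>2 - t r\<close> per observation\<close>
  define t where "t = r / (4 * T\<^sup>2)"
  have t: "0 < t" using r T_pos by (simp add: t_def)
  have "prob {\<omega>\<in>space M. ?N * r < \<bar>score k \<omega>\<bar>} \<le> 2 * exp (?N * (2 * t\<^sup>2 * T\<^sup>2)) * exp (- (t * (?N * r)))"
    using score_mgf[OF k, of t] score_mgf[OF k, of "- t"] t score_measurable[OF k]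
    by (intro prob_abs_le_Chernoff) auto
  also have "\<dots> = 2 * exp (?N * (2 * t\<^sup>2 * T\<^sup>2) + - (t * (?N * r)))"
    unfolding exp_add by simp
  also have "?N * (2 * t\<^sup>2 * T\<^sup>2) + - (t * (?N * r)) = - (?N * r\<^sup>2 / (8 * T\<^sup>2))"
    using T_pos by (simp add: t_def power2_eq_square field_simps)
  finally show ?thesis .
qed

end

section \<open>Concentration and lower bound for the truncated Gram matrix\<close>

text \<open>
  The loss minus its linearization is an average of the gaps between \<open>ln cosh\<close> and its tangents; the
  responses enter through the linear part only.
\<close>

lemma pseudo_loss_expansion:
  fixes x :: "nat \<Rightarrow> nat \<Rightarrow> real" and y \<theta> v a :: "nat \<Rightarrow> real"
  assumes a_def: "\<And>i. a i = local_field E g y i + dotp d (x i) \<theta>"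
  shows "pseudo_loss d E g x y I (\<lambda>k. \<theta> k + v k) = pseudo_loss d E g x y I \<theta>
    + (\<Sum>k<d. - (1 / real (card I)) * (\<Sum>i\<in>I. (y i - tanh (a i)) * x i k) * v k)
    + 1 / real (card I) * (\<Sum>i\<in>I. ln (cosh (a i + dotp d (x i) v)) - ln (cosh (a i)) - tanh (a i) * dotp d (x i) v)"
proof -
  let ?c = "1 / real (card I)"
  have "(\<Sum>k<d. - ?c * (\<Sum>i\<in>I. (y i - tanh (a i)) * x i k) * v k)
      = (\<Sum>k<d. \<Sum>i\<in>I. - ?c * ((y i - tanh (a i)) * (x i k * v k)))"
    by (simp add: sum_distrib_left sum_distrib_right mult_ac)
  also have "\<dots> = (\<Sum>i\<in>I. \<Sum>k<d. - ?c * ((y i - tanh (a i)) * (x i k * v k)))" by (rule sum.swap)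
  also have "\<dots> = - ?c * (\<Sum>i\<in>I. (y i - tanh (a i)) * dotp d (x i) v)"
    by (simp add: sum_distrib_left dotp_def)
  finally have lin: "(\<Sum>k<d. - ?c * (\<Sum>i\<in>I. (y i - tanh (a i)) * x i k) * v k)
      = - ?c * (\<Sum>i\<in>I. (y i - tanh (a i)) * dotp d (x i) v)" .
  have "local_field E g y i + dotp d (x i) (\<lambda>k. \<theta> k + v k) = a i + dotp d (x i) v" for i
    by (simp add: a_def dotp_def sum.distrib distrib_left)
  then have "pseudo_loss d E g x y I (\<lambda>k. \<theta> k + v k)
      = - ?c * (\<Sum>i\<in>I. y i * (a i + dotp d (x i) v) - ln (cosh (a i + dotp d (x i) v)))"
    unfolding pseudo_loss_def by simp
  moreover have "pseudo_loss d E g x y I \<theta> = - ?c * (\<Sum>i\<in>I. y i * a i - ln (cosh (a i)))"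
    unfolding pseudo_loss_def a_def by simp
  moreover have "- ?c * (\<Sum>i\<in>I. y i * (a i + dotp d (x i) v) - ln (cosh (a i + dotp d (x i) v)))
      = - ?c * (\<Sum>i\<in>I. y i * a i - ln (cosh (a i)))
        + - ?c * (\<Sum>i\<in>I. (y i - tanh (a i)) * dotp d (x i) v)
        + - ?c * (\<Sum>i\<in>I. - (ln (cosh (a i + dotp d (x i) v)) - ln (cosh (a i)) - tanh (a i) * dotp d (x i) v))"
    unfolding distrib_left[symmetric] sum.distrib[symmetric]
    by (intro arg_cong2[where f = "(*)"] sum.cong refl) (simp add: algebra_simps)
  moreover have "- ?c * (\<Sum>i\<in>I. - (ln (cosh (a i + dotp d (x i) v)) - ln (cosh (a i)) - tanh (a i) * dotp d (x i) v))
      = ?c * (\<Sum>i\<in>I. ln (cosh (a i + dotp d (x i) v)) - ln (cosh (a i)) - tanh (a i) * dotp d (x i) v)"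
    unfolding sum_negf by simp
  ultimately show ?thesis using lin by simp
qed

lemma dotp_square: "(dotp d x v)\<^sup>2 = (\<Sum>k<d. \<Sum>l<d. x k * x l * v k * v l)"
  unfolding dotp_def power2_eq_square sum_product by (intro sum.cong refl) (simp add: mult_ac)

lemma abs_dotp_le: "(\<And>k. k < d \<Longrightarrow> \<bar>x k\<bar> \<le> c) \<Longrightarrow> \<bar>dotp d x v\<bar> \<le> c * l1_norm d v"
  unfolding dotp_def l1_norm_def sum_distrib_left
  by (intro order_trans[OF sum_abs] sum_mono) (auto simp: abs_mult intro!: mult_right_mono)

lemma (in prob_space) quadratic_form_expectation:
  fixes f :: "nat \<Rightarrow> nat \<Rightarrow> 'a \<Rightarrow> real"
  assumes f: "\<And>k l. k < d \<Longrightarrow> l < d \<Longrightarrow> integrable M (f k l)"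
  shows "integrable M (\<lambda>\<omega>. \<Sum>k<d. \<Sum>l<d. f k l \<omega> * v k * v l)"
    and "expectation (\<lambda>\<omega>. \<Sum>k<d. \<Sum>l<d. f k l \<omega> * v k * v l)
      = (\<Sum>k<d. \<Sum>l<d. expectation (f k l) * v k * v l)"
proof -
  have t: "integrable M (\<lambda>\<omega>. f k l \<omega> * v k * v l)" if "k < d" "l < d" for k l
    by (intro integrable_mult_left f that)
  have r: "integrable M (\<lambda>\<omega>. \<Sum>l<d. f k l \<omega> * v k * v l)" if "k < d" for k
    by (rule Bochner_Integration.integrable_sum) (rule t[OF that], simp)
  show "integrable M (\<lambda>\<omega>. \<Sum>k<d. \<Sum>l<d. f k l \<omega> * v k * v l)"
    by (rule Bochner_Integration.integrable_sum) (rule r, simp)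
  have "expectation (\<lambda>\<omega>. \<Sum>k<d. \<Sum>l<d. f k l \<omega> * v k * v l)
      = (\<Sum>k<d. expectation (\<lambda>\<omega>. \<Sum>l<d. f k l \<omega> * v k * v l))"
    by (rule Bochner_Integration.integral_sum) (rule r, simp)
  also have "\<dots> = (\<Sum>k<d. \<Sum>l<d. expectation (\<lambda>\<omega>. f k l \<omega> * v k * v l))"
    by (intro sum.cong refl Bochner_Integration.integral_sum t) auto
  finally show "expectation (\<lambda>\<omega>. \<Sum>k<d. \<Sum>l<d. f k l \<omega> * v k * v l)
      = (\<Sum>k<d. \<Sum>l<d. expectation (f k l) * v k * v l)"
    by (auto simp: f intro!: sum.cong)
qed

context ising_regression
begin

lemma zero_less_n: "0 < n" using n_pos by simp

lemma moderate_cases: "moderate i \<omega> = 0 \<or> moderate i \<omega> = 1"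
  by (auto simp: moderate_def indicator_def)

lemma moderate_nonneg: "0 \<le> moderate i \<omega>" and moderate_le: "moderate i \<omega> \<le> 1"
  by (auto simp: moderate_def indicator_def)

lemma truncated_product_measurable:
  assumes "k < d" "l < d"
  shows "(\<lambda>v. indicator {- cutoff..cutoff} (dotp d v \<theta>) * v k * v l :: real) \<in> borel_measurable (borel_Rd d)"
proof -
  note coordinate_measurable[OF assms(1), measurable] coordinate_measurable[OF assms(2), measurable]
    dotp_measurable[of \<theta>, measurable]
  show ?thesis by measurable
qed

lemma truncated_product_expectation:
  assumes i: "i < n" and kl: "k < d" "l < d"
  shows "expectation (\<lambda>\<omega>. moderate i \<omega> * X i \<omega> k * X i \<omega> l) = gram_mean k l"
proof -
  let ?f = "\<lambda>v. indicator {- cutoff..cutoff} (dotp d v \<theta>) * v k * v l :: real"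
  have "expectation (\<lambda>\<omega>. ?f (X j \<omega>)) = integral\<^sup>L (distr M (borel_Rd d) (X j)) ?f" if "j < n" for j
    by (rule integral_distr[symmetric, OF X_measurable[OF that] truncated_product_measurable[OF kl]])
  moreover have "distr M (borel_Rd d) (X i) = distr M (borel_Rd d) (X 0)"
    using covariates i zero_less_n unfolding iid_covariates_def by blast
  ultimately show ?thesis
    using i n_pos unfolding gram_mean_def moderate_def by simp
qed

lemma gram_measurable:
  assumes kl: "k < d" "l < d"
  shows "gram k l \<in> borel_measurable M"
  unfolding gram_def moderate_def
  by (intro borel_measurable_sum measurable_compose[OF X_measurable[OF I_less] truncated_product_measurable[OF kl]])

lemma half_sum_exp: "exp ((a + b) / 2) \<le> (exp a + exp b) / 2" for a b :: real
proof -
  have "2 * exp (a / 2) * exp (b / 2) \<le> (exp (a / 2))\<^sup>2 + (exp (b / 2))\<^sup>2" by (rule sum_squares_bound)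
  then show ?thesis by (simp add: exp_double[symmetric] exp_add add_divide_distrib)
qed

text \<open>
  By the arithmetic-geometric mean inequality a product of two sub-Gaussian coordinates is
  sub-exponential; the truncation only decreases its absolute value.
\<close>

lemma gram_tail:
  assumes kl: "k < d" "l < d" and u: "0 < u" "u \<le> 8"
  shows "prob {\<omega>\<in>space M. real (card I) * (u * T\<^sup>2) < \<bar>gram k l \<omega> - real (card I) * gram_mean k l\<bar>}
    \<le> 2 * exp (- (real (card I) * u\<^sup>2 / 32))"
proof -
  let ?N = "real (card I)"
  define U where "U i \<omega> = moderate i \<omega> * X i \<omega> k * X i \<omega> l / T\<^sup>2" for i \<omega>
  have T2: "0 < T\<^sup>2" using T_pos by simp
  have "prob {\<omega>\<in>space M. ?N * u < \<bar>(\<Sum>i\<in>I. U i \<omega>) - ?N * (gram_mean k l / T\<^sup>2)\<bar>}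
      \<le> 2 * exp (- (?N * u\<^sup>2 / 32))"
  proof (rule Bernstein_subexponential[OF finite_I])
    show "indep_vars (\<lambda>_. borel) U I"
      unfolding U_def moderate_def
      by (intro indep_vars_compose2[OF indep_X_I] borel_measurable_divide borel_measurable_const
          truncated_product_measurable kl)
    fix i assume i: "i \<in> I"
    show "expectation (U i) = gram_mean k l / T\<^sup>2"
      using truncated_product_expectation[OF I_less[OF i] kl] unfolding U_def by simp
    note X_coordinate_measurable[OF I_less[OF i] kl(1), measurable] X_coordinate_measurable[OF I_less[OF i] kl(2), measurable]
    have "(\<integral>\<^sup>+\<omega>. ennreal (exp \<bar>U i \<omega>\<bar>) \<partial>M)
        \<le> (\<integral>\<^sup>+\<omega>. ennreal (1 / 2) * (ennreal (exp ((X i \<omega> k)\<^sup>2 / T\<^sup>2)) + ennreal (exp ((X i \<omega> l)\<^sup>2 / T\<^sup>2))) \<partial>M)"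
    proof (intro nn_integral_mono)
      fix \<omega>
      have "\<bar>U i \<omega>\<bar> = moderate i \<omega> * (\<bar>X i \<omega> k\<bar> * \<bar>X i \<omega> l\<bar>) / T\<^sup>2"
        using moderate_nonneg[of i \<omega>] by (simp add: U_def abs_mult)
      also have "\<dots> \<le> 1 * (\<bar>X i \<omega> k\<bar> * \<bar>X i \<omega> l\<bar>) / T\<^sup>2"
        using T2 moderate_le[of i \<omega>] by (intro divide_right_mono mult_right_mono) auto
      also have "\<dots> \<le> ((X i \<omega> k)\<^sup>2 + (X i \<omega> l)\<^sup>2) / 2 / T\<^sup>2"
        using T2 sum_squares_bound[of "\<bar>X i \<omega> k\<bar>" "\<bar>X i \<omega> l\<bar>"] by (intro divide_right_mono) auto
      also have "\<dots> = ((X i \<omega> k)\<^sup>2 / T\<^sup>2 + (X i \<omega> l)\<^sup>2 / T\<^sup>2) / 2" by (simp add: add_divide_distrib)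
      finally have "exp \<bar>U i \<omega>\<bar> \<le> (exp ((X i \<omega> k)\<^sup>2 / T\<^sup>2) + exp ((X i \<omega> l)\<^sup>2 / T\<^sup>2)) / 2"
        using half_sum_exp by (meson exp_le_cancel_iff order_trans)
      then have "ennreal (exp \<bar>U i \<omega>\<bar>) \<le> ennreal (1 / 2 * (exp ((X i \<omega> k)\<^sup>2 / T\<^sup>2) + exp ((X i \<omega> l)\<^sup>2 / T\<^sup>2)))"
        by (intro ennreal_leI) simp
      also have "\<dots> = ennreal (1 / 2) * (ennreal (exp ((X i \<omega> k)\<^sup>2 / T\<^sup>2)) + ennreal (exp ((X i \<omega> l)\<^sup>2 / T\<^sup>2)))"
        by (subst ennreal_mult) auto
      finally show "ennreal (exp \<bar>U i \<omega>\<bar>)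
          \<le> ennreal (1 / 2) * (ennreal (exp ((X i \<omega> k)\<^sup>2 / T\<^sup>2)) + ennreal (exp ((X i \<omega> l)\<^sup>2 / T\<^sup>2)))" .
    qed
    also have "\<dots> = ennreal (1 / 2) * ((\<integral>\<^sup>+\<omega>. ennreal (exp ((X i \<omega> k)\<^sup>2 / T\<^sup>2)) \<partial>M) + (\<integral>\<^sup>+\<omega>. ennreal (exp ((X i \<omega> l)\<^sup>2 / T\<^sup>2)) \<partial>M))"
      by (subst nn_integral_cmult, measurable, subst nn_integral_add, measurable)
    also have "\<dots> \<le> ennreal (1 / 2) * (2 + 2)"
      using I_less[OF i] kl by (intro mult_left_mono add_mono coordinate_subgauss) auto
    also have "\<dots> = ennreal (1 / 2 * 4)" by (subst ennreal_mult) auto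
    finally show "(\<integral>\<^sup>+\<omega>. ennreal (exp \<bar>U i \<omega>\<bar>) \<partial>M) \<le> 2" by simp
  qed (use u in auto)
  also have "{\<omega>\<in>space M. ?N * u < \<bar>(\<Sum>i\<in>I. U i \<omega>) - ?N * (gram_mean k l / T\<^sup>2)\<bar>}
      = {\<omega>\<in>space M. ?N * (u * T\<^sup>2) < \<bar>gram k l \<omega> - ?N * gram_mean k l\<bar>}"
  proof -
    have "(\<Sum>i\<in>I. U i \<omega>) - ?N * (gram_mean k l / T\<^sup>2) = (gram k l \<omega> - ?N * gram_mean k l) / T\<^sup>2" for \<omega>
      by (simp add: U_def gram_def sum_divide_distrib diff_divide_distrib)
    then show ?thesis
      using T2 by (simp add: abs_divide pos_less_divide_eq mult.assoc)
  qed
  finally show ?thesis .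
qed

lemma coordinate_tail:
  assumes ik: "i < n" "k < d" and c: "0 \<le> c"
  shows "prob {\<omega>\<in>space M. c < \<bar>X i \<omega> k\<bar>} \<le> 2 * exp (- (c\<^sup>2 / T\<^sup>2))"
proof -
  note X_coordinate_measurable[OF ik, measurable]
  have "{\<omega>\<in>space M. c < \<bar>X i \<omega> k\<bar>} = {\<omega>\<in>space M. c\<^sup>2 / T\<^sup>2 < (X i \<omega> k)\<^sup>2 / T\<^sup>2}"
  proof -
    have "c < \<bar>z\<bar> \<longleftrightarrow> c\<^sup>2 / T\<^sup>2 < z\<^sup>2 / T\<^sup>2" for z :: real
      using T_pos c abs_le_square_iff[of z c] by (simp add: divide_less_cancel) (metis abs_of_nonneg not_le)
    then show ?thesis by simp
  qed
  also have "prob \<dots> \<le> 2 * exp (- (c\<^sup>2 / T\<^sup>2))"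
    using coordinate_subgauss[OF ik] by (intro prob_le_exp_Markov) auto
  finally show ?thesis .
qed

lemma unit_fourth_moment:
  assumes i: "i < n" and u: "L2_set u {..<d} = 1"
  shows "integrable M (\<lambda>\<omega>. (dotp d (X i \<omega>) u) ^ 4)" and "expectation (\<lambda>\<omega>. (dotp d (X i \<omega>) u) ^ 4) \<le> 4 * T ^ 4"
proof -
  note X_dotp_measurable[OF i, of u, measurable]
  have "(dotp d (X i \<omega>) u) ^ 4 \<le> 2 * T ^ 4 * exp ((dotp d (X i \<omega>) u)\<^sup>2 / T\<^sup>2)" for \<omega>
  proof -
    define z where "z = (dotp d (X i \<omega>) u)\<^sup>2 / T\<^sup>2"
    have z: "0 \<le> z" by (simp add: z_def)
    have "z\<^sup>2 \<le> 2 * exp z" using exp_lower_Taylor_quadratic[OF z] z by (simp add: field_simps)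
    then have "T ^ 4 * z\<^sup>2 \<le> T ^ 4 * (2 * exp z)" by (intro mult_left_mono) auto
    moreover have "T ^ 4 * z\<^sup>2 = (dotp d (X i \<omega>) u) ^ 4"
      using T_pos by (simp add: z_def power_divide flip: power_mult)
    ultimately show ?thesis by (simp add: z_def mult_ac)
  qed
  then show "integrable M (\<lambda>\<omega>. (dotp d (X i \<omega>) u) ^ 4)" "expectation (\<lambda>\<omega>. (dotp d (X i \<omega>) u) ^ 4) \<le> 4 * T ^ 4"
    using integral_le_of_exp_bound[of "\<lambda>\<omega>. (dotp d (X i \<omega>) u) ^ 4" "\<lambda>\<omega>. (dotp d (X i \<omega>) u)\<^sup>2 / T\<^sup>2" "2 * T ^ 4"]
      unit_projection_subgauss[OF i u] T_pos by auto
qed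

lemma fourth_moment:
  assumes i: "i < n"
  shows "integrable M (\<lambda>\<omega>. (dotp d (X i \<omega>) v) ^ 4)"
    and "expectation (\<lambda>\<omega>. (dotp d (X i \<omega>) v) ^ 4) \<le> 4 * T ^ 4 * (L2_set v {..<d}) ^ 4"
proof -
  define r where "r = L2_set v {..<d}"
  have "integrable M (\<lambda>\<omega>. (dotp d (X i \<omega>) v) ^ 4)
    \<and> expectation (\<lambda>\<omega>. (dotp d (X i \<omega>) v) ^ 4) \<le> 4 * T ^ 4 * r ^ 4"
  proof (cases "r = 0")
    case True
    then have "\<forall>k\<in>{..<d}. v k = 0" unfolding r_def by (simp add: L2_set_eq_0_iff)
    then have "dotp d w v = 0" for w by (simp add: dotp_def)
    then show ?thesis using True by simp
  next
    case False
    then have r: "0 < r" by (metis L2_set_nonneg r_def order_le_less)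
    define u where "u k = v k * inverse r" for k
    have "L2_set u {..<d} = r * inverse r"
      unfolding u_def r_def[symmetric] using r L2_set_left_distrib[of "inverse r" v "{..<d}"] by (simp add: r_def)
    then have u1: "L2_set u {..<d} = 1" using r by simp
    have "dotp d w v = r * dotp d w u" for w
      using r unfolding dotp_def u_def sum_distrib_left by (intro sum.cong) auto
    then have eq: "(dotp d w v) ^ 4 = r ^ 4 * (dotp d w u) ^ 4" for w by (simp add: power_mult_distrib)
    show ?thesis
      using unit_fourth_moment[OF i u1] r mult_left_mono[OF unit_fourth_moment(2)[OF i u1], of "r ^ 4"]
      by (simp add: eq mult_ac)
  qed
  then show "integrable M (\<lambda>\<omega>. (dotp d (X i \<omega>) v) ^ 4)"
    and "expectation (\<lambda>\<omega>. (dotp d (X i \<omega>) v) ^ 4) \<le> 4 * T ^ 4 * (L2_set v {..<d}) ^ 4"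
    by (auto simp: r_def)
qed

lemma product_integrable:
  assumes i: "i < n" and kl: "k < d" "l < d"
  shows "integrable M (\<lambda>\<omega>. X i \<omega> k * X i \<omega> l)"
proof -
  note X_coordinate_measurable[OF i kl(1), measurable] X_coordinate_measurable[OF i kl(2), measurable]
  have f: "integrable M (\<lambda>\<omega>. (X i \<omega> j) ^ 4)" if "j < d" for j
    using fourth_moment(1)[OF i, of "\<lambda>m. if m = j then 1 else 0"] by (simp add: dotp_unit[OF that])
  have int: "integrable M (\<lambda>\<omega>. 1 + (X i \<omega> k) ^ 4 + (X i \<omega> l) ^ 4)"
    using f kl by simp
  have le: "\<bar>a * b\<bar> \<le> 1 + a ^ 4 + b ^ 4" for a b :: real
  proof -
    have q: "2 * z\<^sup>2 \<le> 1 + z ^ 4" for z :: real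
      using sum_squares_bound[of "z\<^sup>2" 1] by (simp flip: power_mult)
    have "2 * \<bar>a\<bar> * \<bar>b\<bar> \<le> a\<^sup>2 + b\<^sup>2" using sum_squares_bound[of "\<bar>a\<bar>" "\<bar>b\<bar>"] by simp
    moreover have "0 \<le> a ^ 4" "0 \<le> b ^ 4" by auto
    ultimately show ?thesis
      using q[of a] q[of b] unfolding abs_mult by linarith
  qed
  show ?thesis
    by (rule Bochner_Integration.integrable_bound[OF int])
      (auto intro!: AE_I2 le)
qed

lemma second_moment_lower:
  "(\<Sum>k<d. (v k)\<^sup>2) / \<kappa> \<le> expectation (\<lambda>\<omega>. (dotp d (X 0 \<omega>) v)\<^sup>2)"
proof -
  let ?a = "\<lambda>k l. expectation (\<lambda>\<omega>. X 0 \<omega> k * X 0 \<omega> l)"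
  have "1 / \<kappa> * (\<Sum>k<d. (v k)\<^sup>2) \<le> lambda_min (mat d d (\<lambda>(k, l). ?a k l)) * (\<Sum>k<d. (v k)\<^sup>2)"
    using moment_min unfolding second_moment_def by (intro mult_right_mono sum_nonneg) auto
  also have "\<dots> \<le> (\<Sum>k<d. \<Sum>l<d. ?a k l * v k * v l)"
    by (rule quadratic_form_ge_lambda_min[OF _ d_pos]) (simp add: mult.commute)
  also have "\<dots> = expectation (\<lambda>\<omega>. (dotp d (X 0 \<omega>) v)\<^sup>2)"
    unfolding dotp_square using n_pos
    by (intro quadratic_form_expectation(2)[symmetric] product_integrable) auto
  finally show ?thesis by simp
qed

text \<open>
  Where the signal \<open>q = X \<bullet> \<theta>\<close> exceeds the cutoff, \<open>(X \<bullet> v)\<^sup>2\<close> is at most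
  \<open>(X \<bullet> v)\<^sup>2 q\<^sup>2 / cutoff\<^sup>2\<close>, and the mean of this product is controlled by fourth moments.
\<close>

lemma truncated_second_moment_lower:
  "(L2_set v {..<d})\<^sup>2 / (2 * \<kappa>) \<le> (\<Sum>k<d. \<Sum>l<d. gram_mean k l * v k * v l)"
proof -
  have n0: "0 < n" using n_pos by simp
  define r where "r = L2_set v {..<d}"
  define z where "z \<omega> = dotp d (X 0 \<omega>) v" for \<omega>
  define q where "q \<omega> = dotp d (X 0 \<omega>) \<theta>" for \<omega>
  have [measurable]: "z \<in> borel_measurable M" "q \<in> borel_measurable M"
    unfolding z_def q_def by (intro X_dotp_measurable n0)+
  have wm [measurable]: "moderate 0 \<in> borel_measurable M"
    unfolding moderate_def using X_dotp_measurable[OF n0, of \<theta>] by measurable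
  have z4: "integrable M (\<lambda>\<omega>. (z \<omega>) ^ 4)" "expectation (\<lambda>\<omega>. (z \<omega>) ^ 4) \<le> 4 * T ^ 4 * r ^ 4"
    using fourth_moment[OF n0, of v] by (auto simp: z_def r_def)
  have q4: "integrable M (\<lambda>\<omega>. (q \<omega>) ^ 4)"
    using fourth_moment(1)[OF n0, of \<theta>] by (simp add: q_def)
  have "expectation (\<lambda>\<omega>. (q \<omega>) ^ 4) \<le> 4 * T ^ 4 * (L2_set \<theta> {..<d}) ^ 4"
    using fourth_moment(2)[OF n0, of \<theta>] by (simp add: q_def)
  also have "\<dots> \<le> 4 * T ^ 4 * K ^ 4"
    using param_norm by (intro mult_left_mono power_mono) auto
  finally have q4b: "expectation (\<lambda>\<omega>. (q \<omega>) ^ 4) \<le> 4 * T ^ 4 * K ^ 4" .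
  have trunc_int: "integrable M (\<lambda>\<omega>. moderate 0 \<omega> * X 0 \<omega> k * X 0 \<omega> l)" if kl: "k < d" "l < d" for k l
  proof (rule Bochner_Integration.integrable_bound[OF product_integrable[OF n0 kl]])
    show "(\<lambda>\<omega>. moderate 0 \<omega> * X 0 \<omega> k * X 0 \<omega> l) \<in> borel_measurable M"
      using X_coordinate_measurable[OF n0 kl(1)] X_coordinate_measurable[OF n0 kl(2)] wm
      by (intro borel_measurable_times)
    show "AE \<omega> in M. norm (moderate 0 \<omega> * X 0 \<omega> k * X 0 \<omega> l) \<le> norm (X 0 \<omega> k * X 0 \<omega> l)"
    proof (intro AE_I2)
      fix \<omega>
      show "norm (moderate 0 \<omega> * X 0 \<omega> k * X 0 \<omega> l) \<le> norm (X 0 \<omega> k * X 0 \<omega> l)"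
        using moderate_cases[of 0 \<omega>] by auto
    qed
  qed
  have int_wz: "integrable M (\<lambda>\<omega>. moderate 0 \<omega> * (z \<omega>)\<^sup>2)"
    and eq: "(\<Sum>k<d. \<Sum>l<d. gram_mean k l * v k * v l) = expectation (\<lambda>\<omega>. moderate 0 \<omega> * (z \<omega>)\<^sup>2)"
  proof -
    have e: "moderate 0 \<omega> * (z \<omega>)\<^sup>2 = (\<Sum>k<d. \<Sum>l<d. moderate 0 \<omega> * X 0 \<omega> k * X 0 \<omega> l * v k * v l)" for \<omega>
      unfolding z_def dotp_square sum_distrib_left by (simp only: mult.assoc)
    show "integrable M (\<lambda>\<omega>. moderate 0 \<omega> * (z \<omega>)\<^sup>2)"
      unfolding e by (rule quadratic_form_expectation(1)[OF trunc_int])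
    show "(\<Sum>k<d. \<Sum>l<d. gram_mean k l * v k * v l) = expectation (\<lambda>\<omega>. moderate 0 \<omega> * (z \<omega>)\<^sup>2)"
      unfolding e gram_mean_def by (rule quadratic_form_expectation(2)[OF trunc_int, symmetric])
  qed
  show ?thesis
  proof (cases "r = 0")
    case True
    then show ?thesis unfolding eq using moderate_nonneg by (auto simp: r_def intro!: integral_nonneg)
  next
    case False
    then have r: "0 < r" by (metis L2_set_nonneg r_def order_le_less)
    have K4: "0 < 1 + K ^ 4" by (simp add: add_pos_nonneg)
    have c2: "cutoff\<^sup>2 = 4 * \<kappa> * T ^ 4 * (1 + K ^ 4)"
      unfolding cutoff_def using kappa_pos T_pos K4 by (intro real_sqrt_pow2) auto
    have c_pos: "0 < cutoff\<^sup>2" unfolding c2 using kappa_pos T_pos K4 by simp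
    have r2: "r\<^sup>2 = (\<Sum>k<d. (v k)\<^sup>2)" by (simp add: r_def L2_set_def sum_nonneg)
    have fourth: "(w\<^sup>2)\<^sup>2 = w ^ 4" for w :: real by (simp flip: power_mult)
    have amgm: "a * b \<le> (a\<^sup>2 + b\<^sup>2) / 2" for a b :: real
      using sum_squares_bound[of a b] by simp
    have pw: "(z \<omega>)\<^sup>2 \<le> moderate 0 \<omega> * (z \<omega>)\<^sup>2 + ((z \<omega>) ^ 4 / r\<^sup>2 + r\<^sup>2 * (q \<omega>) ^ 4) / (2 * cutoff\<^sup>2)" for \<omega>
    proof (cases "\<bar>q \<omega>\<bar> \<le> cutoff")
      case True
      then have "moderate 0 \<omega> = 1" by (auto simp: moderate_def q_def abs_le_iff)
      then show ?thesis by simp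
    next
      case False
      then have "cutoff\<^sup>2 \<le> (q \<omega>)\<^sup>2"
        by (metis abs_le_square_iff abs_of_nonneg cutoff_def linorder_le_cases real_sqrt_ge_zero
            c2 c_pos less_imp_le)
      then have "(z \<omega>)\<^sup>2 * cutoff\<^sup>2 \<le> (z \<omega>)\<^sup>2 * (q \<omega>)\<^sup>2" by (intro mult_left_mono) auto
      also have "\<dots> = ((z \<omega>)\<^sup>2 / r) * (r * (q \<omega>)\<^sup>2)" using r by simp
      also have "\<dots> \<le> (((z \<omega>)\<^sup>2 / r)\<^sup>2 + (r * (q \<omega>)\<^sup>2)\<^sup>2) / 2"
        by (rule amgm)
      also have "\<dots> = ((z \<omega>) ^ 4 / r\<^sup>2 + r\<^sup>2 * (q \<omega>) ^ 4) / 2"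
        by (simp only: power_divide power_mult_distrib fourth)
      finally have "(z \<omega>)\<^sup>2 \<le> ((z \<omega>) ^ 4 / r\<^sup>2 + r\<^sup>2 * (q \<omega>) ^ 4) / 2 / cutoff\<^sup>2"
        using c_pos by (simp add: pos_le_divide_eq)
      moreover have "0 \<le> moderate 0 \<omega> * (z \<omega>)\<^sup>2" using moderate_nonneg by simp
      ultimately show ?thesis by simp
    qed
    define e where "e \<omega> = ((z \<omega>) ^ 4 / r\<^sup>2 + r\<^sup>2 * (q \<omega>) ^ 4) / (2 * cutoff\<^sup>2)" for \<omega>
    have iz: "integrable M (\<lambda>\<omega>. (z \<omega>) ^ 4 / r\<^sup>2)" and iq: "integrable M (\<lambda>\<omega>. r\<^sup>2 * (q \<omega>) ^ 4)"
      by (rule integrable_divide, rule z4(1)) (rule integrable_mult_right, rule q4)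
    have ie: "integrable M e"
      unfolding e_def[abs_def]
      by (rule integrable_divide, rule Bochner_Integration.integrable_add[OF iz iq])
    have ee: "expectation e
        = (expectation (\<lambda>\<omega>. (z \<omega>) ^ 4) / r\<^sup>2 + r\<^sup>2 * expectation (\<lambda>\<omega>. (q \<omega>) ^ 4)) / (2 * cutoff\<^sup>2)"
      unfolding e_def[abs_def] integral_divide_zero Bochner_Integration.integral_add[OF iz iq] integral_mult_right_zero ..
    have tail: "(4 * T ^ 4 * r ^ 4 / r\<^sup>2 + r\<^sup>2 * (4 * T ^ 4 * K ^ 4)) / (2 * cutoff\<^sup>2) = r\<^sup>2 / (2 * \<kappa>)"
    proof -
      define m where "m = 4 * T ^ 4 * (1 + K ^ 4)"
      have m: "m \<noteq> 0" using T_pos K4 by (simp add: m_def)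
      have "4 * T ^ 4 * r ^ 4 / r\<^sup>2 = 4 * T ^ 4 * r\<^sup>2"
        using r by (simp add: power2_eq_square power4_eq_xxxx)
      then have 1: "4 * T ^ 4 * r ^ 4 / r\<^sup>2 + r\<^sup>2 * (4 * T ^ 4 * K ^ 4) = r\<^sup>2 * m"
        by (simp add: algebra_simps m_def)
      have 2: "2 * cutoff\<^sup>2 = (2 * \<kappa>) * m" unfolding c2 m_def by simp
      show ?thesis unfolding 1 2 using m by simp
    qed
    have "r\<^sup>2 / \<kappa> \<le> expectation (\<lambda>\<omega>. (z \<omega>)\<^sup>2)"
      using second_moment_lower[of v] by (simp add: r2 z_def)
    also have "\<dots> \<le> expectation (\<lambda>\<omega>. moderate 0 \<omega> * (z \<omega>)\<^sup>2 + e \<omega>)"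
    proof (rule integral_mono)
      show "integrable M (\<lambda>\<omega>. (z \<omega>)\<^sup>2)"
        unfolding z_def dotp_square by (rule quadratic_form_expectation(1)[OF product_integrable[OF n0]])
      show "integrable M (\<lambda>\<omega>. moderate 0 \<omega> * (z \<omega>)\<^sup>2 + e \<omega>)"
        by (rule Bochner_Integration.integrable_add[OF int_wz ie])
    qed (unfold e_def, rule pw)
    also have "\<dots> = expectation (\<lambda>\<omega>. moderate 0 \<omega> * (z \<omega>)\<^sup>2)
        + (expectation (\<lambda>\<omega>. (z \<omega>) ^ 4) / r\<^sup>2 + r\<^sup>2 * expectation (\<lambda>\<omega>. (q \<omega>) ^ 4)) / (2 * cutoff\<^sup>2)"
      unfolding Bochner_Integration.integral_add[OF int_wz ie] ee ..
    also have "\<dots> \<le> expectation (\<lambda>\<omega>. moderate 0 \<omega> * (z \<omega>)\<^sup>2)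
        + (4 * T ^ 4 * r ^ 4 / r\<^sup>2 + r\<^sup>2 * (4 * T ^ 4 * K ^ 4)) / (2 * cutoff\<^sup>2)"
      using z4(2) q4b c_pos r by (intro add_left_mono divide_right_mono add_mono mult_left_mono) auto
    also have "\<dots> = expectation (\<lambda>\<omega>. moderate 0 \<omega> * (z \<omega>)\<^sup>2) + r\<^sup>2 / (2 * \<kappa>)"
      by (simp only: tail)
    finally have "r\<^sup>2 / \<kappa> \<le> expectation (\<lambda>\<omega>. moderate 0 \<omega> * (z \<omega>)\<^sup>2) + r\<^sup>2 / (2 * \<kappa>)" .
    moreover have "r\<^sup>2 / (2 * \<kappa>) = r\<^sup>2 / \<kappa> / 2" by (simp only: divide_divide_eq_left mult.commute)
    ultimately have "r\<^sup>2 / (2 * \<kappa>) \<le> expectation (\<lambda>\<omega>. moderate 0 \<omega> * (z \<omega>)\<^sup>2)" by linarith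
    then show ?thesis by (simp only: eq r_def)
  qed
qed

end

section \<open>Local strong convexity of the pseudo-likelihood\<close>

context ising_regression
begin

text \<open>
  Half the least second derivative of \<open>ln cosh\<close> at arguments of size at most \<open>cutoff + 2\<close>.
\<close>

definition curvature :: real where "curvature = (1 - (tanh (cutoff + 2))\<^sup>2) / 2"

lemma curvature_pos: "0 < curvature"
proof -
  have "\<bar>tanh (cutoff + 2)\<bar> < 1" using tanh_real_bounds[of "cutoff + 2"] by (simp add: abs_less_iff)
  then have "(tanh (cutoff + 2))\<^sup>2 < 1" by (simp add: abs_square_less_1)
  then show ?thesis by (simp add: curvature_def)
qed

lemma lasso_estimate_le:
  assumes "is_lasso_estimate d E g x z J lam b"
  shows "pseudo_loss d E g x z J b + lam * l1_norm d b \<le> pseudo_loss d E g x z J \<theta> + lam * l1_norm d \<theta>"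
  using assms param_Rd unfolding is_lasso_estimate_def is_arg_min_def by (meson not_le)

lemma loss_expansion_at_truth:
  "pseudo_loss d E g (\<lambda>i. X i \<omega>) (y \<omega>) I (\<lambda>k. \<theta> k + w k)
    = pseudo_loss d E g (\<lambda>i. X i \<omega>) (y \<omega>) I \<theta> + (\<Sum>k<d. - (1 / real (card I)) * score k \<omega> * w k)
      + 1 / real (card I) * (\<Sum>i\<in>I. ln (cosh (local_field E g (y \<omega>) i + dotp d (X i \<omega>) \<theta> + dotp d (X i \<omega>) w))
          - ln (cosh (local_field E g (y \<omega>) i + dotp d (X i \<omega>) \<theta>))
          - tanh (local_field E g (y \<omega>) i + dotp d (X i \<omega>) \<theta>) * dotp d (X i \<omega>) w)"
  unfolding score_def residual_def by (rule pseudo_loss_expansion) simp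

lemma loss_tangent:
  "pseudo_loss d E g (\<lambda>i. X i \<omega>) (y \<omega>) I \<theta> + (\<Sum>k<d. - (1 / real (card I)) * score k \<omega> * w k)
    \<le> pseudo_loss d E g (\<lambda>i. X i \<omega>) (y \<omega>) I (\<lambda>k. \<theta> k + w k)"
proof -
  have "0 \<le> ln (cosh (a + h)) - ln (cosh a) - tanh a * h" for a h :: real
    using ln_cosh_above_tangent[of a h] by simp
  then have "0 \<le> 1 / real (card I) * (\<Sum>i\<in>I. ln (cosh (local_field E g (y \<omega>) i + dotp d (X i \<omega>) \<theta> + dotp d (X i \<omega>) w))
          - ln (cosh (local_field E g (y \<omega>) i + dotp d (X i \<omega>) \<theta>))
          - tanh (local_field E g (y \<omega>) i + dotp d (X i \<omega>) \<theta>) * dotp d (X i \<omega>) w)"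
    by (intro mult_nonneg_nonneg sum_nonneg) auto
  then show ?thesis unfolding loss_expansion_at_truth by linarith
qed

lemma loss_segment:
  assumes t: "0 \<le> t" "t \<le> 1"
  shows "pseudo_loss d E g (\<lambda>i. X i \<omega>) (y \<omega>) I (\<lambda>k. \<theta> k + t * v k)
    \<le> (1 - t) * pseudo_loss d E g (\<lambda>i. X i \<omega>) (y \<omega>) I \<theta>
      + t * pseudo_loss d E g (\<lambda>i. X i \<omega>) (y \<omega>) I (\<lambda>k. \<theta> k + v k)"
proof -
  define D where "D w = (\<Sum>i\<in>I. ln (cosh (local_field E g (y \<omega>) i + dotp d (X i \<omega>) \<theta> + dotp d (X i \<omega>) w))
          - ln (cosh (local_field E g (y \<omega>) i + dotp d (X i \<omega>) \<theta>))
          - tanh (local_field E g (y \<omega>) i + dotp d (X i \<omega>) \<theta>) * dotp d (X i \<omega>) w)" for w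
  have dt: "dotp d z (\<lambda>k. t * v k) = t * dotp d z v" for z
    unfolding dotp_def sum_distrib_left by (intro sum.cong refl) simp
  have "ln (cosh (a + t * h)) - ln (cosh a) - tanh a * (t * h)
      \<le> t * (ln (cosh (a + h)) - ln (cosh a) - tanh a * h)" for a h :: real
    using ln_cosh_segment[OF t, of a h] by (simp add: algebra_simps)
  then have "D (\<lambda>k. t * v k) \<le> t * D v"
    unfolding D_def dt sum_distrib_left by (intro sum_mono)
  then have "1 / real (card I) * D (\<lambda>k. t * v k) \<le> 1 / real (card I) * (t * D v)"
    by (intro mult_left_mono) auto
  moreover have "(\<Sum>k<d. - (1 / real (card I)) * score k \<omega> * (t * v k))
      = t * (\<Sum>k<d. - (1 / real (card I)) * score k \<omega> * v k)"
    unfolding sum_distrib_left by (intro sum.cong refl) simp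
  ultimately show ?thesis
    unfolding loss_expansion_at_truth D_def[symmetric] by (simp add: algebra_simps)
qed

text \<open>
  Each gap between \<open>ln cosh\<close> and its tangent is nonnegative; at observations with moderate signal the
  argument stays within \<open>cutoff + 2\<close> (one unit for the local field, one for the perturbation), so the
  gap is at least quadratic. The sum of these quadratic terms is the quadratic form of the truncated
  Gram matrix, which is compared with its mean entry by entry.
\<close>

lemma loss_curvature:
  assumes \<omega>: "\<omega> \<in> space M"
    and gram_close: "\<And>k l. k < d \<Longrightarrow> l < d \<Longrightarrow> \<bar>gram k l \<omega> - real (card I) * gram_mean k l\<bar> \<le> real (card I) * \<delta>"
    and coords: "\<And>i k. i \<in> I \<Longrightarrow> k < d \<Longrightarrow> \<bar>X i \<omega> k\<bar> \<le> \<xi>" and \<xi>: "0 < \<xi>"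
    and w: "l1_norm d w \<le> 1 / \<xi>"
  shows "pseudo_loss d E g (\<lambda>i. X i \<omega>) (y \<omega>) I \<theta> + (\<Sum>k<d. - (1 / real (card I)) * score k \<omega> * w k)
      + curvature / (2 * \<kappa>) * (L2_set w {..<d})\<^sup>2 - curvature * \<delta> * (l1_norm d w)\<^sup>2
    \<le> pseudo_loss d E g (\<lambda>i. X i \<omega>) (y \<omega>) I (\<lambda>k. \<theta> k + w k)"
proof -
  let ?N = "real (card I)"
  define a where "a i = local_field E g (y \<omega>) i + dotp d (X i \<omega>) \<theta>" for i
  define h where "h i = dotp d (X i \<omega>) w" for i
  have site: "curvature * (moderate i \<omega> * (h i)\<^sup>2) \<le> ln (cosh (a i + h i)) - ln (cosh (a i)) - tanh (a i) * h i"
    if i: "i \<in> I" for i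
  proof (cases "moderate i \<omega> = 1")
    case True
    then have "\<bar>dotp d (X i \<omega>) \<theta>\<bar> \<le> cutoff"
      by (auto simp: moderate_def indicator_def abs_le_iff split: if_splits)
    moreover have "\<bar>local_field E g (y \<omega>) i\<bar> \<le> 1"
      by (intro abs_local_field_le_one[OF hypergraph I_less[OF i] weights[OF I_less[OF i]]] y_spins \<omega>)
    ultimately have "\<bar>a i\<bar> \<le> cutoff + 1" unfolding a_def by linarith
    moreover have "\<bar>h i\<bar> \<le> 1"
    proof -
      have "\<bar>h i\<bar> \<le> \<xi> * l1_norm d w" unfolding h_def by (rule abs_dotp_le) (rule coords[OF i])
      also have "\<dots> \<le> \<xi> * (1 / \<xi>)" using w \<xi> by (intro mult_left_mono) auto
      finally show ?thesis using \<xi> by simp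
    qed
    ultimately have "\<bar>a i\<bar> + \<bar>h i\<bar> \<le> cutoff + 2" by linarith
    from ln_cosh_strong_convexity[OF this] show ?thesis
      unfolding True curvature_def by simp
  next
    case False
    then have "moderate i \<omega> = 0" using moderate_cases by blast
    then show ?thesis using ln_cosh_above_tangent[of "a i" "h i"] by simp
  qed
  have quad: "(\<Sum>i\<in>I. moderate i \<omega> * (h i)\<^sup>2) = (\<Sum>k<d. \<Sum>l<d. gram k l \<omega> * w k * w l)"
  proof -
    have "(\<Sum>i\<in>I. moderate i \<omega> * (h i)\<^sup>2)
        = (\<Sum>i\<in>I. \<Sum>k<d. \<Sum>l<d. moderate i \<omega> * X i \<omega> k * X i \<omega> l * w k * w l)"
      unfolding h_def dotp_square sum_distrib_left by (simp only: mult.assoc)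
    also have "\<dots> = (\<Sum>k<d. \<Sum>i\<in>I. \<Sum>l<d. moderate i \<omega> * X i \<omega> k * X i \<omega> l * w k * w l)"
      by (rule sum.swap)
    also have "\<dots> = (\<Sum>k<d. \<Sum>l<d. \<Sum>i\<in>I. moderate i \<omega> * X i \<omega> k * X i \<omega> l * w k * w l)"
      by (intro sum.cong refl sum.swap)
    finally show ?thesis unfolding gram_def sum_distrib_right .
  qed
  have l1sq: "(l1_norm d w)\<^sup>2 = (\<Sum>k<d. \<Sum>l<d. \<bar>w k\<bar> * \<bar>w l\<bar>)"
    unfolding l1_norm_def power2_eq_square by (rule sum_product)
  have "?N * (\<Sum>k<d. \<Sum>l<d. gram_mean k l * w k * w l) - ?N * \<delta> * (l1_norm d w)\<^sup>2
      = (\<Sum>k<d. \<Sum>l<d. ?N * (gram_mean k l * w k * w l) - ?N * \<delta> * (\<bar>w k\<bar> * \<bar>w l\<bar>))"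
    unfolding l1sq by (simp add: sum_subtractf sum_distrib_left)
  also have "\<dots> \<le> (\<Sum>k<d. \<Sum>l<d. gram k l \<omega> * w k * w l)"
  proof (intro sum_mono)
    fix k l assume "k \<in> {..<d}" "l \<in> {..<d}"
    then have "\<bar>(gram k l \<omega> - ?N * gram_mean k l) * (w k * w l)\<bar> \<le> ?N * \<delta> * (\<bar>w k\<bar> * \<bar>w l\<bar>)"
      unfolding abs_mult using gram_close[of k l] by (intro mult_right_mono) auto
    then have "- (?N * \<delta> * (\<bar>w k\<bar> * \<bar>w l\<bar>)) \<le> (gram k l \<omega> - ?N * gram_mean k l) * (w k * w l)"
      by linarith
    then show "?N * (gram_mean k l * w k * w l) - ?N * \<delta> * (\<bar>w k\<bar> * \<bar>w l\<bar>) \<le> gram k l \<omega> * w k * w l"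
      by (simp add: algebra_simps)
  qed
  finally have "?N * (\<Sum>k<d. \<Sum>l<d. gram_mean k l * w k * w l) - ?N * \<delta> * (l1_norm d w)\<^sup>2
      \<le> (\<Sum>i\<in>I. moderate i \<omega> * (h i)\<^sup>2)" unfolding quad .
  moreover have "?N * ((L2_set w {..<d})\<^sup>2 / (2 * \<kappa>)) \<le> ?N * (\<Sum>k<d. \<Sum>l<d. gram_mean k l * w k * w l)"
    by (intro mult_left_mono truncated_second_moment_lower) auto
  ultimately have "?N * ((L2_set w {..<d})\<^sup>2 / (2 * \<kappa>) - \<delta> * (l1_norm d w)\<^sup>2) \<le> (\<Sum>i\<in>I. moderate i \<omega> * (h i)\<^sup>2)"
    by (simp add: algebra_simps)
  then have "curvature * (?N * ((L2_set w {..<d})\<^sup>2 / (2 * \<kappa>) - \<delta> * (l1_norm d w)\<^sup>2))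
      \<le> curvature * (\<Sum>i\<in>I. moderate i \<omega> * (h i)\<^sup>2)"
    using curvature_pos by (intro mult_left_mono) auto
  also have "\<dots> \<le> (\<Sum>i\<in>I. ln (cosh (a i + h i)) - ln (cosh (a i)) - tanh (a i) * h i)"
    unfolding sum_distrib_left by (intro sum_mono site)
  finally have "1 / ?N * (curvature * (?N * ((L2_set w {..<d})\<^sup>2 / (2 * \<kappa>) - \<delta> * (l1_norm d w)\<^sup>2)))
      \<le> 1 / ?N * (\<Sum>i\<in>I. ln (cosh (a i + h i)) - ln (cosh (a i)) - tanh (a i) * h i)"
    by (intro mult_left_mono) auto
  moreover have "1 / ?N * (curvature * (?N * ((L2_set w {..<d})\<^sup>2 / (2 * \<kappa>) - \<delta> * (l1_norm d w)\<^sup>2)))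
      = curvature / (2 * \<kappa>) * (L2_set w {..<d})\<^sup>2 - curvature * \<delta> * (l1_norm d w)\<^sup>2"
    using card_I_pos by (simp add: right_diff_distrib)
  ultimately show ?thesis
    unfolding loss_expansion_at_truth a_def h_def by linarith
qed

lemma lasso_error:
  assumes \<omega>: "\<omega> \<in> space M" and lam: "0 < lam"
    and est: "is_lasso_estimate d E g (\<lambda>i. X i \<omega>) (y \<omega>) I lam b"
    and score: "\<And>k. k < d \<Longrightarrow> \<bar>score k \<omega>\<bar> \<le> real (card I) * (lam / 2)"
    and gram_close: "\<And>k l. k < d \<Longrightarrow> l < d \<Longrightarrow> \<bar>gram k l \<omega> - real (card I) * gram_mean k l\<bar> \<le> real (card I) * \<delta>"
    and coords: "\<And>i k. i \<in> I \<Longrightarrow> k < d \<Longrightarrow> \<bar>X i \<omega> k\<bar> \<le> \<xi>" and \<xi>: "0 < \<xi>"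
    and \<delta>: "0 \<le> \<delta>" "64 * real (l0_norm d \<theta>) * \<delta> * \<kappa> \<le> 1"
    and radius: "96 * \<kappa> / curvature * lam * real (l0_norm d \<theta>) * \<xi> < 1"
  shows "L2_set (\<lambda>k. b k - \<theta> k) {..<d} \<le> 24 * \<kappa> / curvature * lam * sqrt (real (l0_norm d \<theta>))"
    and "l1_norm d (\<lambda>k. b k - \<theta> k) \<le> 96 * \<kappa> / curvature * lam * real (l0_norm d \<theta>)"
proof -
  let ?L = "pseudo_loss d E g (\<lambda>i. X i \<omega>) (y \<omega>) I"
  let ?G = "\<lambda>k. - (1 / real (card I)) * score k \<omega>"
  let ?v = "\<lambda>k. b k - \<theta> k"
  have \<alpha>: "0 < curvature / (2 * \<kappa>)" using curvature_pos kappa_pos by simp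
  have G: "\<bar>?G k\<bar> \<le> lam / 2" if "k < d" for k
    using score[OF that] card_I_pos by (simp add: abs_mult pos_divide_le_eq mult.commute)
  have small: "32 * real (l0_norm d \<theta>) * (curvature * \<delta>) \<le> curvature / (2 * \<kappa>)"
  proof -
    have "curvature * (64 * real (l0_norm d \<theta>) * \<delta> * \<kappa>) \<le> curvature * 1"
      using \<delta>(2) curvature_pos by (intro mult_left_mono) auto
    then show ?thesis using kappa_pos by (simp add: pos_le_divide_eq mult_ac)
  qed
  have rad: "48 * lam * real (l0_norm d \<theta>) / (curvature / (2 * \<kappa>)) < 1 / \<xi>"
    using radius \<xi> by (simp add: pos_less_divide_eq mult_ac)
  have opt: "?L (\<lambda>k. \<theta> k + ?v k) + lam * l1_norm d (\<lambda>k. \<theta> k + ?v k) \<le> ?L \<theta> + lam * l1_norm d \<theta>"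
    using lasso_estimate_le[OF est] by simp
  have cd: "0 \<le> curvature * \<delta>" using curvature_pos \<delta> by simp
  note bound = l1_penalized_error_bound[where L = ?L and G = ?G and v = ?v and \<theta> = \<theta> and \<rho> = "1 / \<xi>",
      OF lam \<alpha> cd G loss_tangent loss_segment
        loss_curvature[OF \<omega> gram_close coords \<xi>] small rad opt]
  show "L2_set ?v {..<d} \<le> 24 * \<kappa> / curvature * lam * sqrt (real (l0_norm d \<theta>))"
    using bound(1) by (simp add: mult_ac)
  show "l1_norm d ?v \<le> 96 * \<kappa> / curvature * lam * real (l0_norm d \<theta>)"
    using bound(2) by (simp add: mult_ac)
qed

text \<open>
  With an empty support the cone is \<open>{0}\<close>, so the gradient bound alone forces the estimator to equal
  the parameter.
\<close>

lemma lasso_exact_without_signal: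
  assumes lam: "0 < lam"
    and est: "is_lasso_estimate d E g (\<lambda>i. X i \<omega>) (y \<omega>) I lam b"
    and score: "\<And>k. k < d \<Longrightarrow> \<bar>score k \<omega>\<bar> \<le> real (card I) * (lam / 2)"
    and zero: "l0_norm d \<theta> = 0"
  shows "L2_set (\<lambda>k. b k - \<theta> k) {..<d} = 0" and "l1_norm d (\<lambda>k. b k - \<theta> k) = 0"
proof -
  let ?G = "\<lambda>k. - (1 / real (card I)) * score k \<omega>"
  let ?v = "\<lambda>k. b k - \<theta> k"
  have G: "\<bar>?G k\<bar> \<le> lam / 2" if "k < d" for k
    using score[OF that] card_I_pos by (simp add: abs_mult pos_divide_le_eq mult.commute)
  have "(\<Sum>k<d. ?G k * ?v k) + lam * l1_norm d (\<lambda>k. \<theta> k + ?v k) \<le> lam * l1_norm d \<theta>"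
    using lasso_estimate_le[OF est] loss_tangent[of \<omega> ?v] by simp
  from l1_penalty_cone[OF lam G this]
  have "l1_norm d ?v \<le> 4 * (\<Sum>k | k \<in> {..<d} \<and> \<theta> k \<noteq> 0. \<bar>?v k\<bar>)" .
  also have "{k \<in> {..<d}. \<theta> k \<noteq> 0} = {}"
    using zero unfolding l0_norm_def by (subst (asm) card_0_eq) auto
  finally show l1: "l1_norm d ?v = 0"
    using l1_norm_nonneg[of d ?v] by simp
  then have "\<forall>k\<in>{..<d}. \<bar>?v k\<bar> = 0"
    unfolding l1_norm_def by (subst (asm) sum_nonneg_eq_0_iff) auto
  then show "L2_set ?v {..<d} = 0" by (simp add: L2_set_def)
qed

lemma score_event:
  assumes "0 < lam"
  shows "{\<omega>\<in>space M. \<exists>k\<in>{..<d}. real (card I) * (lam / 2) < \<bar>score k \<omega>\<bar>} \<in> events"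
    and "prob {\<omega>\<in>space M. \<exists>k\<in>{..<d}. real (card I) * (lam / 2) < \<bar>score k \<omega>\<bar>}
      \<le> real d * (2 * exp (- (real (card I) * lam\<^sup>2 / (32 * T\<^sup>2))))"
proof -
  have ev: "{\<omega>\<in>space M. real (card I) * (lam / 2) < \<bar>score k \<omega>\<bar>} \<in> events" if "k \<in> {..<d}" for k
  proof -
    have [measurable]: "score k \<in> borel_measurable M" using score_measurable that by simp
    show ?thesis by measurable
  qed
  then show "{\<omega>\<in>space M. \<exists>k\<in>{..<d}. real (card I) * (lam / 2) < \<bar>score k \<omega>\<bar>} \<in> events"
    by (intro sets.sets_Collect_finite_Ex) auto
  have "prob {\<omega>\<in>space M. real (card I) * (lam / 2) < \<bar>score k \<omega>\<bar>}
      \<le> 2 * exp (- (real (card I) * lam\<^sup>2 / (32 * T\<^sup>2)))" if "k \<in> {..<d}" for k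
    using score_tail[of k "lam / 2"] that assms by (simp add: power_divide)
  from prob_finite_union_le[OF finite_lessThan ev this]
  show "prob {\<omega>\<in>space M. \<exists>k\<in>{..<d}. real (card I) * (lam / 2) < \<bar>score k \<omega>\<bar>}
      \<le> real d * (2 * exp (- (real (card I) * lam\<^sup>2 / (32 * T\<^sup>2))))" by simp
qed

lemma gram_event:
  assumes u: "0 < u" "u \<le> 8"
  shows "{\<omega>\<in>space M. \<exists>p\<in>{..<d} \<times> {..<d}. real (card I) * (u * T\<^sup>2)
        < \<bar>gram (fst p) (snd p) \<omega> - real (card I) * gram_mean (fst p) (snd p)\<bar>} \<in> events" (is "?A \<in> events")
    and "prob {\<omega>\<in>space M. \<exists>p\<in>{..<d} \<times> {..<d}. real (card I) * (u * T\<^sup>2)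
        < \<bar>gram (fst p) (snd p) \<omega> - real (card I) * gram_mean (fst p) (snd p)\<bar>}
      \<le> (real d)\<^sup>2 * (2 * exp (- (real (card I) * u\<^sup>2 / 32)))"
proof -
  let ?P = "\<lambda>p \<omega>. real (card I) * (u * T\<^sup>2) < \<bar>gram (fst p) (snd p) \<omega> - real (card I) * gram_mean (fst p) (snd p)\<bar>"
  have ev: "{\<omega>\<in>space M. ?P p \<omega>} \<in> events" if "p \<in> {..<d} \<times> {..<d}" for p
  proof -
    have [measurable]: "gram (fst p) (snd p) \<in> borel_measurable M"
      using that by (intro gram_measurable) auto
    show ?thesis by measurable
  qed
  then show "?A \<in> events"
    by (intro sets.sets_Collect_finite_Ex) auto
  have "prob {\<omega>\<in>space M. ?P p \<omega>} \<le> 2 * exp (- (real (card I) * u\<^sup>2 / 32))" if "p \<in> {..<d} \<times> {..<d}" for p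
    using that u by (intro gram_tail) auto
  from prob_finite_union_le[of "{..<d} \<times> {..<d}" ?P, OF _ ev this]
  show "prob ?A \<le> (real d)\<^sup>2 * (2 * exp (- (real (card I) * u\<^sup>2 / 32)))"
    by (simp add: card_cartesian_product power2_eq_square)
qed

lemma coordinate_event:
  assumes c: "0 \<le> c"
  shows "{\<omega>\<in>space M. \<exists>p\<in>I \<times> {..<d}. c < \<bar>X (fst p) \<omega> (snd p)\<bar>} \<in> events" (is "?A \<in> events")
    and "prob {\<omega>\<in>space M. \<exists>p\<in>I \<times> {..<d}. c < \<bar>X (fst p) \<omega> (snd p)\<bar>}
      \<le> real (card I) * real d * (2 * exp (- (c\<^sup>2 / T\<^sup>2)))"
proof -
  have ev: "{\<omega>\<in>space M. c < \<bar>X (fst p) \<omega> (snd p)\<bar>} \<in> events" if "p \<in> I \<times> {..<d}" for p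
  proof -
    have [measurable]: "(\<lambda>\<omega>. X (fst p) \<omega> (snd p)) \<in> borel_measurable M"
      using that I_less by (intro X_coordinate_measurable) auto
    show ?thesis by measurable
  qed
  then show "?A \<in> events"
    using finite_I by (intro sets.sets_Collect_finite_Ex) auto
  have "prob {\<omega>\<in>space M. c < \<bar>X (fst p) \<omega> (snd p)\<bar>} \<le> 2 * exp (- (c\<^sup>2 / T\<^sup>2))" if "p \<in> I \<times> {..<d}" for p
    using that I_less c by (intro coordinate_tail) auto
  from prob_finite_union_le[of "I \<times> {..<d}" "\<lambda>p \<omega>. c < \<bar>X (fst p) \<omega> (snd p)\<bar>", OF _ ev this]
  show "prob ?A \<le> real (card I) * real d * (2 * exp (- (c\<^sup>2 / T\<^sup>2)))"
    using finite_I by (simp add: card_cartesian_product)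
qed

end

section \<open>Error bounds for a fixed sample size\<close>

lemma exp_neg_le_inverse_power:
  fixes x e :: real
  assumes "0 < x" "real m * ln x \<le> e"
  shows "exp (- e) \<le> 1 / x ^ m"
proof -
  have "exp (- e) \<le> exp (- (real m * ln x))" using assms by simp
  also have "\<dots> = 1 / exp (real m * ln x)" by (simp add: exp_minus inverse_eq_divide)
  also have "exp (real m * ln x) = x ^ m" using assms by (simp add: exp_of_nat_mult)
  finally show ?thesis .
qed

context ising_regression
begin

text \<open>
  The constants in \<open>lam\<close>, \<open>u\<close> and \<open>\<xi>\<close> are chosen so that each of the three families of tail bounds,
  of sizes \<open>d\<close>, \<open>d\<^sup>2\<close> and at most \<open>n d\<close>, sums to at most \<open>2 / d\<close>. The smallness conditions refer to
  curvature and are imposed only when \<open>\<theta> \<noteq> 0\<close>.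
\<close>

lemma lasso_error_whp:
  assumes c: "0 < c" "c * real n \<le> real (card I)" and d2: "2 \<le> d"
    and lam: "lam = 8 * T / sqrt c * sqrt (ln (real d) / real n)"
    and u: "u = sqrt (96 / c) * sqrt (ln (real d) / real n)"
    and \<xi>: "\<xi> = T * sqrt (2 * ln (real n * real d))"
    and small: "l0_norm d \<theta> \<noteq> 0 \<Longrightarrow> u \<le> 8"
      "l0_norm d \<theta> \<noteq> 0 \<Longrightarrow> 64 * real (l0_norm d \<theta>) * (u * T\<^sup>2) * \<kappa> \<le> 1"
      "l0_norm d \<theta> \<noteq> 0 \<Longrightarrow> 96 * \<kappa> / curvature * lam * real (l0_norm d \<theta>) * \<xi> < 1"
  shows "\<exists>A\<in>events. 1 - 6 / real d \<le> prob A \<and>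
    (\<forall>\<omega>\<in>A. \<forall>b. is_lasso_estimate d E g (\<lambda>i. X i \<omega>) (y \<omega>) I lam b \<longrightarrow>
       L2_set (\<lambda>k. b k - \<theta> k) {..<d} \<le> 24 * \<kappa> / curvature * lam * sqrt (real (l0_norm d \<theta>)) \<and>
       l1_norm d (\<lambda>k. b k - \<theta> k) \<le> 96 * \<kappa> / curvature * lam * real (l0_norm d \<theta>))"
proof -
  let ?N = "real (card I)" and ?L = "ln (real d) / real n"
  have n0: "0 < real n" using n_pos by simp
  have lnd: "0 < ln (real d)" using d2 by simp
  have L: "0 < ?L" using lnd n0 by simp
  have lam0: "0 < lam" unfolding lam using T_pos c L by (intro mult_pos_pos divide_pos_pos) auto
  have u0: "0 < u" unfolding u using c L by (intro mult_pos_pos) auto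
  have nd: "real d \<le> real n * real d" using mult_right_mono[of 1 "real n" "real d"] n_pos by simp
  have ln_nd: "0 < ln (real n * real d)" using nd d2 by (intro ln_gt_zero) linarith
  have \<xi>0: "0 < \<xi>" unfolding \<xi> using T_pos ln_nd by (intro mult_pos_pos) auto
  \<comment> \<open>turns the exponents of the tail bounds into multiples of \<open>ln d\<close>\<close>
  have rate: "real m * ln (real d) \<le> ?N * (real m / c * ?L)" for m
  proof -
    have "real m * ln (real d) = c * real n * (real m / c * ?L)" using c n0 by simp
    also have "\<dots> \<le> ?N * (real m / c * ?L)"
      using c L by (intro mult_right_mono mult_nonneg_nonneg) auto
    finally show ?thesis .
  qed
  define A1 where "A1 = {\<omega>\<in>space M. \<exists>k\<in>{..<d}. ?N * (lam / 2) < \<bar>score k \<omega>\<bar>}"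
  define A2 where "A2 = {\<omega>\<in>space M. \<exists>p\<in>{..<d} \<times> {..<d}. ?N * (u * T\<^sup>2)
        < \<bar>gram (fst p) (snd p) \<omega> - ?N * gram_mean (fst p) (snd p)\<bar>}"
  define A3 where "A3 = {\<omega>\<in>space M. \<exists>p\<in>I \<times> {..<d}. \<xi> < \<bar>X (fst p) \<omega> (snd p)\<bar>}"
  have ev1: "A1 \<in> events" and ev3: "A3 \<in> events"
    unfolding A1_def A3_def using score_event(1)[OF lam0] coordinate_event(1) \<xi>0 by auto
  have "lam\<^sup>2 = 64 * T\<^sup>2 / c * ?L"
    unfolding lam power_mult_distrib power_divide real_sqrt_pow2[OF less_imp_le[OF L]]
      real_sqrt_pow2[OF less_imp_le[OF c(1)]] by simp
  then have "?N * lam\<^sup>2 / (32 * T\<^sup>2) = ?N * (real 2 / c * ?L)" using T_pos by simp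
  with rate[of 2] have "real 2 * ln (real d) \<le> ?N * lam\<^sup>2 / (32 * T\<^sup>2)" by (simp only:)
  then have "exp (- (?N * lam\<^sup>2 / (32 * T\<^sup>2))) \<le> 1 / real d ^ 2"
    using d2 by (intro exp_neg_le_inverse_power) auto
  then have "real d * (2 * exp (- (?N * lam\<^sup>2 / (32 * T\<^sup>2)))) \<le> real d * (2 * (1 / real d ^ 2))"
    by (intro mult_left_mono) auto
  with score_event(2)[OF lam0] have p1: "prob A1 \<le> 2 / real d"
    unfolding A1_def using d2 by (simp add: power2_eq_square)
  have "exp (- (\<xi>\<^sup>2 / T\<^sup>2)) \<le> 1 / (real n * real d) ^ 2"
  proof (rule exp_neg_le_inverse_power)
    show "real 2 * ln (real n * real d) \<le> \<xi>\<^sup>2 / T\<^sup>2"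
      unfolding \<xi> using T_pos ln_nd by (simp add: power_mult_distrib)
  qed (use n0 d2 in simp)
  then have "?N * real d * (2 * exp (- (\<xi>\<^sup>2 / T\<^sup>2))) \<le> ?N * real d * (2 * (1 / (real n * real d) ^ 2))"
    by (intro mult_left_mono) auto
  also have "\<dots> \<le> real n * real d * (2 * (1 / (real n * real d) ^ 2))"
  proof (intro mult_right_mono)
    show "?N \<le> real n" using card_mono[OF _ I_subset] by simp
  qed auto
  also have "\<dots> = 2 / (real n * real d)" using n0 d2 by (simp add: power2_eq_square)
  also have "\<dots> \<le> 2 / real d" using nd d2 by (intro divide_left_mono mult_pos_pos) (use n0 in auto)
  finally have p3: "prob A3 \<le> 2 / real d"
    using coordinate_event(2)[of \<xi>] \<xi>0 unfolding A3_def by linarith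
  show ?thesis
  proof (cases "l0_norm d \<theta> = 0")
    case True
    have "prob (space M - A1) = 1 - prob A1" by (rule prob_compl[OF ev1])
    moreover have "2 / real d \<le> 6 / real d" by (intro divide_right_mono) auto
    ultimately have pr: "1 - 6 / real d \<le> prob (space M - A1)" using p1 by linarith
    show ?thesis
    proof (intro bexI[of _ "space M - A1"] conjI pr ballI allI impI)
      fix \<omega> b assume w: "\<omega> \<in> space M - A1"
        and est: "is_lasso_estimate d E g (\<lambda>i. X i \<omega>) (y \<omega>) I lam b"
      have sc: "\<bar>score k \<omega>\<bar> \<le> ?N * (lam / 2)" if "k < d" for k
        using w that unfolding A1_def by (auto simp: not_less)
      note ex = lasso_exact_without_signal[OF lam0 est sc True]
      show "L2_set (\<lambda>k. b k - \<theta> k) {..<d} \<le> 24 * \<kappa> / curvature * lam * sqrt (real (l0_norm d \<theta>))"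
        "l1_norm d (\<lambda>k. b k - \<theta> k) \<le> 96 * \<kappa> / curvature * lam * real (l0_norm d \<theta>)"
        using ex True by simp_all
    qed (use ev1 in auto)
  next
    case False
    note sm = small(1)[OF False] small(2)[OF False] small(3)[OF False]
    have ev2: "A2 \<in> events" unfolding A2_def by (rule gram_event(1)[OF u0 sm(1)])
    have "u\<^sup>2 = 96 / c * ?L"
      unfolding u using c L by (simp add: power_mult_distrib)
    then have "?N * u\<^sup>2 / 32 = ?N * (real 3 / c * ?L)" by simp
    with rate[of 3] have "real 3 * ln (real d) \<le> ?N * u\<^sup>2 / 32" by (simp only:)
    then have "exp (- (?N * u\<^sup>2 / 32)) \<le> 1 / real d ^ 3"
      using d2 by (intro exp_neg_le_inverse_power) auto
    then have "(real d)\<^sup>2 * (2 * exp (- (?N * u\<^sup>2 / 32))) \<le> (real d)\<^sup>2 * (2 * (1 / real d ^ 3))"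
      by (intro mult_left_mono) auto
    also have "\<dots> = 2 / real d" using d2 by (simp add: power2_eq_square power3_eq_cube)
    finally have p2: "prob A2 \<le> 2 / real d"
      using gram_event(2)[OF u0 sm(1)] unfolding A2_def by linarith
    let ?A = "A1 \<union> A2 \<union> A3"
    have evA: "?A \<in> events" using ev1 ev2 ev3 by auto
    have "prob ?A \<le> prob (A1 \<union> A2) + prob A3" using ev1 ev2 ev3 by (intro measure_Un_le) auto
    also have "prob (A1 \<union> A2) \<le> prob A1 + prob A2" using ev1 ev2 by (intro measure_Un_le) auto
    finally have "prob ?A \<le> 6 / real d" using p1 p2 p3 by linarith
    moreover have "prob (space M - ?A) = 1 - prob ?A" by (rule prob_compl[OF evA])
    ultimately have pr: "1 - 6 / real d \<le> prob (space M - ?A)" by linarith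
    show ?thesis
    proof (intro bexI[of _ "space M - ?A"] conjI pr ballI allI impI)
      fix \<omega> b assume w: "\<omega> \<in> space M - ?A"
        and est: "is_lasso_estimate d E g (\<lambda>i. X i \<omega>) (y \<omega>) I lam b"
      have w0: "\<omega> \<in> space M" using w by simp
      have sc: "\<bar>score k \<omega>\<bar> \<le> ?N * (lam / 2)" if "k < d" for k
        using w that unfolding A1_def by (auto simp: not_less)
      have gr: "\<bar>gram k l \<omega> - ?N * gram_mean k l\<bar> \<le> ?N * (u * T\<^sup>2)" if "k < d" "l < d" for k l
        using w that unfolding A2_def by (auto simp: not_less)
      have co: "\<bar>X i \<omega> k\<bar> \<le> \<xi>" if "i \<in> I" "k < d" for i k
        using w that unfolding A3_def by (auto simp: not_less)
      have uT: "0 \<le> u * T\<^sup>2" using u0 by simp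
      show "L2_set (\<lambda>k. b k - \<theta> k) {..<d} \<le> 24 * \<kappa> / curvature * lam * sqrt (real (l0_norm d \<theta>))"
        "l1_norm d (\<lambda>k. b k - \<theta> k) \<le> 96 * \<kappa> / curvature * lam * real (l0_norm d \<theta>)"
        by (rule lasso_error[OF w0 lam0 est sc gr co \<xi>0 uT sm(2,3)], assumption+)+
    qed (use evA in auto)
  qed
qed

end

section \<open>Asymptotic error bounds\<close>

theorem proposition2p3:
  fixes M :: "nat \<Rightarrow> 'a measure"
    and d s :: "nat \<Rightarrow> nat"
    and E :: "nat \<Rightarrow> nat set set"
    and g :: "nat \<Rightarrow> nat set \<Rightarrow> real"
    and X :: "nat \<Rightarrow> nat \<Rightarrow> 'a \<Rightarrow> nat \<Rightarrow> real"
    and y :: "nat \<Rightarrow> 'a \<Rightarrow> nat \<Rightarrow> real"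
    and \<theta> :: "nat \<Rightarrow> nat \<Rightarrow> real"
    and S S1 S2 :: "nat \<Rightarrow> nat set"
    and K B \<kappa> :: real
    and D :: nat
  assumes prob: "\<And>n. 1 \<le> n \<Longrightarrow> prob_space (M n)"
    and dim: "\<And>n. 1 \<le> n \<Longrightarrow> 1 \<le> d n"
    and graph: "\<And>n. 1 \<le> n \<Longrightarrow> weighted_hypergraph n (E n) (g n)"
    and param: "\<And>n. 1 \<le> n \<Longrightarrow> \<theta> n \<in> Rd (d n)"
    and covariates: "\<And>n. 1 \<le> n \<Longrightarrow> iid_covariates (M n) n (d n) (X n)"
    and response: "\<And>n. 1 \<le> n \<Longrightarrow> ising_response (M n) n (d n) (E n) (g n) (\<theta> n) (X n) (y n)"
    and A1_weights: "\<And>n i. i < n \<Longrightarrow> (\<Sum>e | e \<in> E n \<and> i \<in> e. g n e) \<le> 1"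
    and A1_degree: "\<And>n i. i < n \<Longrightarrow> card (neighbours n (E n) i) \<le> D"
    and A2_sparse: "\<And>n. 1 \<le> n \<Longrightarrow> l0_norm (d n) (\<theta> n) = s n"
    and A2_K: "K > 0"
    and A2_norm: "\<And>n. 1 \<le> n \<Longrightarrow> L2_set (\<theta> n) {..<d n} \<le> K"
    and A3_subgauss: "\<And>n i. i < n \<Longrightarrow> subgauss_vec_norm (M n) (d n) (X n i) \<le> ennreal B"
    and A3_kappa: "\<kappa> > 0"
    and A3_min: "\<And>n. 1 \<le> n \<Longrightarrow> 1 / \<kappa> \<le> lambda_min (second_moment (M n) (d n) (X n 0))"
    and A3_max: "\<And>n. 1 \<le> n \<Longrightarrow> lambda_max (second_moment (M n) (d n) (X n 0)) \<le> \<kappa>"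
    and split_indep: "\<And>n. 1 \<le> n \<Longrightarrow> strong_independent n (E n) (S n)"
    and split_even: "\<And>n. 1 \<le> n \<Longrightarrow> even (card (S n))"
    and split_size: "(\<lambda>n. real (card (S n))) \<in> \<Omega>(\<lambda>n. real n)"
    and split_union: "\<And>n. 1 \<le> n \<Longrightarrow> S n = S1 n \<union> S2 n"
    and split_disjoint: "\<And>n. 1 \<le> n \<Longrightarrow> S1 n \<inter> S2 n = {}"
    and split_equal: "\<And>n. 1 \<le> n \<Longrightarrow> card (S1 n) = card (S2 n)"
    and d_infinity: "filterlim d at_top sequentially"
    and sparsity: "(\<lambda>n. real (s n)) \<in> o(\<lambda>n. sqrt (real n) / (sqrt (ln (real n)) * ln (real (d n))))"
    and rate: "(\<lambda>n. real (s n) * sqrt (ln (real (d n)) / real n)) \<in> o(\<lambda>_. 1)"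
  shows "\<exists>C>0. \<exists>K'. \<forall>\<theta>t :: nat \<Rightarrow> 'a \<Rightarrow> nat \<Rightarrow> real.
    (\<forall>\<^sub>F n in sequentially. \<forall>\<omega>\<in>space (M n).
       is_lasso_estimate (d n) (E n) (g n) (\<lambda>i. X n i \<omega>) (y n \<omega>) (S1 n)
         (C * sqrt (ln (real (d n)) / real n)) (\<theta>t n \<omega>)) \<longrightarrow>
    with_high_prob M (\<lambda>n \<omega>.
      L2_set (\<lambda>k. \<theta>t n \<omega> k - \<theta> n k) {..<d n} \<le> K' * sqrt (real (s n) * ln (real (d n)) / real n) \<and>
      l1_norm (d n) (\<lambda>k. \<theta>t n \<omega> k - \<theta> n k) \<le> K' * (real (s n) * sqrt (ln (real (d n)) / real n)))"
proof -
  define T where "T = ising_regression.T B"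
  define cv where "cv = ising_regression.curvature K B \<kappa>"
  obtain c0 where c0: "0 < c0" and size: "\<forall>\<^sub>F n in sequentially. c0 * real n \<le> real (card (S n))"
    using split_size unfolding bigomega_def by auto
  define c where "c = c0 / 2"
  have c: "0 < c" using c0 by (simp add: c_def)
  have card_S1: "c * real n \<le> real (card (S1 n))" if "1 \<le> n" "c0 * real n \<le> real (card (S n))" for n
  proof -
    have "finite (S n)" using split_indep[OF that(1)] unfolding strong_independent_def
      by (meson finite_lessThan finite_subset)
    then have "card (S n) = card (S1 n) + card (S2 n)"
      using split_union[OF that(1)] split_disjoint[OF that(1)] by (simp add: card_Un_disjoint)
    then show ?thesis using that split_equal[OF that(1)] by (simp add: c_def)
  qed
  have model: "ising_regression (M n) n (d n) (E n) (g n) (\<theta> n) (X n) (y n) (S1 n) K B \<kappa>"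
    if n: "1 \<le> n" and size: "c0 * real n \<le> real (card (S n))" for n
  proof -
    interpret prob_space "M n" by (rule prob[OF n])
    have fin: "finite (S n)" using split_indep[OF n] unfolding strong_independent_def
      by (meson finite_lessThan finite_subset)
    have sub: "S1 n \<subseteq> S n" using split_union[OF n] by auto
    have "card (S1 n \<inter> e) \<le> card (S n \<inter> e)" for e
      using fin sub by (intro card_mono) auto
    then have "strong_independent n (E n) (S1 n)"
      using split_indep[OF n] sub unfolding strong_independent_def by (meson order_trans)
    moreover have "S1 n \<noteq> {}"
    proof
      assume "S1 n = {}"
      then have "c * real n \<le> 0" using card_S1[OF n size] by simp
      then show False using c n by (simp add: mult_le_0_iff)
    qed
    ultimately show ?thesis
      by unfold_locales
        (use n dim graph param covariates response A1_weights A2_norm A3_subgauss A3_kappa A3_min in auto)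
  qed
  have "\<forall>\<^sub>F n in sequentially. 1 \<le> n \<and> c0 * real n \<le> real (card (S n))"
    using size eventually_ge_at_top[of 1] by eventually_elim simp
  then obtain n0 where n0: "1 \<le> n0" "c0 * real n0 \<le> real (card (S n0))"
    unfolding eventually_sequentially by blast
  have T: "0 < T" and cv: "0 < cv"
    using ising_regression.T_pos(1)[OF model[OF n0]] ising_regression.curvature_pos[OF model[OF n0]]
    by (simp_all add: T_def cv_def)
  define C where "C = 8 * T / sqrt c"
  define a where "a = sqrt (96 / c)"
  have C: "0 < C" and a: "0 < a" using T c by (auto simp: C_def a_def)
  define K' where "K' = max (24 * \<kappa> / cv * C) (96 * \<kappa> / cv * C)"
  \<comment> \<open>\<open>\<epsilon>1\<close> makes the entrywise deviation of the Gram matrix harmless on the cone; \<open>\<epsilon>2\<close> keeps the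
    product of the error radius and the largest entry of the design below \<open>1\<close>\<close>
  define \<epsilon>1 where "\<epsilon>1 = min (8 / a) (1 / (64 * T\<^sup>2 * \<kappa> * a))"
  define H where "H = 96 * \<kappa> / cv * C * T"
  define \<epsilon>2 where "\<epsilon>2 = 1 / (4 * H)"
  have H: "0 < H" using A3_kappa cv C T by (simp add: H_def)
  have \<epsilon>1: "0 < \<epsilon>1" "a * \<epsilon>1 \<le> 8" "64 * T\<^sup>2 * \<kappa> * a * \<epsilon>1 \<le> 1"
  proof -
    show "0 < \<epsilon>1" using a T A3_kappa by (simp add: \<epsilon>1_def)
    have "a * \<epsilon>1 \<le> a * (8 / a)" using a unfolding \<epsilon>1_def by (intro mult_left_mono) auto
    then show "a * \<epsilon>1 \<le> 8" using a by simp
    have "64 * T\<^sup>2 * \<kappa> * a * \<epsilon>1 \<le> 64 * T\<^sup>2 * \<kappa> * a * (1 / (64 * T\<^sup>2 * \<kappa> * a))"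
      using a T A3_kappa unfolding \<epsilon>1_def by (intro mult_left_mono) auto
    then show "64 * T\<^sup>2 * \<kappa> * a * \<epsilon>1 \<le> 1" using a T A3_kappa by simp
  qed
  have \<epsilon>2: "0 < \<epsilon>2" using H by (simp add: \<epsilon>2_def)
  define L where "L n = ln (real (d n)) / real n" for n
  define lam where "lam n = C * sqrt (L n)" for n
  define Good where "Good n \<longleftrightarrow> 3 \<le> n \<and> 3 \<le> d n \<and> c0 * real n \<le> real (card (S n))
      \<and> real (s n) * sqrt (L n) \<le> \<epsilon>1
      \<and> real (s n) \<le> \<epsilon>2 * (sqrt (real n) / (sqrt (ln (real n)) * ln (real (d n))))" for n
  have "\<forall>\<^sub>F n in sequentially. 3 \<le> d n"
    using d_infinity by (simp add: filterlim_at_top)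
  moreover have "\<forall>\<^sub>F n in sequentially. real (s n) * sqrt (L n) \<le> \<epsilon>1"
    using landau_o.smallD[OF rate \<epsilon>1(1)] unfolding L_def
    by eventually_elim simp
  moreover have "\<forall>\<^sub>F n in sequentially. real (s n) \<le> \<epsilon>2 * (sqrt (real n) / (sqrt (ln (real n)) * ln (real (d n))))"
    using landau_o.smallD[OF sparsity \<epsilon>2] eventually_ge_at_top[of 3] \<open>\<forall>\<^sub>F n in sequentially. 3 \<le> d n\<close>
    by eventually_elim (simp add: abs_mult)
  ultimately have Good: "\<forall>\<^sub>F n in sequentially. Good n"
    using size eventually_ge_at_top[of 3] unfolding Good_def by eventually_elim simp
  have whp: "\<exists>A\<in>sets (M n). 1 - 6 / real (d n) \<le> measure (M n) A \<and>
      (\<forall>\<omega>\<in>A. \<forall>b. is_lasso_estimate (d n) (E n) (g n) (\<lambda>i. X n i \<omega>) (y n \<omega>) (S1 n) (lam n) b \<longrightarrow>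
        L2_set (\<lambda>k. b k - \<theta> n k) {..<d n} \<le> K' * sqrt (real (s n) * ln (real (d n)) / real n) \<and>
        l1_norm (d n) (\<lambda>k. b k - \<theta> n k) \<le> K' * (real (s n) * sqrt (ln (real (d n)) / real n)))"
    if good: "Good n" for n
  proof -
    have n: "1 \<le> n" "3 \<le> n" "3 \<le> d n" and sz: "c0 * real n \<le> real (card (S n))"
      and r1: "real (s n) * sqrt (L n) \<le> \<epsilon>1"
      and r2: "real (s n) \<le> \<epsilon>2 * (sqrt (real n) / (sqrt (ln (real n)) * ln (real (d n))))"
      using good by (auto simp: Good_def)
    interpret R: ising_regression "M n" n "d n" "E n" "g n" "\<theta> n" "X n" "y n" "S1 n" K B \<kappa>
      by (rule model[OF n(1) sz])
    have TR: "R.T = T" and cR: "R.curvature = cv" by (simp_all add: T_def cv_def)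
    have l0: "l0_norm (d n) (\<theta> n) = s n" by (rule A2_sparse[OF n(1)])
    have ln3: "1 \<le> ln (real m)" if "3 \<le> m" for m :: nat
    proof -
      have "3 \<le> real m" using that by simp
      then have "exp 1 \<le> real m" using exp_le by (rule order_trans[rotated])
      then have "ln (exp 1) \<le> ln (real m)" by (intro ln_mono) auto
      then show ?thesis by simp
    qed
    have lnn: "1 \<le> ln (real n)" and lnd: "1 \<le> ln (real (d n))" using ln3 n by auto
    have L0: "0 < L n" using lnd n by (simp add: L_def)
    define u where "u = a * sqrt (L n)"
    define \<xi> where "\<xi> = T * sqrt (2 * ln (real n * real (d n)))"
    \<comment> \<open>for \<open>s \<ge> 1\<close> the rate condition also bounds \<open>ln d / n\<close>\<close>
    have u8: "u \<le> 8" if "s n \<noteq> 0"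
    proof -
      have "1 * sqrt (L n) \<le> real (s n) * sqrt (L n)"
        using that L0 by (intro mult_right_mono) auto
      then have "u \<le> a * \<epsilon>1" using r1 a unfolding u_def by (intro mult_left_mono) auto
      then show ?thesis using \<epsilon>1(2) by simp
    qed
    have gram_small: "64 * real (s n) * (u * T\<^sup>2) * \<kappa> \<le> 1"
    proof -
      have "64 * real (s n) * (u * T\<^sup>2) * \<kappa> = 64 * T\<^sup>2 * \<kappa> * a * (real (s n) * sqrt (L n))"
        by (simp add: u_def mult_ac)
      also have "\<dots> \<le> 64 * T\<^sup>2 * \<kappa> * a * \<epsilon>1"
        using r1 T A3_kappa a by (intro mult_left_mono) auto
      finally show ?thesis using \<epsilon>1(3) by simp
    qed
    have radius_small: "96 * \<kappa> / cv * lam n * real (s n) * \<xi> < 1"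
    proof -
      have "ln (real n * real (d n)) = ln (real n) + ln (real (d n))"
        using n by (intro ln_mult_pos) auto
      also have "\<dots> \<le> 2 * (ln (real n) * ln (real (d n)))"
      proof -
        have "ln (real n) * 1 \<le> ln (real n) * ln (real (d n))"
          using lnn lnd by (intro mult_left_mono) auto
        moreover have "1 * ln (real (d n)) \<le> ln (real n) * ln (real (d n))"
          using lnn lnd by (intro mult_right_mono) auto
        ultimately show ?thesis by linarith
      qed
      \<comment> \<open>both logarithms are at least \<open>1\<close>, so their sum is dominated by their product, which is the form
        of the sparsity condition\<close>
      finally have "sqrt (2 * ln (real n * real (d n))) \<le> sqrt (2\<^sup>2 * (ln (real n) * ln (real (d n))))"
        by (intro real_sqrt_le_mono) simp
      also have "\<dots> = 2 * (sqrt (ln (real n)) * sqrt (ln (real (d n))))"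
        by (simp add: real_sqrt_mult)
      finally have sq: "sqrt (2 * ln (real n * real (d n))) \<le> 2 * (sqrt (ln (real n)) * sqrt (ln (real (d n))))" .
      have "96 * \<kappa> / cv * lam n * real (s n) * \<xi>
          = H * (real (s n) * sqrt (L n) * sqrt (2 * ln (real n * real (d n))))"
        by (simp add: H_def lam_def \<xi>_def mult_ac)
      also have "\<dots> \<le> H * (real (s n) * sqrt (L n) * (2 * (sqrt (ln (real n)) * sqrt (ln (real (d n))))))"
        using H sq L0 by (intro mult_left_mono) auto
      also have "\<dots> = 2 * H * (real (s n) * (sqrt (ln (real n)) * (sqrt (ln (real (d n))) * sqrt (ln (real (d n))))) / sqrt (real n))"
        by (simp add: L_def real_sqrt_divide mult_ac)
      also have "sqrt (ln (real (d n))) * sqrt (ln (real (d n))) = ln (real (d n))"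
        using lnd by simp
      also have "real (s n) * (sqrt (ln (real n)) * ln (real (d n))) / sqrt (real n) \<le> \<epsilon>2"
      proof -
        have p: "0 < sqrt (ln (real n)) * ln (real (d n))" using lnn lnd by simp
        have "real (s n) * (sqrt (ln (real n)) * ln (real (d n)))
            \<le> \<epsilon>2 * (sqrt (real n) / (sqrt (ln (real n)) * ln (real (d n)))) * (sqrt (ln (real n)) * ln (real (d n)))"
          using r2 p by (intro mult_right_mono) auto
        also have "\<dots> = \<epsilon>2 * sqrt (real n)" using p by (metis less_irrefl mult.assoc nonzero_divide_eq_eq)
        finally show ?thesis using n by (simp add: pos_divide_le_eq)
      qed
      finally have "96 * \<kappa> / cv * lam n * real (s n) * \<xi> \<le> 2 * H * \<epsilon>2" using H by simp
      also have "\<dots> < 1" using H by (simp add: \<epsilon>2_def)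
      finally show ?thesis .
    qed
    have K2: "24 * \<kappa> / cv * lam n * sqrt (real (s n)) \<le> K' * sqrt (real (s n) * ln (real (d n)) / real n)"
    proof -
      have "24 * \<kappa> / cv * lam n * sqrt (real (s n)) = 24 * \<kappa> / cv * C * sqrt (real (s n) * ln (real (d n)) / real n)"
        by (simp add: lam_def L_def real_sqrt_mult real_sqrt_divide)
      also have "\<dots> \<le> K' * sqrt (real (s n) * ln (real (d n)) / real n)"
        using lnd by (intro mult_right_mono) (auto simp: K'_def)
      finally show ?thesis .
    qed
    have K1: "96 * \<kappa> / cv * lam n * real (s n) \<le> K' * (real (s n) * sqrt (ln (real (d n)) / real n))"
    proof -
      have "96 * \<kappa> / cv * lam n * real (s n) = 96 * \<kappa> / cv * C * (real (s n) * sqrt (ln (real (d n)) / real n))"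
        by (simp add: lam_def L_def)
      also have "\<dots> \<le> K' * (real (s n) * sqrt (ln (real (d n)) / real n))"
        using lnd by (intro mult_right_mono) (auto simp: K'_def)
      finally show ?thesis .
    qed
    have "\<exists>A\<in>sets (M n). 1 - 6 / real (d n) \<le> measure (M n) A \<and>
      (\<forall>\<omega>\<in>A. \<forall>b. is_lasso_estimate (d n) (E n) (g n) (\<lambda>i. X n i \<omega>) (y n \<omega>) (S1 n) (lam n) b \<longrightarrow>
        L2_set (\<lambda>k. b k - \<theta> n k) {..<d n} \<le> 24 * \<kappa> / cv * lam n * sqrt (real (s n)) \<and>
        l1_norm (d n) (\<lambda>k. b k - \<theta> n k) \<le> 96 * \<kappa> / cv * lam n * real (s n))"
      using R.lasso_error_whp[of c "lam n" u \<xi>, unfolded TR cR l0] c card_S1[OF n(1) sz] n(3)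
        u8 gram_small radius_small
      by (simp add: lam_def C_def L_def u_def a_def \<xi>_def)
    then show ?thesis using K1 K2 by (meson order_trans)
  qed
  have "with_high_prob M (\<lambda>n \<omega>.
      L2_set (\<lambda>k. \<theta>t n \<omega> k - \<theta> n k) {..<d n} \<le> K' * sqrt (real (s n) * ln (real (d n)) / real n) \<and>
      l1_norm (d n) (\<lambda>k. \<theta>t n \<omega> k - \<theta> n k) \<le> K' * (real (s n) * sqrt (ln (real (d n)) / real n)))"
    if est: "\<forall>\<^sub>F n in sequentially. \<forall>\<omega>\<in>space (M n).
       is_lasso_estimate (d n) (E n) (g n) (\<lambda>i. X n i \<omega>) (y n \<omega>) (S1 n)
         (C * sqrt (ln (real (d n)) / real n)) (\<theta>t n \<omega>)" for \<theta>t :: "nat \<Rightarrow> 'a \<Rightarrow> nat \<Rightarrow> real"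
  proof -
    let ?P = "\<lambda>n \<omega>. L2_set (\<lambda>k. \<theta>t n \<omega> k - \<theta> n k) {..<d n} \<le> K' * sqrt (real (s n) * ln (real (d n)) / real n) \<and>
      l1_norm (d n) (\<lambda>k. \<theta>t n \<omega> k - \<theta> n k) \<le> K' * (real (s n) * sqrt (ln (real (d n)) / real n))"
    \<comment> \<open>at the finitely many sample sizes that are not \<open>Ok\<close> the empty event is used\<close>
    define Ok where "Ok n \<longleftrightarrow> Good n \<and> (\<forall>\<omega>\<in>space (M n).
       is_lasso_estimate (d n) (E n) (g n) (\<lambda>i. X n i \<omega>) (y n \<omega>) (S1 n) (lam n) (\<theta>t n \<omega>))" for n
    have "\<forall>n. \<exists>A. A \<in> sets (M n) \<and> (\<forall>\<omega>\<in>A. ?P n \<omega>) \<and> (Ok n \<longrightarrow> 1 - 6 / real (d n) \<le> measure (M n) A)"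
    proof
      fix n
      show "\<exists>A. A \<in> sets (M n) \<and> (\<forall>\<omega>\<in>A. ?P n \<omega>) \<and> (Ok n \<longrightarrow> 1 - 6 / real (d n) \<le> measure (M n) A)"
      proof (cases "Ok n")
        case True
        then obtain A where A: "A \<in> sets (M n)" "1 - 6 / real (d n) \<le> measure (M n) A"
          and imp: "\<And>\<omega> b. \<omega> \<in> A \<Longrightarrow> is_lasso_estimate (d n) (E n) (g n) (\<lambda>i. X n i \<omega>) (y n \<omega>) (S1 n) (lam n) b \<Longrightarrow>
            L2_set (\<lambda>k. b k - \<theta> n k) {..<d n} \<le> K' * sqrt (real (s n) * ln (real (d n)) / real n) \<and>
            l1_norm (d n) (\<lambda>k. b k - \<theta> n k) \<le> K' * (real (s n) * sqrt (ln (real (d n)) / real n))"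
          using whp[of n] unfolding Ok_def by blast
        have "?P n \<omega>" if "\<omega> \<in> A" for \<omega>
          using imp[OF that] True sets.sets_into_space[OF A(1)] that unfolding Ok_def by blast
        with A show ?thesis by blast
      qed (auto intro: exI[of _ "{}"])
    qed
    from choice[OF this] obtain A where A: "\<And>n. A n \<in> sets (M n)" "\<And>n \<omega>. \<omega> \<in> A n \<Longrightarrow> ?P n \<omega>"
      and big: "\<And>n. Ok n \<Longrightarrow> 1 - 6 / real (d n) \<le> measure (M n) (A n)"
      by blast
    have Ok: "\<forall>\<^sub>F n in sequentially. Ok n"
      using Good est unfolding Ok_def lam_def L_def by (rule eventually_conj)
    have "(\<lambda>n. measure (M n) (A n)) \<longlonglongrightarrow> 1"
    proof (rule tendsto_sandwich)
      show "\<forall>\<^sub>F n in sequentially. 1 - 6 / real (d n) \<le> measure (M n) (A n)"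
        using Ok by eventually_elim (rule big)
      show "\<forall>\<^sub>F n in sequentially. measure (M n) (A n) \<le> 1"
        using eventually_ge_at_top[of 1] by eventually_elim (simp add: prob prob_space.prob_le_1)
      have "filterlim (\<lambda>n. real (d n)) at_top sequentially"
        by (rule filterlim_compose[OF filterlim_real_sequentially d_infinity])
      then have "(\<lambda>n. 1 - 6 / real (d n)) \<longlonglongrightarrow> 1 - 0"
        by (intro tendsto_diff tendsto_const tendsto_divide_0[OF tendsto_const] filterlim_at_top_imp_at_infinity)
      then show "(\<lambda>n. 1 - 6 / real (d n)) \<longlonglongrightarrow> 1" by simp
    qed simp
    with A show ?thesis unfolding with_high_prob_def by blast
  qed
  with C show ?thesis by blast
qed

end
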